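(* Let $\mathfrak{D}=\sum_{i=0}^m\Delta_i\otimes V(\ell_i)$ where each $\ell_i$ is a linear form in $\mathbb{C}[x_0,\dots,x_c]$, the $\Delta_i$ are $\sigma$-polyhedra, $\sum_i\Delta_i\subsetneq\sigma$, and the hyperplane arrangement $\{V(\ell_i)\}$ is of full rank and in general linear position. Let $w\in\mathrm{relint}(\tau)$ where $\tau$ is a maximal cone of $\mathrm{Trop}(L)$, $L$ being the image of $\mathbb{P}^c$ in $\mathbb{P}^m$ under $P\mapsto[\ell_0(P):\dots:\ell_m(P)]$, and let $\mathfrak{v}_w$ be a full rank valuation on $R(\mathfrak{D})$ associated with the maximal cone of $\mathrm{Trop}(J_{\mathfrak{D}})$ lifting $\tau$ (see context). Then the Newton-Okounkov cone $C(R(\mathfrak{D}),\mathfrak{v}_w)$ is isomorphic to $$\Big\{(v,u)\in\mathbb{R}^c\times\sigma^\vee_{\mathbb{R}}\ :\ \sum_{i=1}^cv_i\le\sum_{j\in\mathcal{I}}\Delta_j(u)\ \text{ and }\ v_j\ge-\Delta_{i_j}(u)\ \text{ for all }1\le j\le c\Big\},$$ where $\sigma^\vee_{\mathbb{R}}\subseteq M_{\mathbb{R}}$ is the real dual cone of $\sigma$, $\mathcal{I}$ is the set of indices in $\{0,\dots,m\}$ at which $w$ is minimized, and $\{i_1,\dots,i_c\}=\{0,\dots,m\}\setminus\mathcal{I}$.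
   Context: $N$ is a lattice of finite rank, $M=\mathrm{Hom}(N,\mathbb{Z})$, $\sigma\subset N_{\mathbb{Q}}$ a pointed rational polyhedral cone with dual $\sigma^\vee$. A $\sigma$-polyhedron is $\Delta=\Pi+\sigma$ with $\Pi\subset N_{\mathbb{Q}}$ a rational polytope (the empty set also allowed); $\Delta(u)=\min_{v\in\Delta}\langle u,v\rangle$ for $u$ in the dual cone, and $\infty$ if $\Delta=\emptyset$. Full rank and general linear position: any $c+1$ of the $\ell_i$ are linearly independent, and the $\ell_i$ span the linear forms. $R(\mathfrak{D})=\bigoplus_{u\in\sigma^\vee\cap M}H^0(\mathbb{P}^c,\mathcal{O}(\sum_i\lfloor\Delta_i(u)\rfloor V(\ell_i)))\chi^u$. With $t_i=x_i/x_0$ on the torus of $\mathbb{P}^m$, $e_1,\dots,e_m$ the standard basis of $\mathbb{R}^m$, $e_0=-\sum_{i\ge1}e_i$, let $\delta\subseteq\mathbb{R}^m\times N_{\mathbb{R}}$ be the positive hull of $(\{0\}\times\sigma)\cup\bigcup_{i=0}^m\{e_i\}\times\Delta_i$, and $\mathcal{H}$ a Hilbert basis of $\delta^\vee\cap(\mathbb{Z}^m\times M)$. $J_{\mathfrak{D}}$ is the kernel of the surjection $\phi:\mathbb{C}[x_{(h,h')}:(h,h')\in\mathcal{H}]\to R(\mathfrak{D})$ sending $x_{(h,h')}$ to the restriction of $t^h\chi^{h'}$ to $L\cong\mathbb{P}^c$, i.e. to $\prod_{i=1}^m(\ell_i/\ell_0)^{h_i}\chi^{h'}$. Tropical conventions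 are min: $\mathrm{Trop}(I)$ is the set of $w$ such that the ideal $\mathrm{in}_w(I)$ of minimal-weight initial forms contains no monomial. $\mathrm{Trop}(L)\subset\mathbb{R}^m\cong\mathbb{R}^{m+1}/\mathbb{R}(1,\dots,1)$ is the tropicalization of $L\cap T_{\mathbb{P}^m}$; it is the Bergman fan of the uniform matroid $U_{c+1,m+1}$ with maximal cones $\mathrm{cone}(e_{i_1},\dots,e_{i_c})$. A point $w=(w_1,\dots,w_m)$ is read as $(w_0=0,w_1,\dots,w_m)$ and $\mathcal{I}=\{i:w_i=\min_kw_k\}$. $\mathrm{Trop}(J_{\mathfrak{D}})$ is the image of $\mathrm{Trop}(L)\times N_{\mathbb{R}}$ under the injective linear map $\Phi(z)=(\langle h,z\rangle)_{h\in\mathcal{H}}$. The valuation: let $d=c+\mathrm{rk}(N)$, choose linearly independent rational vectors $\mathbf{u}_1,\dots,\mathbf{u}_d$ in the relatively open cone $\Phi(\mathrm{relint}(\tau)\times N_{\mathbb{R}})$, and let $A$ be the matrix with rows $\mathbf{u}_i$. For $p=\sum_ac_ax^a$ put $\tilde{\mathfrak{v}}(p)=\min\{Aa:c_a\ne0\}\in\mathbb{Q}^d$ (lexicographic order) and $\mathfrak{v}_w(f)=\max\{\tilde{\mathfrak{v}}(p):\phi(p)=f\}$ for $0\ne f\in R(\mathfrak{D})$. The Newton-Okounkov cone $C(R(\mathfrak{D}),\mathfrak{v}_w)\subset\mathbb{R}^d$ is the closure of the positive (convex) hull of the value semigroup $\{\mathfrak{v}_w(f):f\ne0\}$. Isomorphism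 of cones means by a linear isomorphism of the ambient real vector spaces. *)

theory Defs
  imports
    "HOL-Analysis.Analysis"
    "HOL-Analysis.Finite_Function_Topology"
    "HOL-Library.Poly_Mapping"
    "HOL-Library.Set_Algebras"
    "HOL-Computational_Algebra.Fraction_Field"
begin

text \<open>
  Vectors are finitely supported functions, and \<open>vecs A\<close> is the coordinate space
  with index set \<open>A\<close>.  After the choice of a basis, a lattice \<open>N\<close> of rank \<open>r\<close> and its dual
  \<open>M\<close> are \<open>vecs {..<r}\<close> over the integers (rank 0 is allowed), and \<open>\<real>\<^sup>m\<close> is
  \<open>vecs {1..m}\<close> over the reals.  Elements of \<open>N\<^sub>\<rat>\<close> are real vectors with rational entries.
  Linear structure and topology on real vectors are those of
  \<^theory>\<open>HOL-Analysis.Finite_Function_Topology\<close>.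
\<close>

type_synonym rvec = "nat \<Rightarrow>\<^sub>0 real"
type_synonym ivec = "nat \<Rightarrow>\<^sub>0 int"

definition vecs :: "'i set \<Rightarrow> ('i \<Rightarrow>\<^sub>0 'a::zero) set" where
  "vecs A = {v. Poly_Mapping.keys v \<subseteq> A}"

definition of_ivec :: "ivec \<Rightarrow> rvec" where
  "of_ivec = Poly_Mapping.map real_of_int"

definition pairing :: "rvec \<Rightarrow> rvec \<Rightarrow> real" where
  "pairing u v = (\<Sum>i\<in>Poly_Mapping.keys u. Poly_Mapping.lookup u i * Poly_Mapping.lookup v i)"

definition NQ :: "nat \<Rightarrow> rvec set" where
  "NQ r = {v \<in> vecs {..<r}. \<forall>i. Poly_Mapping.lookup v i \<in> \<rat>}"


subsection \<open>Polyhedra in the rational vector space of the lattice\<close>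

definition rational_polyhedral_cone :: "nat \<Rightarrow> rvec set \<Rightarrow> bool" where
  "rational_polyhedral_cone r \<sigma> \<longleftrightarrow>
     (\<exists>X. finite X \<and> X \<subseteq> NQ r \<and>
        \<sigma> = {\<Sum>x\<in>X. q x *\<^sub>R x | q. \<forall>x\<in>X. q x \<in> \<rat> \<and> 0 \<le> q x})"

definition pointed :: "rvec set \<Rightarrow> bool" where
  "pointed \<sigma> \<longleftrightarrow> (\<forall>v. v \<in> \<sigma> \<and> - v \<in> \<sigma> \<longrightarrow> v = 0)"

definition rational_polytope :: "nat \<Rightarrow> rvec set \<Rightarrow> bool" where
  "rational_polytope r P \<longleftrightarrow>
     (\<exists>X. finite X \<and> X \<subseteq> NQ r \<and>
        P = {\<Sum>x\<in>X. q x *\<^sub>R x | q. (\<forall>x\<in>X. q x \<in> \<rat> \<and> 0 \<le> q x) \<and> (\<Sum>x\<in>X. q x) = 1})"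

definition sigma_polyhedron :: "nat \<Rightarrow> rvec set \<Rightarrow> rvec set \<Rightarrow> bool" where
  "sigma_polyhedron r \<sigma> \<Delta> \<longleftrightarrow> \<Delta> = {} \<or> (\<exists>P. rational_polytope r P \<and> \<Delta> = P + \<sigma>)"

definition dual_cone :: "nat \<Rightarrow> rvec set \<Rightarrow> rvec set" where
  "dual_cone r \<sigma> = {u \<in> vecs {..<r}. \<forall>v\<in>\<sigma>. 0 \<le> pairing u v}"

text \<open>
  The number \<open>\<Delta>(u)\<close>.  For \<open>u\<close> in the dual cone the infimum over a nonempty \<open>\<sigma>\<close>-polyhedron is a
  minimum (attained at a vertex); for the empty polyhedron it is \<open>\<infinity>\<close>.
\<close>
definition supp_val :: "rvec set \<Rightarrow> rvec \<Rightarrow> ereal" where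
  "supp_val \<Delta> u = (INF v\<in>\<Delta>. ereal (pairing u v))"


subsection \<open>Polynomials\<close>

type_synonym 'v cpoly = "('v \<Rightarrow>\<^sub>0 nat) \<Rightarrow>\<^sub>0 complex"

definition polys :: "'v set \<Rightarrow> 'v cpoly set" where
  "polys V = {p. Poly_Mapping.keys p \<subseteq> vecs V}"

definition var :: "'v \<Rightarrow> 'v cpoly" where
  "var i = Poly_Mapping.single (Poly_Mapping.single i 1) 1"

definition const :: "complex \<Rightarrow> 'v cpoly" where
  "const z = Poly_Mapping.single 0 z"

definition eval_poly :: "(nat \<Rightarrow> complex) \<Rightarrow> nat cpoly \<Rightarrow> complex" where
  "eval_poly P p = (\<Sum>a\<in>Poly_Mapping.keys p. Poly_Mapping.lookup p a *
     (\<Prod>i\<in>Poly_Mapping.keys a. P i ^ Poly_Mapping.lookup a i))"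

definition hom_polys :: "nat \<Rightarrow> nat \<Rightarrow> nat cpoly set" where
  "hom_polys c e = {p \<in> polys {..c}. \<forall>a\<in>Poly_Mapping.keys p.
     (\<Sum>i\<in>Poly_Mapping.keys a. Poly_Mapping.lookup a i) = e}"

text \<open>Independence is that of the family, so repetitions among the forms are excluded as well.\<close>
definition general_full_rank :: "nat \<Rightarrow> nat \<Rightarrow> (nat \<Rightarrow> nat cpoly) \<Rightarrow> bool" where
  "general_full_rank c m l \<longleftrightarrow>
     (\<forall>S\<subseteq>{..m}. card S = c + 1 \<longrightarrow>
        (\<forall>a. (\<Sum>i\<in>S. const (a i) * l i) = 0 \<longrightarrow> (\<forall>i\<in>S. a i = 0))) \<and>
     (\<forall>p\<in>hom_polys c 1. \<exists>a. p = (\<Sum>i\<le>m. const (a i) * l i))"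


subsection \<open>The section ring of a polyhedral divisor\<close>

text \<open>Rational functions on \<open>\<bbbP>\<^sup>c\<close> are elements of the fraction field of the polynomial ring.\<close>
type_synonym ratfun = "nat cpoly fract"

definition to_rf :: "nat cpoly \<Rightarrow> ratfun" where
  "to_rf p = Fract p 1"

text \<open>The coordinate ring \<open>\<complex>[x\<^sub>0/x\<^sub>k, \<dots>, x\<^sub>c/x\<^sub>k]\<close> of the standard chart \<open>x\<^sub>k \<noteq> 0\<close> of \<open>\<bbbP>\<^sup>c\<close>.\<close>
definition chart_ring :: "nat \<Rightarrow> nat \<Rightarrow> ratfun set" where
  "chart_ring c k = {to_rf p / to_rf (var k) ^ e | p e. p \<in> hom_polys c e}"

text \<open>
  Global sections of \<open>\<O>(D)\<close> for the integral divisor \<open>D = \<Sum>\<^sub>i a\<^sub>i V(l\<^sub>i)\<close>.  On the chart \<open>x\<^sub>k \<noteq> 0\<close> the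
  divisor has the local equation \<open>\<Prod>\<^sub>i (l\<^sub>i/x\<^sub>k)\<^bsup>a\<^sub>i\<^esup>\<close>, and a rational function is a section of \<open>\<O>(D)\<close>
  there iff its product with the local equation is regular.
\<close>
definition sections :: "nat \<Rightarrow> nat \<Rightarrow> (nat \<Rightarrow> nat cpoly) \<Rightarrow> (nat \<Rightarrow> int) \<Rightarrow> ratfun set" where
  "sections c m l a =
     {f. \<forall>k\<le>c. f * (\<Prod>i\<le>m. (to_rf (l i) / to_rf (var k)) powi a i) \<in> chart_ring c k}"

text \<open>A coefficient \<open>\<infinity>\<close> (from an empty polyhedron) means that poles of any order are allowed.\<close>
definition graded_piece ::
    "nat \<Rightarrow> nat \<Rightarrow> (nat \<Rightarrow> nat cpoly) \<Rightarrow> (nat \<Rightarrow> rvec set) \<Rightarrow> ivec \<Rightarrow> ratfun set" where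
  "graded_piece c m l \<Delta> u =
     {f. \<exists>a. f \<in> sections c m l a \<and>
        (\<forall>i\<le>m. supp_val (\<Delta> i) (of_ivec u) \<noteq> \<infinity> \<longrightarrow>
                a i = \<lfloor>real_of_ereal (supp_val (\<Delta> i) (of_ivec u))\<rfloor>)}"

text \<open>The ambient ring \<^typ>\<open>ivec \<Rightarrow>\<^sub>0 ratfun\<close> is the group algebra; \<open>\<chi>\<^sup>u\<close> is \<open>single u 1\<close>.\<close>
definition section_ring ::
    "nat \<Rightarrow> nat \<Rightarrow> nat \<Rightarrow> rvec set \<Rightarrow> (nat \<Rightarrow> nat cpoly) \<Rightarrow> (nat \<Rightarrow> rvec set) \<Rightarrow> (ivec \<Rightarrow>\<^sub>0 ratfun) set" where
  "section_ring c m r \<sigma> l \<Delta> =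
     {F. \<forall>u\<in>Poly_Mapping.keys F.
          u \<in> vecs {..<r} \<and> of_ivec u \<in> dual_cone r \<sigma> \<and>
          Poly_Mapping.lookup F u \<in> graded_piece c m l \<Delta> u}"


subsection \<open>Generators\<close>

definition evec :: "nat \<Rightarrow> nat \<Rightarrow> rvec" where
  "evec m i = (if i = 0 then - (\<Sum>j=1..m. Poly_Mapping.single j 1) else Poly_Mapping.single i 1)"

definition delta_cone :: "nat \<Rightarrow> rvec set \<Rightarrow> (nat \<Rightarrow> rvec set) \<Rightarrow> (rvec \<times> rvec) set" where
  "delta_cone m \<sigma> \<Delta> = convex_cone hull (({0} \<times> \<sigma>) \<union> (\<Union>i\<le>m. {evec m i} \<times> \<Delta> i))"

definition dual_lattice_points ::
    "nat \<Rightarrow> nat \<Rightarrow> (rvec \<times> rvec) set \<Rightarrow> (ivec \<times> ivec) set" where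
  "dual_lattice_points m r C =
     {(h, h'). h \<in> vecs {1..m} \<and> h' \<in> vecs {..<r} \<and>
        (\<forall>(x, y)\<in>C. 0 \<le> pairing (of_ivec h) x + pairing (of_ivec h') y)}"

text \<open>A finite generating set of the monoid; irredundancy is not required.\<close>
definition hilbert_basis :: "'a::comm_monoid_add set \<Rightarrow> 'a set \<Rightarrow> bool" where
  "hilbert_basis H G \<longleftrightarrow>
     finite H \<and> (\<lambda>S. 0 \<in> S \<and> (\<forall>x\<in>S. \<forall>y\<in>S. x + y \<in> S)) hull H = G"

text \<open>The restriction to \<open>L \<cong> \<bbbP>\<^sup>c\<close> of \<open>t\<^sup>h \<chi>\<^bsup>h'\<^esup>\<close>.\<close>
definition generator ::
    "nat \<Rightarrow> (nat \<Rightarrow> nat cpoly) \<Rightarrow> ivec \<times> ivec \<Rightarrow> (ivec \<Rightarrow>\<^sub>0 ratfun)" where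
  "generator m l = (\<lambda>(h, h').
     Poly_Mapping.single h'
       (\<Prod>i=1..m. (to_rf (l i) / to_rf (l 0)) powi Poly_Mapping.lookup h i))"

definition phi ::
    "nat \<Rightarrow> (nat \<Rightarrow> nat cpoly) \<Rightarrow> (ivec \<times> ivec) cpoly \<Rightarrow> (ivec \<Rightarrow>\<^sub>0 ratfun)" where
  "phi m l p = (\<Sum>a\<in>Poly_Mapping.keys p.
     Poly_Mapping.single 0 (to_rf (const (Poly_Mapping.lookup p a))) *
     (\<Prod>g\<in>Poly_Mapping.keys a. generator m l g ^ Poly_Mapping.lookup a g))"


subsection \<open>Tropicalization (min convention)\<close>

definition weight :: "rvec \<Rightarrow> (nat \<Rightarrow>\<^sub>0 nat) \<Rightarrow> real" where
  "weight w a = (\<Sum>i\<in>Poly_Mapping.keys a. Poly_Mapping.lookup w i * real (Poly_Mapping.lookup a i))"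

definition initial_form :: "rvec \<Rightarrow> nat cpoly \<Rightarrow> nat cpoly" where
  "initial_form w p =
     (\<Sum>a\<in>{a \<in> Poly_Mapping.keys p. weight w a = Min (weight w ` Poly_Mapping.keys p)}.
        Poly_Mapping.single a (Poly_Mapping.lookup p a))"

definition ideal_of_polys :: "'v set \<Rightarrow> 'v cpoly set \<Rightarrow> bool" where
  "ideal_of_polys V J \<longleftrightarrow> J \<subseteq> polys V \<and> 0 \<in> J \<and>
     (\<forall>p\<in>J. \<forall>q\<in>J. p + q \<in> J) \<and> (\<forall>p\<in>J. \<forall>q\<in>polys V. q * p \<in> J)"

definition initial_ideal :: "nat \<Rightarrow> rvec \<Rightarrow> nat cpoly set \<Rightarrow> nat cpoly set" where
  "initial_ideal m w J = ideal_of_polys {..m} hull (initial_form w ` J)"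

text \<open>
  Elements of \<open>\<real>\<^sup>m \<cong> \<real>\<^bsup>m+1\<^esup>/\<real>(1,\<dots>,1)\<close> are represented with \<open>w\<^sub>0 = 0\<close>: membership in
  \<open>vecs {1..m}\<close> says that the entry of index 0 vanishes.
\<close>
definition Trop :: "nat \<Rightarrow> nat cpoly set \<Rightarrow> rvec set" where
  "Trop m J = {w \<in> vecs {1..m}.
     \<not> (\<exists>a\<in>vecs {..m}. Poly_Mapping.single a 1 \<in> initial_ideal m w J)}"

text \<open>The homogeneous ideal of the image \<open>L\<close> of \<open>\<bbbP>\<^sup>c\<close> in \<open>\<bbbP>\<^sup>m\<close>.\<close>
definition vanishing_ideal :: "nat \<Rightarrow> (nat \<Rightarrow> nat cpoly) \<Rightarrow> nat cpoly set" where
  "vanishing_ideal m l =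
     {p \<in> polys {..m}. \<forall>P. eval_poly (\<lambda>i. eval_poly P (l i)) p = 0}"

text \<open>The cones of the fan of \<open>\<bbbP>\<^sup>m\<close>, which induces the fan structure on \<open>Trop(L)\<close>.\<close>
definition coordinate_cones :: "nat \<Rightarrow> rvec set set" where
  "coordinate_cones m = {convex_cone hull (evec m ` S) | S. S \<subset> {..m}}"

definition maximal_trop_cone :: "nat \<Rightarrow> (nat \<Rightarrow> nat cpoly) \<Rightarrow> rvec set \<Rightarrow> bool" where
  "maximal_trop_cone m l \<tau> \<longleftrightarrow>
     \<tau> \<in> coordinate_cones m \<and> \<tau> \<subseteq> Trop m (vanishing_ideal m l) \<and>
     (\<forall>\<tau>'\<in>coordinate_cones m. \<tau>' \<subseteq> Trop m (vanishing_ideal m l) \<and> \<tau> \<subseteq> \<tau>' \<longrightarrow> \<tau>' = \<tau>)"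


subsection \<open>Valuation and Newton-Okounkov cone\<close>

text \<open>The map \<open>\<Phi>\<close> with values in the coordinate space \<open>vecs H\<close>.\<close>
definition Phi :: "(ivec \<times> ivec) set \<Rightarrow> rvec \<times> rvec \<Rightarrow> ((ivec \<times> ivec) \<Rightarrow>\<^sub>0 real)" where
  "Phi H z = (\<Sum>(h, h')\<in>H.
     Poly_Mapping.single (h, h') (pairing (of_ivec h) (fst z) + pairing (of_ivec h') (snd z)))"

text \<open>
  Matrices given by their rows \<open>A 0, \<dots>, A (d - 1)\<close>.  \<open>Phi\<close> identifies \<open>Trop(L) \<times> N\<^sub>\<real>\<close> with the
  tropicalization of the kernel of \<open>phi\<close>; the cone lifting \<open>\<tau>\<close> is the image of \<open>\<tau> \<times> N\<^sub>\<real>\<close>.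
\<close>
definition weight_matrix ::
    "nat \<Rightarrow> nat \<Rightarrow> (ivec \<times> ivec) set \<Rightarrow> rvec set \<Rightarrow> (nat \<Rightarrow> ((ivec \<times> ivec) \<Rightarrow>\<^sub>0 real)) \<Rightarrow> bool" where
  "weight_matrix d r H \<tau> A \<longleftrightarrow>
     (\<forall>k<d. A k \<in> Phi H ` (rel_interior \<tau> \<times> vecs {..<r}) \<and> (\<forall>g. Poly_Mapping.lookup (A k) g \<in> \<rat>)) \<and>
     inj_on A {..<d} \<and> independent (A ` {..<d})"

definition mat_exponent ::
    "nat \<Rightarrow> (nat \<Rightarrow> ('v \<Rightarrow>\<^sub>0 real)) \<Rightarrow> ('v \<Rightarrow>\<^sub>0 nat) \<Rightarrow> rvec" where
  "mat_exponent d A a = (\<Sum>k<d. Poly_Mapping.single k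
     (\<Sum>g\<in>Poly_Mapping.keys a. Poly_Mapping.lookup (A k) g * real (Poly_Mapping.lookup a g)))"

text \<open>
  The linear order on \<^typ>\<open>rvec\<close> (see \<^theory>\<open>HOL-Library.Fun_Lexorder\<close>) is the lexicographic one,
  entries of smaller index being compared first.
\<close>
definition pre_valuation :: "nat \<Rightarrow> (nat \<Rightarrow> ('v \<Rightarrow>\<^sub>0 real)) \<Rightarrow> 'v cpoly \<Rightarrow> rvec" where
  "pre_valuation d A p = Min (mat_exponent d A ` Poly_Mapping.keys p)"

definition valuation ::
    "nat \<Rightarrow> nat \<Rightarrow> (nat \<Rightarrow> nat cpoly) \<Rightarrow> (ivec \<times> ivec) set \<Rightarrow> (nat \<Rightarrow> ((ivec \<times> ivec) \<Rightarrow>\<^sub>0 real))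
       \<Rightarrow> (ivec \<Rightarrow>\<^sub>0 ratfun) \<Rightarrow> rvec" where
  "valuation d m l H A f =
     (GREATEST y. \<exists>p\<in>polys H. phi m l p = f \<and> y = pre_valuation d A p)"

definition newton_okounkov_cone :: "('f::zero) set \<Rightarrow> ('f \<Rightarrow> rvec) \<Rightarrow> rvec set" where
  "newton_okounkov_cone R v = closure (convex_cone hull (v ` (R - {0})))"

definition cones_isomorphic ::
    "'a::real_vector set \<Rightarrow> 'a set \<Rightarrow> 'b::real_vector set \<Rightarrow> 'b set \<Rightarrow> bool" where
  "cones_isomorphic V C W D \<longleftrightarrow> (\<exists>f. linear f \<and> bij_betw f V W \<and> f ` C = D)"

definition minimizing_indices :: "nat \<Rightarrow> rvec \<Rightarrow> nat set" where
  "minimizing_indices m w =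
     {i. i \<le> m \<and> Poly_Mapping.lookup w i = Min (Poly_Mapping.lookup w ` {..m})}"

end

theory Submission
  imports Defs "HOL-Analysis.Kronecker_Approximation_Theorem"
begin

text \<open>
  Let \<open>S\<close> be the set of indices at which \<open>w\<close> is not minimized.  It has \<open>c\<close> elements, and \<open>\<tau>\<close> is spanned
  by the vectors \<open>e\<^sub>i\<close>, \<open>i \<in> S\<close>.  By general position the forms \<open>l\<^sub>i\<close>, \<open>i \<in> S\<close>, are local coordinates of
  \<open>\<bbbP>\<^sup>c\<close> at the point where they all vanish, and no other form of the arrangement vanishes there.

  The rows of \<open>A\<close> pair with the exponent \<open>(h, u)\<close> of a character \<open>t\<^sup>h \<chi>\<^sup>u\<close> only through its local exponent,
  which consists of the homogeneous exponents of \<open>h\<close> on \<open>S\<close> and of \<open>u\<close>.  So the valuation is the monomial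
  valuation at that point: one expands a section in the local coordinates and takes the smallest
  weight of an exponent.  One half of this is that leading terms do not cancel, in the form that
  the minimal weight of a relation between the generators is attained at least twice
  (\<open>minimal_monomial_not_cancelled\<close>, \<open>minimum_attained_twice\<close>, \<open>valuation_phi\<close>).  The other half is
  that every section is a combination of characters in the dual of \<open>\<delta>\<close> with distinct local
  exponents (\<open>section_expansion\<close>, \<open>section_ring_preimage\<close>).  Consequently the values are
  exactly the weights of the local exponents of the lattice points of the dual of \<open>\<delta>\<close>
  (\<open>values_of_section_ring\<close>).

  A vector \<open>(v, u)\<close> is the local exponent of a real point of the dual of \<open>\<delta>\<close> iff the remaining
  homogeneous exponents can be chosen with \<open>h\<^sub>j \<ge> - \<Delta>\<^sub>j(u)\<close> and total sum zero; eliminating them leaves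
  the inequality between \<open>\<Sum>\<^sub>i v\<^sub>i\<close> and \<open>\<Sum>\<^sub>j \<Delta>\<^sub>j(u)\<close>.  The dual of \<open>\<delta>\<close> is a rational cone, so by Diophantine
  approximation its lattice points come arbitrarily close to every ray
  (\<open>integral_points_near_ray\<close>, \<open>support_cone_subset_closure\<close>).  Finally, the weight is an
  invertible linear function of the local exponent, because \<open>A\<close> has \<open>c + r\<close> independent rows
  (\<open>bij_betw_weight_map\<close>), and its inverse is the isomorphism of cones.
\<close>


abbreviation entry :: "('i \<Rightarrow>\<^sub>0 'a::zero) \<Rightarrow> 'i \<Rightarrow> 'a" where
  "entry \<equiv> Poly_Mapping.lookup"

abbreviation supp :: "('i \<Rightarrow>\<^sub>0 'a::zero) \<Rightarrow> 'i set" where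
  "supp \<equiv> Poly_Mapping.keys"


section \<open>Evaluating polynomials in a ring\<close>

definition monom_eval :: "('v \<Rightarrow> 'b::comm_monoid_mult) \<Rightarrow> ('v \<Rightarrow>\<^sub>0 nat) \<Rightarrow> 'b" where
  "monom_eval X a = (\<Prod>i\<in>supp a. X i ^ entry a i)"

lemma monom_eval_superset:
  "finite K \<Longrightarrow> supp a \<subseteq> K \<Longrightarrow> monom_eval X a = (\<Prod>i\<in>K. X i ^ entry a i)"
  unfolding monom_eval_def
  by (rule prod.mono_neutral_left) (auto simp: in_keys_iff)

lemma monom_eval_0 [simp]: "monom_eval X 0 = 1"
  by (simp add: monom_eval_def)

lemma monom_eval_single [simp]: "monom_eval X (Poly_Mapping.single i n) = X i ^ n"
  by (simp add: monom_eval_def)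

lemma monom_eval_add: "monom_eval X (a + b) = monom_eval X a * monom_eval X b"
proof -
  let ?K = "supp a \<union> supp b"
  have "monom_eval X (a + b) = (\<Prod>i\<in>?K. X i ^ entry (a + b) i)"
    by (rule monom_eval_superset) (simp_all add: keys_add)
  also have "\<dots> = (\<Prod>i\<in>?K. X i ^ entry a i) * (\<Prod>i\<in>?K. X i ^ entry b i)"
    by (simp add: lookup_add power_add prod.distrib)
  also have "(\<Prod>i\<in>?K. X i ^ entry a i) = monom_eval X a"
    by (rule monom_eval_superset [symmetric]) auto
  also have "(\<Prod>i\<in>?K. X i ^ entry b i) = monom_eval X b"
    by (rule monom_eval_superset [symmetric]) auto
  finally show ?thesis .
qed

lemma sum_supp_superset:
  assumes "finite K" "supp p \<subseteq> K" "\<And>a. F a 0 = 0"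
  shows "(\<Sum>a\<in>supp p. F a (entry p a)) = (\<Sum>a\<in>K. F a (entry p a))"
  using assms by (intro sum.mono_neutral_left) (auto simp: in_keys_iff)

lemma sum_single_supp: "(\<Sum>a\<in>supp p. Poly_Mapping.single a (entry p a)) = p"
proof (rule poly_mapping_eqI)
  fix k
  show "entry (\<Sum>a\<in>supp p. Poly_Mapping.single a (entry p a)) k = entry p k"
    by (cases "k \<in> supp p") (auto simp: lookup_sum lookup_single when_def in_keys_iff)
qed

text \<open>
  The coefficients enter through a map \<open>e\<close>, so that one notion covers substitution of polynomials
  into polynomials and the map \<open>phi\<close> into the group algebra.
\<close>
definition insertion ::
    "(complex \<Rightarrow> 'b::comm_semiring_1) \<Rightarrow> ('v \<Rightarrow> 'b) \<Rightarrow> 'v cpoly \<Rightarrow> 'b" where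
  "insertion e X p = (\<Sum>a\<in>supp p. e (entry p a) * monom_eval X a)"

locale coefficient_map =
  fixes e :: "complex \<Rightarrow> 'b::comm_ring_1"
  assumes e_0: "e 0 = 0" and e_1: "e 1 = 1"
    and e_add: "e (x + y) = e x + e y" and e_mult: "e (x * y) = e x * e y"
begin

lemma insertion_superset:
  assumes "finite K" "supp p \<subseteq> K"
  shows "insertion e X p = (\<Sum>a\<in>K. e (entry p a) * monom_eval X a)"
  unfolding insertion_def
  by (rule sum_supp_superset [where F = "\<lambda>a z. e z * monom_eval X a"]) (use assms e_0 in auto)

lemma insertion_0 [simp]: "insertion e X 0 = 0"
  by (simp add: insertion_def)

lemma insertion_single: "insertion e X (Poly_Mapping.single a z) = e z * monom_eval X a"
  by (simp add: insertion_def e_0)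

lemma insertion_add: "insertion e X (p + q) = insertion e X p + insertion e X q"
proof -
  let ?K = "supp p \<union> supp q"
  have "insertion e X (p + q) = (\<Sum>a\<in>?K. e (entry (p + q) a) * monom_eval X a)"
    by (rule insertion_superset) (simp_all add: keys_add)
  also have "\<dots> = (\<Sum>a\<in>?K. e (entry p a) * monom_eval X a) + (\<Sum>a\<in>?K. e (entry q a) * monom_eval X a)"
    by (simp add: lookup_add e_add sum.distrib distrib_right)
  also have "(\<Sum>a\<in>?K. e (entry p a) * monom_eval X a) = insertion e X p"
    by (rule insertion_superset [symmetric]) auto
  also have "(\<Sum>a\<in>?K. e (entry q a) * monom_eval X a) = insertion e X q"
    by (rule insertion_superset [symmetric]) auto
  finally show ?thesis .
qed

lemma insertion_diff: "insertion e X (p - q) = insertion e X p - insertion e X q"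
  using insertion_add [of X "p - q" q] by (simp add: algebra_simps)

lemma insertion_sum: "insertion e X (\<Sum>j\<in>J. p j) = (\<Sum>j\<in>J. insertion e X (p j))"
  by (induction J rule: infinite_finite_induct) (auto simp: insertion_add)

lemma insertion_mult: "insertion e X (p * q) = insertion e X p * insertion e X q"
proof -
  have "p * q = (\<Sum>a\<in>supp p. \<Sum>b\<in>supp q. Poly_Mapping.single (a + b) (entry p a * entry q b))"
    using sum_product [of "\<lambda>a. Poly_Mapping.single a (entry p a)" "supp p"
        "\<lambda>a. Poly_Mapping.single a (entry q a)" "supp q"]
    by (simp add: sum_single_supp mult_single)
  then show ?thesis
    by (simp only:) (simp add: insertion_sum insertion_single e_mult monom_eval_add sum_product mult_ac
        insertion_def [of _ _ p] insertion_def [of _ _ q])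
qed

lemma insertion_const: "insertion e X (const z) = e z"
  by (simp add: const_def insertion_single)

lemma insertion_1 [simp]: "insertion e X 1 = 1"
  using insertion_const [of X 1] by (simp add: const_def e_1)

lemma insertion_var: "insertion e X (var i) = X i"
  by (simp add: var_def insertion_single e_1)

lemma insertion_power: "insertion e X (p ^ n) = insertion e X p ^ n"
  by (induction n) (auto simp: insertion_mult)

lemma insertion_prod: "insertion e X (\<Prod>j\<in>J. p j) = (\<Prod>j\<in>J. insertion e X (p j))"
  by (induction J rule: infinite_finite_induct) (auto simp: insertion_mult)

end

lemma const_0 [simp]: "const 0 = 0"
  by (simp add: const_def)

lemma const_1 [simp]: "const 1 = 1"
  by (simp add: const_def)

lemma const_add: "const (x + y) = const x + const y"
  by (simp add: const_def single_add)

lemma const_mult: "const (x * y) = const x * const y"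
  by (simp add: const_def mult_single)

lemma const_mult_single: "const z * Poly_Mapping.single a y = Poly_Mapping.single a (z * y)"
  by (simp add: const_def mult_single)

lemma const_uminus: "const (- x) = - const x"
  by (simp add: const_def single_uminus)

abbreviation subst :: "('v \<Rightarrow> 'v cpoly) \<Rightarrow> 'v cpoly \<Rightarrow> 'v cpoly" where
  "subst \<equiv> insertion const"

interpretation subst: coefficient_map const
  by unfold_locales (simp_all add: const_add const_mult)

lemma monom_eval_var: "monom_eval var a = Poly_Mapping.single a 1"
proof -
  have pow: "var i ^ n = Poly_Mapping.single (Poly_Mapping.single i n) 1" for i :: 'a and n
  proof (induction n)
    case (Suc n)
    then show ?case by (simp add: var_def mult_single single_add [symmetric])
  qed (simp add: var_def)
  have "(\<Prod>i\<in>K. Poly_Mapping.single (Poly_Mapping.single i (entry a i)) 1)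
      = Poly_Mapping.single (\<Sum>i\<in>K. Poly_Mapping.single i (entry a i)) (1::complex)" for K
    by (induction K rule: infinite_finite_induct) (auto simp: mult_single)
  then show ?thesis
    by (simp add: monom_eval_def pow sum_single_supp)
qed

lemma subst_subst: "subst X (subst Y p) = subst (\<lambda>i. subst X (Y i)) p"
  by (simp add: insertion_def [of _ Y p] insertion_def [of _ "\<lambda>i. subst X (Y i)" p]
      subst.insertion_sum subst.insertion_mult subst.insertion_const monom_eval_def
      subst.insertion_prod subst.insertion_power)

lemma subst_var: "subst var p = p"
  by (simp add: insertion_def monom_eval_var const_mult_single sum_single_supp)

lemma subst_cong:
  assumes "p \<in> polys V" "\<And>i. i \<in> V \<Longrightarrow> X i = Y i"
  shows "subst X p = subst Y p"
proof -
  have "X i = Y i" if "a \<in> supp p" "i \<in> supp a" for a i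
    using assms that unfolding polys_def vecs_def by blast
  then have "monom_eval X a = monom_eval Y a" if "a \<in> supp p" for a
    using that unfolding monom_eval_def by (intro prod.cong) auto
  then show ?thesis by (simp add: insertion_def)
qed


section \<open>Homogeneous polynomials\<close>

definition total_deg :: "('v \<Rightarrow>\<^sub>0 nat) \<Rightarrow> nat" where
  "total_deg a = (\<Sum>i\<in>supp a. entry a i)"

definition homog :: "'v set \<Rightarrow> nat \<Rightarrow> 'v cpoly set" where
  "homog V n = {p \<in> polys V. \<forall>a\<in>supp p. total_deg a = n}"

lemma hom_polys_eq_homog: "hom_polys c n = homog {..c} n"
  by (simp add: hom_polys_def homog_def total_deg_def)

lemma total_deg_superset:
  "finite K \<Longrightarrow> supp a \<subseteq> K \<Longrightarrow> total_deg a = (\<Sum>i\<in>K. entry a i)"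
  unfolding total_deg_def by (rule sum.mono_neutral_left) (auto simp: in_keys_iff)

lemma total_deg_add: "total_deg (a + b) = total_deg a + total_deg b"
proof -
  let ?K = "supp a \<union> supp b"
  have "total_deg (a + b) = (\<Sum>i\<in>?K. entry (a + b) i)"
    by (rule total_deg_superset) (simp_all add: keys_add)
  also have "\<dots> = (\<Sum>i\<in>?K. entry a i) + (\<Sum>i\<in>?K. entry b i)"
    by (simp add: lookup_add sum.distrib)
  also have "\<dots> = total_deg a + total_deg b"
    by (simp add: total_deg_superset [of ?K a] total_deg_superset [of ?K b])
  finally show ?thesis .
qed

lemma total_deg_single [simp]: "total_deg (Poly_Mapping.single i n) = n"
  by (simp add: total_deg_def)

lemma homog_0: "0 \<in> homog V n"
  by (simp add: homog_def polys_def)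

lemma homog_add: "p \<in> homog V n \<Longrightarrow> q \<in> homog V n \<Longrightarrow> p + q \<in> homog V n"
  using keys_add [of p q] by (fastforce simp: homog_def polys_def)

lemma homog_sum: "(\<And>j. j \<in> J \<Longrightarrow> p j \<in> homog V n) \<Longrightarrow> (\<Sum>j\<in>J. p j) \<in> homog V n"
  by (induction J rule: infinite_finite_induct) (auto simp: homog_0 homog_add)

lemma vecs_add: "a \<in> vecs V \<Longrightarrow> b \<in> vecs V \<Longrightarrow> a + b \<in> vecs V"
  using keys_add [of a b] by (auto simp: vecs_def)

lemma homog_mult:
  assumes "p \<in> homog V n" "q \<in> homog V k"
  shows "p * q \<in> homog V (n + k)"
proof -
  have "a \<in> vecs V \<and> total_deg a = n + k" if a: "a \<in> supp (p * q)" for a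
  proof -
    obtain b d where "a = b + d" "b \<in> supp p" "d \<in> supp q"
      using a keys_mult [of p q] by auto
    then show ?thesis
      using assms by (auto simp: homog_def polys_def total_deg_add intro!: vecs_add)
  qed
  then show ?thesis by (auto simp: homog_def polys_def)
qed

lemma homog_const: "const z \<in> homog V 0"
  by (auto simp: homog_def polys_def const_def vecs_def total_deg_def)

lemma homog_1: "1 \<in> homog V 0"
  using homog_const [of 1] by simp

lemma homog_var: "i \<in> V \<Longrightarrow> var i \<in> homog V 1"
  by (auto simp: homog_def polys_def var_def vecs_def)

lemma homog_power: "p \<in> homog V n \<Longrightarrow> p ^ k \<in> homog V (n * k)"
  by (induction k) (auto simp: homog_1 dest: homog_mult)

lemma homog_prod:
  "(\<And>j. j \<in> J \<Longrightarrow> p j \<in> homog V (n j)) \<Longrightarrow> (\<Prod>j\<in>J. p j) \<in> homog V (\<Sum>j\<in>J. n j)"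
  by (induction J rule: infinite_finite_induct) (auto simp: homog_1 homog_mult)

lemma homog_const_mult: "p \<in> homog V n \<Longrightarrow> const z * p \<in> homog V n"
  using homog_mult [OF homog_const] by simp

lemma subst_homog:
  assumes p: "p \<in> homog V n" and X: "\<And>i. i \<in> V \<Longrightarrow> X i \<in> homog W 1"
  shows "subst X p \<in> homog W n"
  unfolding insertion_def
proof (rule homog_sum, rule homog_const_mult)
  fix a assume a: "a \<in> supp p"
  have "monom_eval X a \<in> homog W (\<Sum>i\<in>supp a. 1 * entry a i)"
    unfolding monom_eval_def
    by (intro homog_prod homog_power X) (use a p in \<open>auto simp: homog_def polys_def vecs_def\<close>)
  moreover have "(\<Sum>i\<in>supp a. 1 * entry a i) = n"
    using a p by (auto simp: homog_def total_deg_def)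
  ultimately show "monom_eval X a \<in> homog W n" by simp
qed

lemma total_deg_eq_1:
  assumes "total_deg a = 1"
  obtains i where "i \<in> supp a" "a = Poly_Mapping.single i 1"
proof -
  have "\<exists>i\<in>supp a. entry a i = 1 \<and> (\<forall>j\<in>supp a. j \<noteq> i \<longrightarrow> entry a j = 0)"
    using assms sum_eq_1_iff [of "supp a" "entry a"] by (fastforce simp: total_deg_def)
  then obtain i where i: "i \<in> supp a" "entry a i = 1" "\<forall>j\<in>supp a. j \<noteq> i \<longrightarrow> entry a j = 0"
    by blast
  then have "a = Poly_Mapping.single i 1"
    by (intro poly_mapping_eqI) (auto simp: lookup_single when_def in_keys_iff)
  with i that show ?thesis by blast
qed

lemma linear_form_expand:
  assumes "p \<in> homog V 1" "finite V"
  obtains b where "p = (\<Sum>i\<in>V. const (b i) * var i)"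
proof -
  let ?s = "\<lambda>i. Poly_Mapping.single i (1::nat)"
  have sub: "supp p \<subseteq> ?s ` V"
  proof
    fix a assume a: "a \<in> supp p"
    then have "total_deg a = 1" "supp a \<subseteq> V"
      using assms by (auto simp: homog_def polys_def vecs_def)
    then show "a \<in> ?s ` V" by (metis image_eqI subsetD total_deg_eq_1)
  qed
  have inj: "inj_on ?s V"
    by (rule inj_onI) (metis lookup_single_eq lookup_single_not_eq zero_neq_one)
  have "p = (\<Sum>a\<in>?s ` V. Poly_Mapping.single a (entry p a))"
    using sum_supp_superset [OF _ sub, of "\<lambda>a z. Poly_Mapping.single a z"] assms
    by (simp add: sum_single_supp)
  also have "\<dots> = (\<Sum>i\<in>V. const (entry p (?s i)) * var i)"
    by (subst sum.reindex [OF inj]) (simp add: var_def const_mult_single)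
  finally show ?thesis by (rule that)
qed


section \<open>Linear forms in general position as coordinates\<close>

text \<open>
  The exchange argument in the form used twice below: for linear forms over \<open>\<complex>\<close> and for the rows
  of the weight matrix over \<open>\<real>\<close>.
\<close>
lemma (in vector_space) independent_spans_of_card:
  assumes B: "finite B" "independent B" "B \<subseteq> span E"
    and E: "finite E" "card E \<le> card B" and x: "x \<in> span E"
  shows "x \<in> span B"
proof (rule ccontr)
  assume nx: "x \<notin> span B"
  then have "independent (insert x B)"
    using B by (simp add: independent_insert)
  then have "card (insert x B) \<le> card E"
    using independent_span_bound [OF E(1), of "insert x B"] B x by simp
  moreover have "x \<notin> B"
    using nx span_base by blast
  ultimately show False
    using B E by simp
qed

interpretation cpoly: vector_space "\<lambda>z p. const z * p :: 'v cpoly"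
  by unfold_locales (simp_all add: const_add const_mult algebra_simps)

lemma general_full_rankD:
  assumes "general_full_rank c m l" "T \<subseteq> {..m}" "card T = c + 1"
    and "(\<Sum>i\<in>T. const (a i) * l i) = 0" "i \<in> T"
  shows "a i = 0"
  using assms by (auto simp: general_full_rank_def)

lemma general_full_rank_eqD:
  assumes gen: "general_full_rank c m l" "T \<subseteq> {..m}" "card T = c + 1"
    and eq: "(\<Sum>i\<in>T. const (a i) * l i) = (\<Sum>i\<in>T. const (b i) * l i)" and "i \<in> T"
  shows "a i = b i"
proof -
  have "(\<Sum>i\<in>T. const (a i - b i) * l i) = 0"
    using eq by (simp add: const_add [of "a _" "- b _", simplified] const_uminus algebra_simps sum_subtractf)
  from general_full_rankD [OF gen this \<open>i \<in> T\<close>] show ?thesis by simp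
qed

lemma forms_inj_on:
  assumes gen: "general_full_rank c m l" and T: "T \<subseteq> {..m}" "card T = c + 1"
  shows "inj_on l T"
proof (rule inj_onI, rule ccontr)
  fix i j assume ij: "i \<in> T" "j \<in> T" "l i = l j" "i \<noteq> j"
  have fin: "finite T" using T finite_subset by blast
  define a :: "nat \<Rightarrow> complex" where "a = (\<lambda>k. if k = i then 1 else if k = j then -1 else 0)"
  have "(\<Sum>k\<in>T. const (a k) * l k) = (\<Sum>k\<in>{i,j}. const (a k) * l k)"
    by (rule sum.mono_neutral_right) (use ij fin in \<open>auto simp: a_def\<close>)
  also have "\<dots> = 0"
    using ij by (simp add: a_def const_uminus)
  finally have "a i = 0"
    using general_full_rankD [OF gen T] ij by blast
  then show False by (simp add: a_def)
qed

lemma forms_independent: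
  assumes gen: "general_full_rank c m l" and T: "T \<subseteq> {..m}" "card T = c + 1"
  shows "cpoly.independent (l ` T)"
proof (rule cpoly.independent_if_scalars_zero)
  have inj: "inj_on l T" by (rule forms_inj_on [OF assms])
  show "finite (l ` T)" using T finite_subset by blast
  fix f x assume *: "(\<Sum>x\<in>l ` T. const (f x) * x) = 0" "x \<in> l ` T"
  then have "(\<Sum>i\<in>T. const (f (l i)) * l i) = 0"
    by (simp add: sum.reindex [OF inj])
  from general_full_rankD [OF gen T this] *(2) show "f x = 0" by auto
qed

lemma linear_form_nonzero:
  assumes gen: "general_full_rank c m l" and T: "T \<subseteq> {..m}" "card T = c + 1" and i: "i \<in> T"
  shows "l i \<noteq> 0"
proof
  assume 0: "l i = 0"
  have "(\<Sum>k\<in>T. const (if k = i then 1 else 0) * l k) = 0"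
    by (rule sum.neutral) (auto simp: 0)
  from general_full_rankD [OF gen T this i] show False by simp
qed

text \<open>
  Any \<open>c + 1\<close> of the forms are linear coordinates on the \<open>(c + 1)\<close>-dimensional space of linear
  forms: substituting \<open>Y\<close> rewrites a polynomial in \<open>x\<^sub>0, \<dots>, x\<^sub>c\<close> in these coordinates.
\<close>
lemma linear_coordinates:
  assumes gen: "general_full_rank c m l" and T: "T \<subseteq> {..m}" "card T = c + 1"
    and l: "\<And>i. i \<le> m \<Longrightarrow> l i \<in> homog {..c} 1"
  obtains Y where "\<And>i. i \<le> c \<Longrightarrow> Y i \<in> homog T 1"
    and "\<And>p. p \<in> polys {..c} \<Longrightarrow> subst l (subst Y p) = p"
    and "\<And>j. j \<in> T \<Longrightarrow> subst Y (l j) = var j"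
    and "\<And>k. k \<le> m \<Longrightarrow> k \<notin> T \<Longrightarrow>
           \<exists>b. subst Y (l k) = (\<Sum>j\<in>T. const (b j) * var j) \<and> (\<forall>j\<in>T. b j \<noteq> 0)"
proof -
  have finT: "finite T" using T finite_subset by blast
  have inj: "inj_on l T" by (rule forms_inj_on [OF gen T])
  have l_span: "l i \<in> cpoly.span (var ` {..c})" if i: "i \<in> T" for i
  proof -
    obtain b where "l i = (\<Sum>i\<le>c. const (b i) * var i)"
      using linear_form_expand [OF l [of i]] i T by auto
    also have "\<dots> \<in> cpoly.span (var ` {..c})"
      by (intro cpoly.span_sum cpoly.span_scale cpoly.span_base) auto
    finally show ?thesis .
  qed
  have "\<exists>b. var i = (\<Sum>j\<in>T. const (b j) * l j)" if i: "i \<le> c" for i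
  proof -
    have "var i \<in> cpoly.span (l ` T)"
    proof (rule cpoly.independent_spans_of_card)
      show "cpoly.independent (l ` T)" by (rule forms_independent [OF gen T])
      show "card (var ` {..c} :: nat cpoly set) \<le> card (l ` T)"
        using card_image_le [of "{..c}" var] T by (simp add: card_image [OF inj])
      show "var i \<in> cpoly.span (var ` {..c})"
        by (rule cpoly.span_base) (use i in auto)
    qed (use finT l_span in auto)
    then obtain f where "var i = (\<Sum>x\<in>l ` T. const (f x) * x)"
      using cpoly.span_finite [of "l ` T"] finT by auto
    then show ?thesis
      by (auto simp: sum.reindex [OF inj])
  qed
  then obtain b where b: "\<And>i. i \<le> c \<Longrightarrow> var i = (\<Sum>j\<in>T. const (b i j) * l j)"
    by metis
  define Y where "Y i = (\<Sum>j\<in>T. const (b i j) * var j)" for i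
  have Y: "Y i \<in> homog T 1" for i
    unfolding Y_def by (intro homog_sum homog_const_mult homog_var)
  have lY: "subst l (Y i) = var i" if "i \<le> c" for i
    using b [OF that] by (simp add: Y_def subst.insertion_sum subst.insertion_mult
        subst.insertion_const subst.insertion_var)
  have inv: "subst l (subst Y p) = p" if "p \<in> polys {..c}" for p
  proof -
    have "subst l (subst Y p) = subst var p"
      unfolding subst_subst by (rule subst_cong [OF that]) (use lY in auto)
    then show ?thesis by (simp add: subst_var)
  qed
  have expand: "\<exists>d. subst Y (l k) = (\<Sum>j\<in>T. const (d j) * var j) \<and> l k = (\<Sum>j\<in>T. const (d j) * l j)"
    if k: "k \<le> m" for k
  proof -
    have "subst Y (l k) \<in> homog T 1"
      by (rule subst_homog [OF l [OF k]]) (rule Y)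
    then obtain d where d: "subst Y (l k) = (\<Sum>j\<in>T. const (d j) * var j)"
      using linear_form_expand finT by blast
    have "l k = subst l (subst Y (l k))"
      using inv l [OF k] by (simp add: homog_def)
    also have "\<dots> = (\<Sum>j\<in>T. const (d j) * l j)"
      unfolding d by (simp add: subst.insertion_sum subst.insertion_mult
          subst.insertion_const subst.insertion_var)
    finally show ?thesis using d by blast
  qed
  show ?thesis
  proof (rule that [OF Y inv])
    fix j assume j: "j \<in> T"
    obtain d where d: "subst Y (l j) = (\<Sum>i\<in>T. const (d i) * var i)"
        "l j = (\<Sum>i\<in>T. const (d i) * l i)"
      using expand [of j] j T by blast
    have delta: "(\<Sum>i\<in>T. const (if i = j then 1 else 0) * f i) = f j" for f :: "nat \<Rightarrow> nat cpoly"
    proof -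
      have "(\<Sum>i\<in>T. const (if i = j then 1 else 0) * f i) = (\<Sum>i\<in>T. if i = j then f i else 0)"
        by (rule sum.cong) auto
      then show ?thesis using finT j by simp
    qed
    have "d i = (if i = j then 1 else 0)" if "i \<in> T" for i
      by (rule general_full_rank_eqD [OF gen T _ that]) (metis d(2) delta)
    then have "subst Y (l j) = (\<Sum>i\<in>T. const (if i = j then 1 else 0) * var i)"
      unfolding d(1) by (intro sum.cong) auto
    then show "subst Y (l j) = var j"
      by (simp only: delta)
  next
    fix k assume k: "k \<le> m" "k \<notin> T"
    obtain d where d: "subst Y (l k) = (\<Sum>j\<in>T. const (d j) * var j)"
        "l k = (\<Sum>j\<in>T. const (d j) * l j)"
      using expand k by blast
    have "d j \<noteq> 0" if j: "j \<in> T" for j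
    proof
      assume 0: "d j = 0"
      let ?T = "insert k (T - {j})"
      have T': "?T \<subseteq> {..m}" "card ?T = c + 1"
        using T k j finT by auto
      have "l k = (\<Sum>i\<in>T - {j}. const (d i) * l i)"
        unfolding d(2) using j finT 0 by (simp add: sum.remove)
      note lk = this
      have "(\<Sum>i\<in>?T. const (if i = k then -1 else d i) * l i) = 0"
      proof -
        have "(\<Sum>i\<in>T - {j}. const (if i = k then -1 else d i) * l i) = (\<Sum>i\<in>T - {j}. const (d i) * l i)"
          by (rule sum.cong) (use k in auto)
        with lk show ?thesis
          using k finT by (simp add: const_uminus)
      qed
      from general_full_rankD [OF gen T' this, of k] show False by simp
    qed
    with d show "\<exists>b. subst Y (l k) = (\<Sum>j\<in>T. const (b j) * var j) \<and> (\<forall>j\<in>T. b j \<noteq> 0)"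
      by blast
  qed
qed


section \<open>Leading terms of products of the forms\<close>

text \<open>
  \<open>leading S n z g\<close> says that \<open>z y\<^sup>n\<close> is the leading term of \<open>g\<close> at the point where the
  coordinates in \<open>S\<close> vanish: every exponent of \<open>g\<close> is at least \<open>n\<close> on \<open>S\<close>, and \<open>n\<close> itself is the
  only exponent that agrees with \<open>n\<close> on \<open>S\<close>.  No order on exponents is involved, so the notion
  serves all monomial orders for which the variables in \<open>S\<close> are positive.
\<close>
definition leading :: "'v set \<Rightarrow> ('v \<Rightarrow>\<^sub>0 nat) \<Rightarrow> complex \<Rightarrow> 'v cpoly \<Rightarrow> bool" where
  "leading S n z g \<longleftrightarrow>
     (\<forall>a\<in>supp g. (\<forall>j\<in>S. entry n j \<le> entry a j) \<and> ((\<forall>j\<in>S. entry a j = entry n j) \<longrightarrow> a = n)) \<and>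
     entry g n = z"

lemma entry_mult_unique:
  fixes f g :: "'a::cancel_comm_monoid_add \<Rightarrow>\<^sub>0 'b::comm_semiring_1"
  assumes "\<And>a b. a \<in> supp f \<Longrightarrow> b \<in> supp g \<Longrightarrow> a + b = n + k \<Longrightarrow> a = n"
  shows "entry (f * g) (n + k) = entry f n * entry g k"
proof -
  let ?s = Poly_Mapping.single
  have "f * g = (\<Sum>a\<in>supp f. \<Sum>b\<in>supp g. ?s (a + b) (entry f a * entry g b))"
    using sum_product [of "\<lambda>a. ?s a (entry f a)" "supp f" "\<lambda>a. ?s a (entry g a)" "supp g"]
    by (simp add: sum_single_supp mult_single)
  then have "entry (f * g) (n + k)
      = (\<Sum>a\<in>supp f. \<Sum>b\<in>supp g. entry (?s (a + b) (entry f a * entry g b)) (n + k))"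
    by (simp add: lookup_sum)
  also have "\<dots> = (\<Sum>a\<in>supp f. \<Sum>b\<in>supp g. if a = n \<and> b = k then entry f a * entry g b else 0)"
  proof (intro sum.cong refl)
    fix a b assume "a \<in> supp f" "b \<in> supp g"
    then show "entry (?s (a + b) (entry f a * entry g b)) (n + k)
        = (if a = n \<and> b = k then entry f a * entry g b else 0)"
      using assms [of a b] by (auto simp: lookup_single when_def)
  qed
  also have "\<dots> = (\<Sum>a\<in>supp f. if a = n then (\<Sum>b\<in>supp g. if b = k then entry f a * entry g b else 0) else 0)"
    by (intro sum.cong refl) auto
  also have "\<dots> = entry f n * entry g k"
    by (auto simp: in_keys_iff)
  finally show ?thesis .
qed

lemma entry_const_mult:
  fixes p :: "'v cpoly"
  shows "entry (const z * p) a = z * entry p a"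
proof -
  have "entry (const z * p) (0 + a) = entry (const z :: 'v cpoly) 0 * entry p a"
    by (rule entry_mult_unique) (auto simp: const_def split: if_splits)
  then show ?thesis by (simp add: const_def)
qed

lemma leading_mult:
  assumes f: "leading S n z f" and g: "leading S k y g"
  shows "leading S (n + k) (z * y) (f * g)"
proof -
  have le: "entry n j \<le> entry a j" "entry k j \<le> entry b j"
    if "a \<in> supp f" "b \<in> supp g" "j \<in> S" for a b j
    using f g that by (auto simp: leading_def)
  have eq: "a = n \<and> b = k"
    if ab: "a \<in> supp f" "b \<in> supp g" "\<forall>j\<in>S. entry (a + b) j = entry (n + k) j" for a b
  proof -
    have "entry a j = entry n j \<and> entry b j = entry k j" if "j \<in> S" for j
      using le [OF ab(1,2) that] ab(3) that by (fastforce simp: lookup_add)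
    then show ?thesis
      using f g ab by (auto simp: leading_def)
  qed
  have "entry (f * g) (n + k) = entry f n * entry g k"
    by (rule entry_mult_unique) (use eq in auto)
  moreover have "(\<forall>j\<in>S. entry (n + k) j \<le> entry d j) \<and> ((\<forall>j\<in>S. entry d j = entry (n + k) j) \<longrightarrow> d = n + k)"
    if "d \<in> supp (f * g)" for d
  proof -
    obtain a b where ab: "d = a + b" "a \<in> supp f" "b \<in> supp g"
      using \<open>d \<in> supp (f * g)\<close> keys_mult [of f g] by auto
    then show ?thesis
      using le [OF ab(2,3)] eq [OF ab(2,3)] by (auto simp: lookup_add intro: add_mono)
  qed
  ultimately show ?thesis
    using f g by (auto simp: leading_def)
qed

lemma leading_1: "leading S 0 1 1"
  by (auto simp: leading_def)

lemma leading_power: "leading S n z g \<Longrightarrow> leading S (\<Sum>i<k. n) (z ^ k) (g ^ k)"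
  by (induction k) (auto simp: leading_1 lessThan_Suc leading_mult)

lemma leading_prod:
  "(\<And>i. i \<in> I \<Longrightarrow> leading S (n i) (z i) (g i)) \<Longrightarrow>
     leading S (\<Sum>i\<in>I. n i) (\<Prod>i\<in>I. z i) (\<Prod>i\<in>I. g i)"
  by (induction I rule: infinite_finite_induct) (auto simp: leading_1 leading_mult)

text \<open>
  Let \<open>y\<^sub>i\<close>, \<open>i \<in> S \<union> {k}\<close>, be the linear coordinates given by the forms \<open>l\<^sub>i\<close>.  A form \<open>l\<^sub>i\<close> with
  \<open>i \<in> S\<close> is the coordinate \<open>y\<^sub>i\<close>, and every other form involves \<open>y\<^sub>k\<close>, because it does not lie in the
  span of the \<open>l\<^sub>j\<close>, \<open>j \<in> S\<close>.  So \<open>\<Prod>\<^sub>i l\<^sub>i\<^bsup>n\<^sub>i\<^esup>\<close> has a leading term, and its exponents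
  on \<open>S\<close> are the \<open>n\<^sub>i\<close>.
\<close>
lemma leading_product_of_forms:
  assumes gen: "general_full_rank c m l" and S: "S \<subseteq> {..m}" "card S = c" "k \<le> m" "k \<notin> S"
    and l: "\<And>i. i \<le> m \<Longrightarrow> l i \<in> homog {..c} 1"
  obtains Y where "\<And>n. \<exists>a z. leading S a z (subst Y (\<Prod>i\<le>m. l i ^ n i)) \<and> z \<noteq> 0 \<and>
                       (\<forall>j\<in>S. entry a j = n j)"
proof -
  have finS: "finite S" using S finite_subset by blast
  obtain Y where Y: "\<And>j. j \<in> insert k S \<Longrightarrow> subst Y (l j) = var j"
    "\<And>i. i \<le> m \<Longrightarrow> i \<notin> insert k S \<Longrightarrow>
       \<exists>b. subst Y (l i) = (\<Sum>j\<in>insert k S. const (b j) * var j) \<and> (\<forall>j\<in>insert k S. b j \<noteq> 0)"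
  proof (rule linear_coordinates [OF gen _ _ l])
    show "insert k S \<subseteq> {..m}" "card (insert k S) = c + 1"
      using S finS by auto
  qed blast+
  let ?s = "\<lambda>i. Poly_Mapping.single i (1::nat)"
  define e where "e i = ?s (if i \<in> S then i else k)" for i
  have s_neq: "?s i = ?s j \<longleftrightarrow> i = j" for i j :: nat
    by (metis lookup_single_eq lookup_single_not_eq zero_neq_one)
  have "\<exists>z. leading S (e i) z (subst Y (l i)) \<and> z \<noteq> 0" if i: "i \<le> m" for i
  proof (cases "i \<in> insert k S")
    case True
    then show ?thesis
      using Y(1) [OF True] S by (intro exI [of _ 1]) (auto simp: leading_def e_def var_def)
  next
    case False
    obtain b where b: "subst Y (l i) = (\<Sum>j\<in>insert k S. const (b j) * var j)"
        "\<forall>j\<in>insert k S. b j \<noteq> 0"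
      using Y(2) [OF i False] by blast
    have ent: "entry (subst Y (l i)) (?s j) = b j" if j: "j \<in> insert k S" for j
    proof -
      have "entry (subst Y (l i)) (?s j) = (\<Sum>i\<in>insert k S. if i = j then b i else 0)"
        unfolding b var_def const_mult_single lookup_sum
        by (intro sum.cong) (auto simp: lookup_single when_def s_neq simp del: One_nat_def)
      then show ?thesis using finS j by auto
    qed
    have supp: "supp (subst Y (l i)) \<subseteq> ?s ` insert k S"
      unfolding b var_def const_mult_single
      by (rule order_trans [OF keys_sum]) auto
    have "leading S (?s k) (b k) (subst Y (l i))"
      unfolding leading_def
    proof (intro conjI ballI impI)
      fix a j assume "a \<in> supp (subst Y (l i))" "j \<in> S"
      then show "entry (?s k) j \<le> entry a j"
        using S by (auto simp: lookup_single when_def)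
    next
      fix a assume a: "a \<in> supp (subst Y (l i))" "\<forall>j\<in>S. entry a j = entry (?s k) j"
      then obtain j where j: "j \<in> insert k S" "a = ?s j"
        using supp by auto
      have "j \<notin> S"
        using a(2) S j by (auto simp: lookup_single when_def split: if_splits)
      then show "a = ?s k" using j by simp
    qed (use ent in auto)
    then show ?thesis using False b by (auto simp: e_def)
  qed
  then obtain z where z: "\<And>i. i \<le> m \<Longrightarrow> leading S (e i) (z i) (subst Y (l i))"
      "\<And>i. i \<le> m \<Longrightarrow> z i \<noteq> 0"
    by metis
  show ?thesis
  proof (rule that [of Y])
    fix n :: "nat \<Rightarrow> nat"
    let ?a = "\<Sum>i\<le>m. \<Sum>_<n i. e i"
    have "leading S ?a (\<Prod>i\<le>m. z i ^ n i) (\<Prod>i\<le>m. subst Y (l i) ^ n i)"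
      by (intro leading_prod leading_power z) auto
    then have "leading S ?a (\<Prod>i\<le>m. z i ^ n i) (subst Y (\<Prod>i\<le>m. l i ^ n i))"
      by (simp add: subst.insertion_prod subst.insertion_power)
    moreover have "entry ?a j = n j" if j: "j \<in> S" for j
    proof -
      have "entry ?a j = (\<Sum>i\<le>m. if i = j then n i else 0)"
        unfolding lookup_sum
        by (intro sum.cong) (use j S in \<open>auto simp: e_def lookup_single when_def\<close>)
      then show ?thesis using j S by auto
    qed
    ultimately show "\<exists>a z. leading S a z (subst Y (\<Prod>i\<le>m. l i ^ n i)) \<and> z \<noteq> 0 \<and>
                       (\<forall>j\<in>S. entry a j = n j)"
      using z(2) by (intro exI conjI) auto
  qed
qed


section \<open>Laurent monomials in the forms\<close>

lemma to_rf_add: "to_rf (p + q) = to_rf p + to_rf q"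
  by (simp add: to_rf_def)

lemma to_rf_mult: "to_rf (p * q) = to_rf p * to_rf q"
  by (simp add: to_rf_def)

lemma to_rf_0 [simp]: "to_rf 0 = 0"
  by (simp add: to_rf_def fract_collapse)

lemma to_rf_1 [simp]: "to_rf 1 = 1"
  by (simp add: to_rf_def fract_collapse)

lemma to_rf_eq_iff: "to_rf p = to_rf q \<longleftrightarrow> p = q"
  by (simp add: to_rf_def eq_fract)

lemma to_rf_eq_0_iff [simp]: "to_rf p = 0 \<longleftrightarrow> p = 0"
  using to_rf_eq_iff [of p 0] by simp

lemma to_rf_sum: "to_rf (\<Sum>j\<in>J. p j) = (\<Sum>j\<in>J. to_rf (p j))"
  by (induction J rule: infinite_finite_induct) (auto simp: to_rf_add)

lemma to_rf_prod: "to_rf (\<Prod>j\<in>J. p j) = (\<Prod>j\<in>J. to_rf (p j))"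
  by (induction J rule: infinite_finite_induct) (auto simp: to_rf_mult)

lemma to_rf_power: "to_rf (p ^ n) = to_rf p ^ n"
  by (induction n) (auto simp: to_rf_mult)

text \<open>
  A vector \<open>h \<in> \<int>\<^sup>m\<close> stands for the character \<open>\<Prod>\<^sub>i (x\<^sub>i/x\<^sub>0)\<^bsup>h\<^sub>i\<^esup>\<close> of the torus of \<open>\<bbbP>\<^sup>m\<close>.  Its exponent
  vector in the homogeneous coordinates \<open>x\<^sub>0, \<dots>, x\<^sub>m\<close> has sum zero and is the pairing of \<open>h\<close> with
  the vectors \<open>evec m i\<close>.
\<close>
definition hexp :: "nat \<Rightarrow> (nat \<Rightarrow>\<^sub>0 'a::ab_group_add) \<Rightarrow> nat \<Rightarrow> 'a" where
  "hexp m h i = (if i = 0 then - (\<Sum>j=1..m. entry h j) else entry h i)"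

definition laurent :: "nat \<Rightarrow> (nat \<Rightarrow> nat cpoly) \<Rightarrow> ivec \<Rightarrow> ratfun" where
  "laurent m l h = (\<Prod>i=1..m. (to_rf (l i) / to_rf (l 0)) powi entry h i)"

lemma atMost_eq_insert_0: "{..m} = insert (0::nat) {1..m}"
  by auto

lemma sum_hexp: "(\<Sum>i\<le>m. hexp m h i) = 0"
proof -
  have "(\<Sum>i\<in>{1..m}. hexp m h i) = (\<Sum>i\<in>{1..m}. entry h i)"
    by (rule sum.cong) (auto simp: hexp_def)
  then show ?thesis
    by (simp add: atMost_eq_insert_0) (simp add: hexp_def)
qed

lemma power_int_sum:
  "(x::'a::field) \<noteq> 0 \<Longrightarrow> x powi (\<Sum>i\<in>I. f i) = (\<Prod>i\<in>I. x powi f i)"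
  by (induction I rule: infinite_finite_induct) (auto simp: power_int_add)

lemma laurent_eq_prod:
  assumes l: "\<And>i. i \<le> m \<Longrightarrow> l i \<noteq> 0"
  shows "laurent m l h = (\<Prod>i\<le>m. to_rf (l i) powi hexp m h i)"
proof -
  have "laurent m l h = (\<Prod>i=1..m. to_rf (l i) powi entry h i) / (\<Prod>i=1..m. to_rf (l 0) powi entry h i)"
    by (simp add: laurent_def power_int_divide_distrib prod_dividef)
  also have "(\<Prod>i=1..m. to_rf (l 0) powi entry h i) = to_rf (l 0) powi (\<Sum>i=1..m. entry h i)"
    using l by (simp add: power_int_sum)
  also have "(\<Prod>i=1..m. to_rf (l i) powi entry h i) = (\<Prod>i=1..m. to_rf (l i) powi hexp m h i)"
    by (rule prod.cong) (auto simp: hexp_def)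
  finally show ?thesis
    by (simp add: atMost_eq_insert_0) (simp add: hexp_def power_int_minus divide_inverse mult.commute)
qed

lemma laurent_nonzero:
  assumes "\<And>i. i \<le> m \<Longrightarrow> l i \<noteq> 0"
  shows "laurent m l h \<noteq> 0"
  using assms by (auto simp: laurent_def power_int_eq_0_iff)

lemma laurent_0 [simp]: "laurent m l 0 = 1"
  by (simp add: laurent_def)

lemma laurent_add:
  assumes "\<And>i. i \<le> m \<Longrightarrow> l i \<noteq> 0"
  shows "laurent m l (h + h') = laurent m l h * laurent m l h'"
  unfolding laurent_def prod.distrib [symmetric]
  by (rule prod.cong) (use assms in \<open>auto simp: lookup_add power_int_add\<close>)

text \<open>
  A Laurent monomial whose exponents on \<open>S\<close> are minimal cannot be cancelled: after multiplication
  with a high power of all the forms, its leading term at the point \<open>\<Inter>\<^sub>i\<^sub>\<in>\<^sub>S V(l\<^sub>i)\<close> occurs in no other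
  summand.
\<close>
lemma minimal_monomial_not_cancelled:
  assumes gen: "general_full_rank c m l" and S: "S \<subset> {..m}" "card S = c"
    and l: "\<And>i. i \<le> m \<Longrightarrow> l i \<in> homog {..c} 1"
    and nz: "\<And>i. i \<le> m \<Longrightarrow> l i \<noteq> 0"
    and J: "finite J" "j0 \<in> J"
    and sum: "(\<Sum>j\<in>J. to_rf (const (z j)) * (\<Prod>i\<le>m. to_rf (l i) powi e j i)) = 0"
    and min: "\<And>j. j \<in> J \<Longrightarrow> j \<noteq> j0 \<Longrightarrow> \<exists>i\<in>S. e j0 i < e j i"
  shows "z j0 = 0"
proof -
  obtain k where k: "k \<le> m" "k \<notin> S" using S by auto
  \<comment> \<open>A common shift that makes all exponents nonnegative.\<close>
  define N where "N = (\<Sum>j\<in>J. \<Sum>i\<le>m. \<bar>e j i\<bar>)"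
  define n where "n j i = nat (e j i + N)" for j i
  have N: "0 \<le> e j i + N" if "j \<in> J" "i \<le> m" for j i
  proof -
    have "\<bar>e j i\<bar> \<le> (\<Sum>i\<le>m. \<bar>e j i\<bar>)"
      by (rule member_le_sum) (use that in auto)
    also have "\<dots> \<le> N"
      unfolding N_def by (rule member_le_sum [where f = "\<lambda>j. \<Sum>i\<le>m. \<bar>e j i\<bar>"])
        (use that J in \<open>auto intro: sum_nonneg\<close>)
    finally show ?thesis by linarith
  qed
  have "to_rf (const (z j)) * (\<Prod>i\<le>m. to_rf (l i) powi e j i) * (\<Prod>i\<le>m. to_rf (l i) powi N)
      = to_rf (const (z j) * (\<Prod>i\<le>m. l i ^ n j i))" if j: "j \<in> J" for j
  proof -
    have "to_rf (l i) powi e j i * to_rf (l i) powi N = to_rf (l i) ^ n j i" if i: "i \<le> m" for i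
    proof -
      have "to_rf (l i) powi e j i * to_rf (l i) powi N = to_rf (l i) powi (e j i + N)"
        using nz [OF i] by (simp add: power_int_add)
      then show ?thesis
        using N [OF j i] by (simp add: n_def power_int_def)
    qed
    then show ?thesis
      by (simp add: to_rf_mult to_rf_prod to_rf_power prod.distrib [symmetric] mult.assoc)
  qed
  then have "to_rf (\<Sum>j\<in>J. const (z j) * (\<Prod>i\<le>m. l i ^ n j i))
      = (\<Sum>j\<in>J. to_rf (const (z j)) * (\<Prod>i\<le>m. to_rf (l i) powi e j i)) * (\<Prod>i\<le>m. to_rf (l i) powi N)"
    by (simp add: to_rf_sum sum_distrib_right)
  then have 0: "(\<Sum>j\<in>J. const (z j) * (\<Prod>i\<le>m. l i ^ n j i)) = 0"
    using sum by simp
  obtain Y where Y: "\<And>n. \<exists>a z. leading S a z (subst Y (\<Prod>i\<le>m. l i ^ n i)) \<and> z \<noteq> 0 \<and>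
                       (\<forall>j\<in>S. entry a j = n j)"
    using leading_product_of_forms [OF gen _ S(2) k l] S by auto
  define g where "g j = subst Y (\<Prod>i\<le>m. l i ^ n j i)" for j
  obtain a y where a: "leading S a y (g j0)" "y \<noteq> 0" "\<And>i. i \<in> S \<Longrightarrow> entry a i = n j0 i"
    using Y [of "n j0"] unfolding g_def by auto
  have "entry (g j) a = 0" if j: "j \<in> J" "j \<noteq> j0" for j
  proof -
    obtain i where i: "i \<in> S" "e j0 i < e j i"
      using min [OF j] by blast
    obtain b x where "leading S b x (g j)" "entry b i = n j i"
      using Y [of "n j"] i unfolding g_def by auto
    moreover have "n j0 i < n j i"
      using i N [of j0 i] J S unfolding n_def by auto
    ultimately show ?thesis
      using a(3) [OF i(1)] i(1) by (force simp: leading_def not_in_keys_iff_lookup_eq_zero [symmetric])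
  qed
  moreover have "(\<Sum>j\<in>J. const (z j) * g j) = 0"
    using arg_cong [OF 0, of "subst Y"]
    by (simp add: subst.insertion_sum subst.insertion_mult subst.insertion_const g_def)
  then have "entry (\<Sum>j\<in>J. const (z j) * g j) a = 0"
    by simp
  then have "(\<Sum>j\<in>J. z j * entry (g j) a) = 0"
    by (simp add: lookup_sum entry_const_mult)
  ultimately have "z j0 * entry (g j0) a = 0"
    using J by (simp add: sum.remove)
  then show ?thesis
    using a by (auto simp: leading_def)
qed


section \<open>The presentation of the section ring\<close>

text \<open>The exponent \<open>(h, u)\<close> of the monomial \<open>t\<^sup>h \<chi>\<^sup>u\<close> to which \<open>x\<^sup>a\<close> is sent.\<close>
definition total_exponent :: "('g::comm_monoid_add \<Rightarrow>\<^sub>0 nat) \<Rightarrow> 'g" where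
  "total_exponent a = (\<Sum>g\<in>supp a. \<Sum>_<entry a g. g)"

lemma total_exponent_additive:
  assumes "f 0 = (0::'b::comm_semiring_1)" "\<And>x y. f (x + y) = f x + f y"
  shows "f (total_exponent a) = (\<Sum>g\<in>supp a. of_nat (entry a g) * f g)"
proof -
  have sum: "f (\<Sum>i\<in>I. x i) = (\<Sum>i\<in>I. f (x i))" for I :: "'i set" and x
    by (induction I rule: infinite_finite_induct) (auto simp: assms)
  show ?thesis by (simp add: total_exponent_def sum)
qed

lemma total_exponent_multiplicative:
  assumes "f 0 = (1::'b::comm_monoid_mult)" "\<And>x y. f (x + y) = f x * f y"
  shows "f (total_exponent a) = monom_eval f a"
proof -
  have sum: "f (\<Sum>i\<in>I. x i) = (\<Prod>i\<in>I. f (x i))" for I :: "'i set" and x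
    by (induction I rule: infinite_finite_induct) (auto simp: assms)
  show ?thesis by (simp add: total_exponent_def sum monom_eval_def)
qed

lemma total_exponent_superset:
  "finite K \<Longrightarrow> supp a \<subseteq> K \<Longrightarrow> total_exponent a = (\<Sum>g\<in>K. \<Sum>_<entry a g. g)"
  unfolding total_exponent_def by (rule sum.mono_neutral_left) (auto simp: in_keys_iff)

lemma total_exponent_add: "total_exponent (a + b) = total_exponent a + total_exponent b"
proof -
  let ?K = "supp a \<union> supp b"
  have rep: "(\<Sum>_<n + k. g) = (\<Sum>_<n. g) + (\<Sum>_<k. g)" for n k :: nat and g :: 'a
    by (induction k) (auto simp: lessThan_Suc ac_simps)
  have "total_exponent (a + b) = (\<Sum>g\<in>?K. \<Sum>_<entry (a + b) g. g)"
    by (rule total_exponent_superset) (simp_all add: keys_add)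
  also have "\<dots> = total_exponent a + total_exponent b"
    by (simp add: lookup_add rep sum.distrib total_exponent_superset [of ?K a] total_exponent_superset [of ?K b])
  finally show ?thesis .
qed

lemma total_exponent_0 [simp]: "total_exponent 0 = 0"
  by (simp add: total_exponent_def)

lemma total_exponent_single [simp]: "total_exponent (Poly_Mapping.single g (Suc 0)) = g"
  by (simp add: total_exponent_def lessThan_Suc)

lemma hilbert_basis_total_exponent:
  assumes "hilbert_basis H G"
  shows "total_exponent ` vecs H = G"
proof
  let ?P = "\<lambda>S. 0 \<in> S \<and> (\<forall>x\<in>S. \<forall>y\<in>S. x + y \<in> S)"
  have G: "?P hull H = G" using assms by (simp add: hilbert_basis_def)
  have "0 \<in> (total_exponent ` vecs H :: 'a set)"
    by (rule image_eqI [of _ _ 0]) (auto simp: vecs_def)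
  moreover have "total_exponent a + total_exponent b \<in> total_exponent ` vecs H" if "a \<in> vecs H" "b \<in> vecs H" for a b :: "'a \<Rightarrow>\<^sub>0 nat"
    using that by (simp add: total_exponent_add [symmetric] vecs_add)
  moreover have "g \<in> total_exponent ` vecs H" if "g \<in> H" for g
    by (rule image_eqI [of _ _ "Poly_Mapping.single g 1"]) (use that in \<open>auto simp: vecs_def\<close>)
  ultimately show "G \<subseteq> total_exponent ` vecs H"
    unfolding G [symmetric] by (intro hull_minimal) auto
next
  let ?P = "\<lambda>S. 0 \<in> S \<and> (\<forall>x\<in>S. \<forall>y\<in>S. x + y \<in> S)"
  have G: "?P hull H = G" using assms by (simp add: hilbert_basis_def)
  have P: "?P (?P hull H)"
    by (rule hull_in) blast
  then have P: "0 \<in> G" "\<And>x y. x \<in> G \<Longrightarrow> y \<in> G \<Longrightarrow> x + y \<in> G"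
    unfolding G by auto
  have sum: "(\<Sum>i\<in>I. x i) \<in> G" if "\<And>i. i \<in> I \<Longrightarrow> x i \<in> G" for I :: "'i set" and x
    using that by (induction I rule: infinite_finite_induct) (auto intro: P)
  have "H \<subseteq> G"
    using hull_subset [of H ?P] G by simp
  then have "total_exponent a \<in> G" if "a \<in> vecs H" for a
    using that unfolding total_exponent_def vecs_def by (intro sum) auto
  then show "total_exponent ` vecs H \<subseteq> G" by blast
qed

lemma phi_eq_insertion:
  "phi m l = insertion (\<lambda>z. Poly_Mapping.single 0 (to_rf (const z))) (generator m l)"
  by (simp add: phi_def insertion_def monom_eval_def fun_eq_iff)

interpretation phi: coefficient_map "\<lambda>z. Poly_Mapping.single (0::ivec) (to_rf (const z))"
  by unfold_locales (simp_all add: const_add const_mult to_rf_add to_rf_mult single_add mult_single)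

lemma generator_eq: "generator m l g = Poly_Mapping.single (snd g) (laurent m l (fst g))"
  by (simp add: generator_def laurent_def split: prod.splits)

lemma monom_eval_generator:
  assumes "\<And>i. i \<le> m \<Longrightarrow> l i \<noteq> 0"
  shows "monom_eval (generator m l) a
    = Poly_Mapping.single (snd (total_exponent a)) (laurent m l (fst (total_exponent a)))"
  by (subst total_exponent_multiplicative [symmetric])
     (simp_all add: generator_eq mult_single laurent_add [OF assms])

lemma entry_phi:
  assumes "\<And>i. i \<le> m \<Longrightarrow> l i \<noteq> 0"
  shows "entry (phi m l p) u = (\<Sum>a\<in>{a\<in>supp p. snd (total_exponent a) = u}.
    to_rf (const (entry p a)) * laurent m l (fst (total_exponent a)))"
proof -
  have "entry (phi m l p) u = (\<Sum>a\<in>supp p. if snd (total_exponent a) = u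
      then to_rf (const (entry p a)) * laurent m l (fst (total_exponent a)) else 0)"
    unfolding phi_eq_insertion insertion_def lookup_sum
    by (intro sum.cong) (auto simp: monom_eval_generator [OF assms] mult_single lookup_single when_def)
  then show ?thesis
    by (simp add: sum.inter_filter)
qed


section \<open>The pairing and support functions\<close>

lemma pairing_superset:
  assumes "finite K" "supp u \<subseteq> K \<or> supp v \<subseteq> K"
  shows "pairing u v = (\<Sum>i\<in>K. entry u i * entry v i)"
proof -
  have "pairing u v = (\<Sum>i\<in>supp u \<inter> supp v. entry u i * entry v i)"
    unfolding pairing_def by (rule sum.mono_neutral_right) (auto simp: in_keys_iff)
  also have "\<dots> = (\<Sum>i\<in>K. entry u i * entry v i)"
    by (rule sum.mono_neutral_left) (use assms in \<open>auto simp: in_keys_iff\<close>)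
  finally show ?thesis .
qed

lemma pairing_commute: "pairing u v = pairing v u"
  by (simp add: pairing_superset [of "supp u" u v] pairing_superset [of "supp u" v u] mult.commute)

lemma entry_scaleR [simp]: "entry (a *\<^sub>R v) i = a * entry v i" for v :: "'i \<Rightarrow>\<^sub>0 real"
proof -
  have "finite {i. a * entry v i \<noteq> 0}"
    by (rule finite_subset [OF _ finite_keys [of v]]) (auto simp: in_keys_iff)
  then show ?thesis by (simp add: scaleR_poly_mapping_def)
qed

lemma linear_pairing_right: "linear (pairing u)"
  by (rule linearI) (simp_all add: pairing_def lookup_add algebra_simps sum.distrib sum_distrib_left)

lemma linear_pairing_left: "linear (\<lambda>u. pairing u v)"
  using linear_pairing_right [of v] by (simp add: pairing_commute [of _ v])

lemmas pairing_add_right = linear_add [OF linear_pairing_right]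
lemmas pairing_scale_right = linear_scale [OF linear_pairing_right, unfolded real_scaleR_def]
lemmas pairing_sum_right = linear_sum [OF linear_pairing_right]
lemmas pairing_neg_right = linear_neg [OF linear_pairing_right]
lemmas pairing_0_right [simp] = linear_0 [OF linear_pairing_right]
lemmas pairing_add_left = linear_add [OF linear_pairing_left]
lemmas pairing_scale_left = linear_scale [OF linear_pairing_left, unfolded real_scaleR_def]
lemmas pairing_0_left [simp] = linear_0 [OF linear_pairing_left]

lemma pairing_single_right [simp]: "pairing u (Poly_Mapping.single i x) = entry u i * x"
  by (subst pairing_superset [of "{i}"]) (auto split: if_splits)

lemma entry_of_ivec [simp]: "entry (of_ivec u) i = real_of_int (entry u i)"
  by (simp add: of_ivec_def map.rep_eq when_def)

lemma of_ivec_0 [simp]: "of_ivec 0 = 0"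
  by (rule poly_mapping_eqI) simp

lemma of_ivec_add: "of_ivec (u + v) = of_ivec u + of_ivec v"
  by (rule poly_mapping_eqI) (simp add: lookup_add)

lemma pairing_evec:
  assumes "i \<le> m"
  shows "pairing h (evec m i) = hexp m h i"
  by (simp add: evec_def hexp_def pairing_neg_right pairing_sum_right)

lemma hexp_of_ivec: "hexp m (of_ivec h) i = real_of_int (hexp m h i)"
  by (simp add: hexp_def)

lemma zero_in_cone: "rational_polyhedral_cone r \<sigma> \<Longrightarrow> 0 \<in> \<sigma>"
  unfolding rational_polyhedral_cone_def by (force intro!: exI [of _ "\<lambda>_. 0"])

lemma indicator_combination:
  assumes "finite X" "x \<in> X"
  shows "(\<Sum>y\<in>X. (if y = x then 1 else 0::real) *\<^sub>R y) = (x::'a::real_vector)"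
    and "(\<Sum>y\<in>X. (if y = x then 1 else 0::real)) = 1"
proof -
  have "(\<Sum>y\<in>X. (if y = x then 1 else 0::real) *\<^sub>R y) = (\<Sum>y\<in>X. if y = x then y else 0)"
    by (rule sum.cong) auto
  then show "(\<Sum>y\<in>X. (if y = x then 1 else 0::real) *\<^sub>R y) = x"
    using assms by simp
qed (use assms in simp)

lemma cone_generators:
  assumes "rational_polyhedral_cone r \<sigma>"
  obtains Y where "finite Y" "Y \<subseteq> NQ r"
    "\<And>u. u \<in> vecs {..<r} \<Longrightarrow> u \<in> dual_cone r \<sigma> \<longleftrightarrow> (\<forall>y\<in>Y. 0 \<le> pairing u y)"
proof -
  obtain Y where Y: "finite Y" "Y \<subseteq> NQ r"
    "\<sigma> = {\<Sum>x\<in>Y. q x *\<^sub>R x | q. \<forall>x\<in>Y. q x \<in> \<rat> \<and> 0 \<le> q x}"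
    using assms by (auto simp: rational_polyhedral_cone_def)
  have "y \<in> \<sigma>" if "y \<in> Y" for y
    unfolding Y(3) mem_Collect_eq
    by (rule exI [of _ "\<lambda>x. if x = y then 1 else 0"])
       (simp add: indicator_combination [OF Y(1) that])
  moreover have "0 \<le> pairing u v" if "\<forall>y\<in>Y. 0 \<le> pairing u y" "v \<in> \<sigma>" for u v
    using that unfolding Y(3)
    by (auto simp: pairing_sum_right pairing_scale_right intro!: sum_nonneg mult_nonneg_nonneg)
  ultimately have "u \<in> dual_cone r \<sigma> \<longleftrightarrow> (\<forall>y\<in>Y. 0 \<le> pairing u y)" if "u \<in> vecs {..<r}" for u
    using that by (auto simp: dual_cone_def)
  with Y(1,2) show ?thesis by (rule that)
qed

text \<open>
  A linear function that is nonnegative on \<open>\<sigma>\<close> attains its minimum over \<open>\<Pi> + \<sigma>\<close> at one of the finitely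
  many points that span the polytope \<open>\<Pi>\<close>.
\<close>
lemma polyhedron_vertices:
  assumes sigma: "rational_polyhedral_cone r \<sigma>" and D: "sigma_polyhedron r \<sigma> D"
  obtains X where "finite X" "X \<subseteq> NQ r" "X \<subseteq> D"
    "\<And>u y. u \<in> dual_cone r \<sigma> \<Longrightarrow> y \<in> D \<Longrightarrow> \<exists>x\<in>X. pairing u x \<le> pairing u y"
proof (cases "D = {}")
  case True
  show ?thesis by (rule that [of "{}"]) (use True in auto)
next
  case False
  then obtain P X where P: "D = P + \<sigma>" and X: "finite X" "X \<subseteq> NQ r"
    "P = {\<Sum>x\<in>X. q x *\<^sub>R x | q. (\<forall>x\<in>X. q x \<in> \<rat> \<and> 0 \<le> q x) \<and> (\<Sum>x\<in>X. q x) = 1}"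
    using D by (auto simp: sigma_polyhedron_def rational_polytope_def)
  show ?thesis
  proof (rule that [OF X(1,2)])
    have "x \<in> P" if "x \<in> X" for x
      unfolding X(3) mem_Collect_eq
      by (rule exI [of _ "\<lambda>y. if y = x then 1 else 0"])
         (simp add: indicator_combination [OF X(1) that])
    then show "X \<subseteq> D"
      unfolding P using zero_in_cone [OF sigma] by (force simp: set_plus_def)
  next
    fix u y assume u: "u \<in> dual_cone r \<sigma>" and "y \<in> D"
    then obtain p s where y: "y = p + s" "p \<in> P" "s \<in> \<sigma>"
      unfolding P by (auto elim: set_plus_elim)
    then obtain q where q: "p = (\<Sum>x\<in>X. q x *\<^sub>R x)" "\<And>x. x \<in> X \<Longrightarrow> 0 \<le> q x" "(\<Sum>x\<in>X. q x) = 1"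
      unfolding X(3) by auto
    then have "X \<noteq> {}" by auto
    then obtain x where x: "x \<in> X" "\<And>z. z \<in> X \<Longrightarrow> pairing u x \<le> pairing u z"
      using ex_is_arg_min_if_finite [OF X(1), of "pairing u"]
      by (auto simp: is_arg_min_def not_less)
    have "pairing u x = (\<Sum>z\<in>X. q z * pairing u x)"
      using q(3) by (simp add: sum_distrib_right [symmetric])
    also have "\<dots> \<le> (\<Sum>z\<in>X. q z * pairing u z)"
      by (intro sum_mono mult_left_mono x q)
    also have "\<dots> = pairing u p"
      unfolding q(1) by (simp add: pairing_sum_right pairing_scale_right)
    also have "\<dots> \<le> pairing u y"
      using u y by (simp add: pairing_add_right dual_cone_def)
    finally show "\<exists>x\<in>X. pairing u x \<le> pairing u y"
      using x(1) by blast
  qed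
qed

lemma supp_val_empty [simp]: "supp_val {} u = \<infinity>"
  by (simp add: supp_val_def top_ereal_def)

lemma supp_val_attained:
  assumes sigma: "rational_polyhedral_cone r \<sigma>" and D: "sigma_polyhedron r \<sigma> D"
    and u: "u \<in> dual_cone r \<sigma>" and ne: "D \<noteq> {}"
  obtains x where "x \<in> D" "supp_val D u = ereal (pairing u x)"
    "\<And>y. y \<in> D \<Longrightarrow> pairing u x \<le> pairing u y"
proof -
  obtain X where X: "finite X" "X \<subseteq> D"
    "\<And>y. y \<in> D \<Longrightarrow> \<exists>x\<in>X. pairing u x \<le> pairing u y"
    using polyhedron_vertices [OF sigma D] u by metis
  then have "X \<noteq> {}" using ne by blast
  then obtain x where x: "x \<in> X" "\<And>z. z \<in> X \<Longrightarrow> pairing u x \<le> pairing u z"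
    using ex_is_arg_min_if_finite [OF X(1), of "pairing u"]
    by (auto simp: is_arg_min_def not_less)
  have le: "pairing u x \<le> pairing u y" if "y \<in> D" for y
    using X(3) [OF that] x(2) by force
  have "supp_val D u = ereal (pairing u x)"
    unfolding supp_val_def
    by (rule antisym [OF INF_lower2 [of x] INF_greatest]) (use x X le in auto)
  with x X le show ?thesis by (intro that [of x]) auto
qed

lemma dual_lattice_points_iff:
  "(h, u) \<in> dual_lattice_points m r (delta_cone m \<sigma> \<Delta>) \<longleftrightarrow>
     h \<in> vecs {1..m} \<and> u \<in> vecs {..<r} \<and> of_ivec u \<in> dual_cone r \<sigma> \<and>
     (\<forall>i\<le>m. \<forall>v\<in>\<Delta> i. 0 \<le> real_of_int (hexp m h i) + pairing (of_ivec u) v)"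
proof -
  let ?G = "({0} \<times> \<sigma>) \<union> (\<Union>i\<le>m. {evec m i} \<times> \<Delta> i)"
  define f where "f = (\<lambda>z. pairing (of_ivec h) (fst z) + pairing (of_ivec u) (snd z))"
  define C where "C = {z. 0 \<le> f z}"
  have "linear f"
    unfolding f_def
    by (rule linearI) (simp_all add: pairing_add_right pairing_scale_right algebra_simps)
  then have "convex_cone C"
    unfolding C_def convex_cone_iff by (simp add: linear_add linear_scale linear_0)
  then have "delta_cone m \<sigma> \<Delta> \<subseteq> C \<longleftrightarrow> ?G \<subseteq> C"
    unfolding delta_cone_def by (rule subset_hull)
  also have "\<dots> \<longleftrightarrow> (\<forall>v\<in>\<sigma>. (0, v) \<in> C) \<and> (\<forall>i\<le>m. \<forall>v\<in>\<Delta> i. (evec m i, v) \<in> C)"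
    by blast
  also have "\<dots> \<longleftrightarrow> (\<forall>v\<in>\<sigma>. 0 \<le> pairing (of_ivec u) v) \<and>
      (\<forall>i\<le>m. \<forall>v\<in>\<Delta> i. 0 \<le> real_of_int (hexp m h i) + pairing (of_ivec u) v)"
    by (simp add: C_def f_def pairing_evec hexp_of_ivec)
  finally have "delta_cone m \<sigma> \<Delta> \<subseteq> C \<longleftrightarrow> (\<forall>v\<in>\<sigma>. 0 \<le> pairing (of_ivec u) v) \<and>
      (\<forall>i\<le>m. \<forall>v\<in>\<Delta> i. 0 \<le> real_of_int (hexp m h i) + pairing (of_ivec u) v)" .
  moreover have "(h, u) \<in> dual_lattice_points m r (delta_cone m \<sigma> \<Delta>) \<longleftrightarrow>
      h \<in> vecs {1..m} \<and> u \<in> vecs {..<r} \<and> delta_cone m \<sigma> \<Delta> \<subseteq> C"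
    unfolding dual_lattice_points_def C_def f_def by (simp add: subset_eq split_beta)
  moreover have "of_ivec u \<in> vecs {..<r} \<longleftrightarrow> u \<in> vecs {..<r}"
    by (simp add: vecs_def subset_iff in_keys_iff)
  ultimately show ?thesis
    by (simp add: dual_cone_def conj_ac)
qed


section \<open>The tropical weights and the valuation\<close>

text \<open>
  A monomial that is strictly lighter than all others has minimal exponents on \<open>S\<close> among those of its
  degree \<open>u\<close>, so in a relation between the generators nothing can cancel it.  In tropical terms: the
  initial ideal of the kernel of \<open>phi\<close> with respect to \<open>V\<close> contains no monomial.
\<close>
lemma minimum_attained_twice:
  fixes V :: "(ivec \<times> ivec \<Rightarrow>\<^sub>0 nat) \<Rightarrow> 'o::linorder"
  assumes gen: "general_full_rank c m l" and S: "S \<subset> {..m}" "card S = c"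
    and l: "\<And>i. i \<le> m \<Longrightarrow> l i \<in> homog {..c} 1"
    and nz: "\<And>i. i \<le> m \<Longrightarrow> l i \<noteq> 0"
    and mono: "\<And>a b. a \<in> supp q \<Longrightarrow> b \<in> supp q \<Longrightarrow> snd (total_exponent a) = snd (total_exponent b) \<Longrightarrow>
      (\<And>i. i \<in> S \<Longrightarrow> hexp m (fst (total_exponent a)) i \<le> hexp m (fst (total_exponent b)) i) \<Longrightarrow> V a \<le> V b"
    and q: "phi m l q = 0"
    and min: "\<And>a. a \<in> supp q \<Longrightarrow> a \<noteq> a0 \<Longrightarrow> V a0 < V a"
  shows "entry q a0 = 0"
proof (rule ccontr)
  assume "entry q a0 \<noteq> 0"
  then have a0: "a0 \<in> supp q" by (simp add: in_keys_iff)
  let ?J = "{a \<in> supp q. snd (total_exponent a) = snd (total_exponent a0)}"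
  have "entry q a0 = 0"
  proof (rule minimal_monomial_not_cancelled [OF gen S l nz, where J = ?J])
    show "(\<Sum>a\<in>?J. to_rf (const (entry q a)) *
        (\<Prod>i\<le>m. to_rf (l i) powi hexp m (fst (total_exponent a)) i)) = 0"
    proof -
      have "entry (phi m l q) (snd (total_exponent a0))
          = (\<Sum>a\<in>?J. to_rf (const (entry q a)) * laurent m l (fst (total_exponent a)))"
        by (rule entry_phi) (rule nz)
      then show ?thesis
        using q by (simp add: laurent_eq_prod [OF nz])
    qed
    show "\<exists>i\<in>S. hexp m (fst (total_exponent a0)) i < hexp m (fst (total_exponent a)) i" if "a \<in> ?J" "a \<noteq> a0" for a
    proof (rule ccontr)
      assume "\<not> (\<exists>i\<in>S. hexp m (fst (total_exponent a0)) i < hexp m (fst (total_exponent a)) i)"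
      then have "V a \<le> V a0"
        using that a0 by (intro mono) auto
      with min [of a] that show False by simp
    qed
  qed (use a0 in auto)
  with a0 show False by (simp add: in_keys_iff)
qed

text \<open>
  The maximum in the definition of the valuation is attained at every preimage whose monomials
  have distinct weights: a preimage \<open>p\<close> with larger minimal weight would, subtracted from \<open>p0\<close>,
  leave the lightest monomial of \<open>p0\<close> as the unique lightest monomial of a relation.
\<close>
lemma valuation_phi:
  assumes gen: "general_full_rank c m l" and S: "S \<subset> {..m}" "card S = c"
    and l: "\<And>i. i \<le> m \<Longrightarrow> l i \<in> homog {..c} 1"
    and nz: "\<And>i. i \<le> m \<Longrightarrow> l i \<noteq> 0"
    and mono: "\<And>a b. a \<in> vecs H \<Longrightarrow> b \<in> vecs H \<Longrightarrow> snd (total_exponent a) = snd (total_exponent b) \<Longrightarrow>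
      (\<And>i. i \<in> S \<Longrightarrow> hexp m (fst (total_exponent a)) i \<le> hexp m (fst (total_exponent b)) i) \<Longrightarrow>
      mat_exponent d A a \<le> mat_exponent d A b"
    and p0: "p0 \<in> polys H" "p0 \<noteq> 0" "inj_on (mat_exponent d A) (supp p0)"
  shows "valuation d m l H A (phi m l p0) = pre_valuation d A p0"
  unfolding valuation_def
proof (rule Greatest_equality)
  show "\<exists>p\<in>polys H. phi m l p = phi m l p0 \<and> pre_valuation d A p0 = pre_valuation d A p"
    using p0 by blast
next
  let ?V = "mat_exponent d A"
  fix y assume "\<exists>p\<in>polys H. phi m l p = phi m l p0 \<and> y = pre_valuation d A p"
  then obtain p where p: "p \<in> polys H" "phi m l p = phi m l p0" "y = pre_valuation d A p"
    by blast
  have "supp p0 \<noteq> {}"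
    using p0(2) by (metis keys_zero poly_mapping_eqI not_in_keys_iff_lookup_eq_zero empty_iff)
  then have "Min (?V ` supp p0) \<in> ?V ` supp p0"
    by (intro Min_in) auto
  then obtain a0 where a0: "a0 \<in> supp p0" "?V a0 = pre_valuation d A p0"
    by (auto simp: pre_valuation_def)
  show "y \<le> pre_valuation d A p0"
  proof (rule ccontr)
    assume less: "\<not> y \<le> pre_valuation d A p0"
    have lt_p: "?V a0 < ?V a" if "a \<in> supp p" for a
    proof -
      have "y \<le> ?V a"
        unfolding p(3) pre_valuation_def by (rule Min_le) (use that in auto)
      then show ?thesis using less a0 by simp
    qed
    have lt_p0: "?V a0 < ?V a" if "a \<in> supp p0" "a \<noteq> a0" for a
    proof -
      have "?V a0 \<le> ?V a"
        unfolding a0(2) pre_valuation_def by (rule Min_le) (use that in auto)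
      moreover have "?V a0 \<noteq> ?V a"
        using that a0 p0(3) by (auto simp: inj_on_def)
      ultimately show ?thesis by simp
    qed
    have sub: "supp (p0 - p) \<subseteq> supp p0 \<union> supp p"
      by (auto simp: in_keys_iff lookup_minus)
    have "entry (p0 - p) a0 = 0"
    proof (rule minimum_attained_twice [OF gen S l nz, where V = ?V])
      show "phi m l (p0 - p) = 0"
        using p(2) by (simp add: phi_eq_insertion phi.insertion_diff)
      show "?V a0 < ?V a" if "a \<in> supp (p0 - p)" "a \<noteq> a0" for a
        using that sub lt_p lt_p0 by blast
      show "?V a \<le> ?V b" if "a \<in> supp (p0 - p)" "b \<in> supp (p0 - p)"
        "snd (total_exponent a) = snd (total_exponent b)"
        "\<And>i. i \<in> S \<Longrightarrow> hexp m (fst (total_exponent a)) i \<le> hexp m (fst (total_exponent b)) i" for a b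
        using that sub p0(1) p(1) by (intro mono) (auto simp: polys_def)
    qed auto
    moreover have "a0 \<notin> supp p"
      using lt_p by blast
    ultimately show False
      using a0(1) by (simp add: lookup_minus in_keys_iff)
  qed
qed

lemma entry_Phi:
  assumes "finite H"
  shows "entry (Phi H z) g = (if g \<in> H
    then pairing (of_ivec (fst g)) (fst z) + pairing (of_ivec (snd g)) (snd z) else 0)"
proof -
  have "entry (Phi H z) g = (\<Sum>k\<in>H. if k = g
      then pairing (of_ivec (fst k)) (fst z) + pairing (of_ivec (snd k)) (snd z) else 0)"
    unfolding Phi_def lookup_sum
    by (intro sum.cong) (auto simp: lookup_single when_def split: prod.splits)
  then show ?thesis using assms by simp
qed

lemma mat_exponent_eq:
  assumes H: "finite H" and A: "\<And>k. k < d \<Longrightarrow> A k = Phi H (z k)" and a: "a \<in> vecs H"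
  shows "mat_exponent d A a = (\<Sum>k<d. Poly_Mapping.single k
    (pairing (of_ivec (fst (total_exponent a))) (fst (z k)) + pairing (of_ivec (snd (total_exponent a))) (snd (z k))))"
  unfolding mat_exponent_def
proof (intro sum.cong refl arg_cong2 [where f = Poly_Mapping.single])
  fix k assume k: "k \<in> {..<d}"
  let ?f = "\<lambda>g. pairing (of_ivec (fst g)) (fst (z k)) + pairing (of_ivec (snd g)) (snd (z k))"
  have "?f (total_exponent a) = (\<Sum>g\<in>supp a. of_nat (entry a g) * ?f g)"
    by (rule total_exponent_additive) (simp_all add: of_ivec_add pairing_add_left)
  moreover have "entry (A k) g = ?f g" if "g \<in> supp a" for g
    using k a that by (auto simp: A entry_Phi [OF H] vecs_def)
  ultimately show "(\<Sum>g\<in>supp a. entry (A k) g * real (entry a g)) = ?f (total_exponent a)"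
    by (simp add: mult.commute)
qed

text \<open>
  This makes the weights monotone in the exponents on \<open>S\<close> although they are compared lexicographically.
\<close>
lemma rvec_le_if_entries_le:
  fixes x y :: rvec
  assumes "\<And>k. entry x k \<le> entry y k"
  shows "x \<le> y"
proof (rule ccontr)
  assume "\<not> x \<le> y"
  then have "y < x" by simp
  then obtain k where "entry y k < entry x k"
    by (auto simp: less_poly_mapping.rep_eq less_fun_def)
  with assms [of k] show False by simp
qed


section \<open>Sections as combinations of Laurent monomials\<close>

lemma entry_mult_single:
  fixes p :: "'v cpoly"
  shows "entry (p * Poly_Mapping.single s 1) (a + s) = entry p a"
proof -
  have "entry (p * Poly_Mapping.single s 1) (a + s) = entry p a * entry (Poly_Mapping.single s (1::complex)) s"
    by (rule entry_mult_unique) auto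
  then show ?thesis by simp
qed

lemma var_power: "var i ^ n = Poly_Mapping.single (Poly_Mapping.single i n) 1"
  using monom_eval_var [of "Poly_Mapping.single i n"] by simp

text \<open>
  Unique factorization enters only in this form: \<open>x\<^sub>i\<^sup>n\<close> and \<open>x\<^sub>j\<^sup>k\<close> are coprime, as one reads off
  from exponents.
\<close>
lemma var_power_dvd:
  assumes ij: "i \<noteq> j" and eq: "p * var j ^ k = q * var i ^ n"
  obtains g where "p = g * var i ^ n"
    "\<And>a. a \<in> supp g \<Longrightarrow> a + Poly_Mapping.single i n \<in> supp p"
proof -
  let ?s = "Poly_Mapping.single i n"
  have split: "a = (a - ?s) + ?s" if a: "a \<in> supp p" for a
  proof -
    have "a + Poly_Mapping.single j k \<in> supp (q * var i ^ n)"
      using a unfolding eq [symmetric] by (simp add: var_power in_keys_iff entry_mult_single)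
    then obtain b where b: "a + Poly_Mapping.single j k = b + ?s"
      using keys_mult [of q "var i ^ n"] by (auto simp: var_power)
    have "entry (a + Poly_Mapping.single j k) i = entry (b + ?s) i"
      by (simp add: b)
    then have "n \<le> entry a i"
      using ij by (simp add: lookup_add lookup_single when_def)
    then show ?thesis
      by (intro poly_mapping_eqI) (auto simp: lookup_add lookup_minus lookup_single when_def)
  qed
  define g where "g = (\<Sum>a\<in>supp p. Poly_Mapping.single (a - ?s) (entry p a))"
  have "g * var i ^ n = (\<Sum>a\<in>supp p. Poly_Mapping.single ((a - ?s) + ?s) (entry p a))"
    by (simp add: g_def var_power sum_distrib_right mult_single)
  also have "\<dots> = (\<Sum>a\<in>supp p. Poly_Mapping.single a (entry p a))"
    by (rule sum.cong) (use split in auto)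
  finally have p: "p = g * var i ^ n"
    by (simp add: sum_single_supp)
  moreover have "a + ?s \<in> supp p" if "a \<in> supp g" for a
    using that unfolding p by (simp add: var_power in_keys_iff entry_mult_single)
  ultimately show ?thesis by (rule that)
qed

lemma var_nonzero [simp]: "var i \<noteq> 0"
  by (metis lookup_single_eq lookup_zero var_def zero_neq_one)

text \<open>
  On the chart \<open>x\<^sub>k \<noteq> 0\<close> the product of a section with \<open>\<Prod>\<^sub>i l\<^sub>i\<^bsup>a\<^sub>i\<^esup>\<close> has a power of \<open>x\<^sub>k\<close> as its
  denominator.  For \<open>c \<ge> 1\<close> there are two charts with coprime denominators, so the product is a
  polynomial; if the degree of the divisor is negative, then the polynomial is zero.
\<close>
lemma section_numerator:
  assumes c: "1 \<le> c" and f: "f \<in> sections c m l a"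
  obtains g where "g \<in> polys {..c}"
    "\<And>b. b \<in> supp g \<Longrightarrow> int (total_deg b) = (\<Sum>i\<le>m. a i)"
    "f * (\<Prod>i\<le>m. to_rf (l i) powi a i) = to_rf g"
proof -
  define D where "D = (\<Sum>i\<le>m. a i)"
  define F where "F = f * (\<Prod>i\<le>m. to_rf (l i) powi a i)"
  have chart: "\<exists>p n. p \<in> polys {..c} \<and> (\<forall>b\<in>supp p. int (total_deg b) = D + int n) \<and>
      F * to_rf (var k ^ n) = to_rf p" if k: "k \<le> c" for k
  proof -
    let ?x = "to_rf (var k)"
    have "f * (\<Prod>i\<le>m. (to_rf (l i) / ?x) powi a i) \<in> chart_ring c k"
      using f k by (simp add: sections_def)
    moreover have "f * (\<Prod>i\<le>m. (to_rf (l i) / ?x) powi a i) = F / ?x powi D"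
      by (simp add: F_def D_def power_int_divide_distrib prod_dividef power_int_sum)
    ultimately obtain p e where p: "p \<in> homog {..c} e" "F / ?x powi D = to_rf p / ?x ^ e"
      by (auto simp: chart_ring_def hom_polys_eq_homog)
    \<comment> \<open>The extra factor \<open>x\<^sub>k\<^bsup>\<bar>D\<bar>\<^esup>\<close> keeps the exponents nonnegative whatever the sign of \<open>D\<close>.\<close>
    define n where "n = nat (int e + \<bar>D\<bar> - D)"
    have "F * ?x powi int e = to_rf p * ?x powi D"
      using p(2) by (simp add: field_simps)
    then have "F * ?x powi int e * ?x powi (\<bar>D\<bar> - D) = to_rf p * (?x powi D * ?x powi (\<bar>D\<bar> - D))"
      by simp
    then have "F * ?x powi (int e + (\<bar>D\<bar> - D)) = to_rf p * ?x powi (D + (\<bar>D\<bar> - D))"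
      by (simp only: power_int_add var_nonzero to_rf_eq_0_iff not_False_eq_True simp_thms mult.assoc)
    moreover have "int e + (\<bar>D\<bar> - D) = int n" "D + (\<bar>D\<bar> - D) = int (nat \<bar>D\<bar>)"
      by (simp_all add: n_def)
    ultimately have "F * ?x ^ n = to_rf p * ?x ^ nat \<bar>D\<bar>"
      by (metis power_int_of_nat)
    then have "F * to_rf (var k ^ n) = to_rf (p * var k ^ nat \<bar>D\<bar>)"
      by (simp add: to_rf_mult to_rf_power)
    moreover have h: "p * var k ^ nat \<bar>D\<bar> \<in> homog {..c} (e + nat \<bar>D\<bar>)"
      using homog_mult [OF p(1) homog_power [OF homog_var, of k _ "nat \<bar>D\<bar>"]] k by simp
    moreover have "int (e + nat \<bar>D\<bar>) = D + int n"
      by (simp add: n_def)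
    ultimately show ?thesis
      by (intro exI [of _ "p * var k ^ nat \<bar>D\<bar>"] exI [of _ n]) (auto simp: homog_def)
  qed
  obtain p n where p: "p \<in> polys {..c}" "\<And>b. b \<in> supp p \<Longrightarrow> int (total_deg b) = D + int n"
      "F * to_rf (var 0 ^ n) = to_rf p"
    using chart [of 0] by auto
  obtain q k where q: "F * to_rf (var 1 ^ k) = to_rf q"
    using chart [of 1] c by auto
  have "to_rf (p * var 1 ^ k) = to_rf (q * var 0 ^ n)"
    unfolding to_rf_mult p(3) [symmetric] q [symmetric] by (simp add: mult_ac)
  then have "p * var 1 ^ k = q * var 0 ^ n"
    by (simp add: to_rf_eq_iff)
  then obtain g where g: "p = g * var 0 ^ n"
      "\<And>a. a \<in> supp g \<Longrightarrow> a + Poly_Mapping.single 0 n \<in> supp p"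
    using var_power_dvd [of 0 1] by (metis zero_neq_one)
  show ?thesis
  proof (rule that [of g])
    show "f * (\<Prod>i\<le>m. to_rf (l i) powi a i) = to_rf g"
      using p(3) by (simp add: F_def [symmetric] g(1) to_rf_mult to_rf_power)
    fix b assume b: "b \<in> supp g"
    show "int (total_deg b) = (\<Sum>i\<le>m. a i)"
      using p(2) [OF g(2) [OF b]] by (simp add: total_deg_add D_def)
  next
    have "b \<in> vecs {..c}" if b: "b \<in> supp g" for b
    proof -
      have "b + Poly_Mapping.single 0 n \<in> vecs {..c}"
        using g(2) [OF b] p(1) by (auto simp: polys_def)
      then show ?thesis
        by (auto simp: vecs_def subset_iff in_keys_iff lookup_add)
    qed
    then show "g \<in> polys {..c}" by (auto simp: polys_def)
  qed
qed

lemma entry_sum_single: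
  assumes "finite K"
  shows "entry (\<Sum>i\<in>K. Poly_Mapping.single i (f i)) j = (if j \<in> K then f j else 0)"
proof -
  have "entry (\<Sum>i\<in>K. Poly_Mapping.single i (f i)) j = (\<Sum>i\<in>K. if i = j then f i else 0)"
    unfolding lookup_sum by (intro sum.cong) (auto simp: lookup_single when_def)
  then show ?thesis using assms by simp
qed

lemma hexp_sum_single:
  assumes "(\<Sum>i\<le>m. g i) = 0" "i \<le> m"
  shows "hexp m (\<Sum>i=1..m. Poly_Mapping.single i (g i)) i = g i"
proof (cases "i = 0")
  case True
  have "(\<Sum>j=1..m. entry (\<Sum>i=1..m. Poly_Mapping.single i (g i)) j) = (\<Sum>j=1..m. g j)"
    by (rule sum.cong) (auto simp: entry_sum_single)
  moreover have "(\<Sum>j=1..m. g j) + g 0 = 0"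
    using assms(1) by (simp add: atMost_eq_insert_0 add.commute)
  then have "- (\<Sum>j=1..m. g j) = g 0"
    by (rule minus_unique)
  ultimately show ?thesis
    using True by (simp add: hexp_def)
next
  case False
  then show ?thesis
    using assms by (simp add: hexp_def entry_sum_single)
qed

text \<open>
  Written in the coordinates \<open>l\<^sub>i\<close>, \<open>i \<in> S \<union> {k}\<close>, a section of \<open>\<O>(\<Sum>\<^sub>i a\<^sub>i V(l\<^sub>i))\<close> becomes a
  combination of Laurent monomials that are sections themselves.  As the degree is fixed, they are
  told apart by their exponents on \<open>S\<close>.
\<close>
lemma section_expansion:
  assumes gen: "general_full_rank c m l" and S: "S \<subset> {..m}" "card S = c"
    and l: "\<And>i. i \<le> m \<Longrightarrow> l i \<in> homog {..c} 1"
    and nz: "\<And>i. i \<le> m \<Longrightarrow> l i \<noteq> 0"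
    and c: "1 \<le> c" and f: "f \<in> sections c m l a"
  obtains K z where "finite K" "K \<subseteq> vecs {1..m}"
    "f = (\<Sum>h\<in>K. to_rf (const (z h)) * laurent m l h)"
    "\<And>h i. h \<in> K \<Longrightarrow> i \<le> m \<Longrightarrow> - a i \<le> hexp m h i"
    "\<And>h h'. h \<in> K \<Longrightarrow> h' \<in> K \<Longrightarrow> (\<And>i. i \<in> S \<Longrightarrow> hexp m h i = hexp m h' i) \<Longrightarrow> h = h'"
proof -
  obtain k where k: "k \<le> m" "k \<notin> S" using S by auto
  define T where "T = insert k S"
  have finT: "finite T"
    using S unfolding T_def by (meson finite.insertI finite_atMost finite_subset psubset_imp_subset)
  have T: "T \<subseteq> {..m}" "card T = c + 1"
    using S k finT by (auto simp: T_def)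
  obtain Y where Y: "\<And>i. i \<le> c \<Longrightarrow> Y i \<in> homog T 1"
    "\<And>p. p \<in> polys {..c} \<Longrightarrow> subst l (subst Y p) = p"
    using linear_coordinates [OF gen T l] by metis
  define D where "D = (\<Sum>i\<le>m. a i)"
  obtain g where g: "g \<in> polys {..c}" "\<And>b. b \<in> supp g \<Longrightarrow> int (total_deg b) = D"
    "f * (\<Prod>i\<le>m. to_rf (l i) powi a i) = to_rf g"
    using section_numerator [OF c f] unfolding D_def by blast
  define q where "q = subst Y g"
  have q: "supp n \<subseteq> T" "int (total_deg n) = D" if n: "n \<in> supp q" for n
  proof -
    have "supp g \<noteq> {}"
      using n by (auto simp: q_def insertion_def)
    then have D: "int (nat D) = D"
      using g(2) by fastforce
    then have "g \<in> homog {..c} (nat D)"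
      using g(1) D by (auto simp: homog_def dest!: g(2))
    then have "q \<in> homog T (nat D)"
      unfolding q_def by (intro subst_homog Y) auto
    with n D show "supp n \<subseteq> T" "int (total_deg n) = D"
      by (auto simp: homog_def polys_def vecs_def)
  qed
  have deg: "int (total_deg n) = (\<Sum>i\<le>m. int (entry n i))" if n: "n \<in> supp q" for n
    using total_deg_superset [of "{..m}" n] q(1) [OF n] T by auto
  define s where "s n = (\<Sum>i=1..m. Poly_Mapping.single i (int (entry n i) - a i))" for n
  have hexp: "hexp m (s n) i = int (entry n i) - a i" if "n \<in> supp q" "i \<le> m" for n i
    unfolding s_def using deg [OF that(1)] q(2) [OF that(1)] that(2)
    by (intro hexp_sum_single) (simp_all add: sum_subtractf D_def)
  have eq: "n = n'" if n: "n \<in> supp q" "n' \<in> supp q"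
    and h: "\<And>i. i \<in> S \<Longrightarrow> hexp m (s n) i = hexp m (s n') i" for n n'
  proof -
    have S_eq: "entry n i = entry n' i" if i: "i \<in> S" for i
    proof -
      have "i \<le> m" using i S by auto
      then show ?thesis using h [OF i] by (simp add: hexp n)
    qed
    have "total_deg p = entry p k + (\<Sum>i\<in>S. entry p i)" if "p \<in> supp q" for p
      using total_deg_superset [OF finT q(1) [OF that]] k finT by (simp add: T_def)
    moreover have "total_deg n = total_deg n'"
      using q(2) [OF n(1)] q(2) [OF n(2)] by simp
    ultimately have "entry n k = entry n' k"
      using n S_eq by simp
    then have "entry n i = entry n' i" for i
    proof (cases "i \<in> T")
      case False
      then have "i \<notin> supp n" "i \<notin> supp n'" using q(1) n by blast+
      then show ?thesis by (simp add: in_keys_iff)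
    qed (use S_eq in \<open>auto simp: T_def\<close>)
    then show ?thesis by (rule poly_mapping_eqI)
  qed
  have inj: "inj_on s (supp q)"
    by (rule inj_onI) (auto intro: eq)
  define z where "z h = entry q (inv_into (supp q) s h)" for h
  let ?P = "\<Prod>i\<le>m. to_rf (l i) powi a i"
  have P: "?P \<noteq> 0"
    using nz by (auto simp: power_int_eq_0_iff)
  have mono: "to_rf (monom_eval l n) = laurent m l (s n) * ?P" if n: "n \<in> supp q" for n
  proof -
    have "monom_eval l n = (\<Prod>i\<le>m. l i ^ entry n i)"
      by (rule monom_eval_superset) (use q(1) [OF n] T in auto)
    then have "to_rf (monom_eval l n) = (\<Prod>i\<le>m. to_rf (l i) powi int (entry n i))"
      by (simp add: to_rf_prod to_rf_power)
    also have "\<dots> = (\<Prod>i\<le>m. to_rf (l i) powi hexp m (s n) i * to_rf (l i) powi a i)"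
      by (rule prod.cong) (use nz in \<open>auto simp: hexp [OF n] power_int_add [symmetric] simp del: power_int_of_nat\<close>)
    finally show ?thesis
      by (simp add: laurent_eq_prod [OF nz] prod.distrib)
  qed
  have "f * ?P = to_rf (subst l q)"
    using Y(2) [OF g(1)] g(3) by (simp add: q_def)
  also have "\<dots> = (\<Sum>n\<in>supp q. to_rf (const (entry q n)) * laurent m l (s n)) * ?P"
    by (simp add: insertion_def to_rf_sum to_rf_mult mono sum_distrib_right mult.assoc)
  finally have "f = (\<Sum>n\<in>supp q. to_rf (const (entry q n)) * laurent m l (s n))"
    using P by simp
  also have "\<dots> = (\<Sum>h\<in>s ` supp q. to_rf (const (z h)) * laurent m l h)"
    by (simp add: sum.reindex [OF inj] z_def inj)
  finally have "f = (\<Sum>h\<in>s ` supp q. to_rf (const (z h)) * laurent m l h)" .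
  then show ?thesis
  proof (rule that [rotated 2])
    show "s ` supp q \<subseteq> vecs {1..m}"
      by (auto simp: s_def vecs_def in_keys_iff entry_sum_single split: if_splits)
    fix h h' assume h: "h \<in> s ` supp q" "h' \<in> s ` supp q"
      "\<And>i. i \<in> S \<Longrightarrow> hexp m h i = hexp m h' i"
    then obtain n n' where n: "n \<in> supp q" "n' \<in> supp q" "h = s n" "h' = s n'"
      by blast
    then have "n = n'"
      using h(3) by (intro eq) auto
    then show "h = h'" by (simp add: n)
  qed (auto simp: hexp)
qed

lemma floor_supp_val_le:
  assumes "supp_val D u = ereal x" "v \<in> D"
  shows "real_of_int \<lfloor>real_of_ereal (supp_val D u)\<rfloor> \<le> pairing u v"
proof -
  have "supp_val D u \<le> ereal (pairing u v)"
    unfolding supp_val_def using assms(2) by (rule INF_lower)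
  then show ?thesis using assms(1) by simp linarith
qed

text \<open>
  The exponents are integers, so the bound \<open>- \<lfloor>\<Delta>\<^sub>i(u)\<rfloor>\<close> on the exponent of \<open>l\<^sub>i\<close> amounts to the bound
  \<open>- \<Delta>\<^sub>i(u)\<close>, which is the inequality of the dual of \<open>\<delta>\<close> for the ray through \<open>e\<^sub>i\<close>.
\<close>
lemma graded_piece_expansion:
  assumes gen: "general_full_rank c m l" and S: "S \<subset> {..m}" "card S = c"
    and l: "\<And>i. i \<le> m \<Longrightarrow> l i \<in> homog {..c} 1"
    and nz: "\<And>i. i \<le> m \<Longrightarrow> l i \<noteq> 0"
    and c: "1 \<le> c"
    and sigma: "rational_polyhedral_cone r \<sigma>"
    and Delta: "\<And>i. i \<le> m \<Longrightarrow> sigma_polyhedron r \<sigma> (\<Delta> i)"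
    and u: "u \<in> vecs {..<r}" "of_ivec u \<in> dual_cone r \<sigma>"
    and f: "f \<in> graded_piece c m l \<Delta> u"
  obtains K z where "finite K"
    "\<And>h. h \<in> K \<Longrightarrow> (h, u) \<in> dual_lattice_points m r (delta_cone m \<sigma> \<Delta>)"
    "f = (\<Sum>h\<in>K. to_rf (const (z h)) * laurent m l h)"
    "\<And>h h'. h \<in> K \<Longrightarrow> h' \<in> K \<Longrightarrow> (\<And>i. i \<in> S \<Longrightarrow> hexp m h i = hexp m h' i) \<Longrightarrow> h = h'"
proof -
  obtain a where a: "f \<in> sections c m l a"
    "\<And>i. i \<le> m \<Longrightarrow> supp_val (\<Delta> i) (of_ivec u) \<noteq> \<infinity> \<Longrightarrow>
       a i = \<lfloor>real_of_ereal (supp_val (\<Delta> i) (of_ivec u))\<rfloor>"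
    using f by (auto simp: graded_piece_def)
  obtain K z where K: "finite K" "K \<subseteq> vecs {1..m}"
    "f = (\<Sum>h\<in>K. to_rf (const (z h)) * laurent m l h)"
    "\<And>h i. h \<in> K \<Longrightarrow> i \<le> m \<Longrightarrow> - a i \<le> hexp m h i"
    "\<And>h h'. h \<in> K \<Longrightarrow> h' \<in> K \<Longrightarrow> (\<And>i. i \<in> S \<Longrightarrow> hexp m h i = hexp m h' i) \<Longrightarrow> h = h'"
    using section_expansion [OF gen S l nz c a(1)] by blast
  show ?thesis
  proof (rule that [OF K(1) _ K(3,5)])
    fix h assume h: "h \<in> K"
    have "0 \<le> real_of_int (hexp m h i) + pairing (of_ivec u) v" if i: "i \<le> m" and v: "v \<in> \<Delta> i" for i v
    proof -
      obtain x where x: "supp_val (\<Delta> i) (of_ivec u) = ereal x"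
        using supp_val_attained [OF sigma Delta [OF i] u(2)] v by (metis empty_iff)
      then have "real_of_int (a i) \<le> pairing (of_ivec u) v"
        using floor_supp_val_le [OF x v] a(2) [OF i] by simp
      moreover have "- real_of_int (a i) \<le> real_of_int (hexp m h i)"
        using K(4) [OF h i] by linarith
      ultimately show ?thesis by linarith
    qed
    with h K(2) u show "(h, u) \<in> dual_lattice_points m r (delta_cone m \<sigma> \<Delta>)"
      by (auto simp: dual_lattice_points_iff)
  qed
qed

lemma single_sum: "Poly_Mapping.single k (\<Sum>i\<in>I. f i) = (\<Sum>i\<in>I. Poly_Mapping.single k (f i))"
  by (induction I rule: infinite_finite_induct) (auto simp: single_add)

text \<open>
  Lifting the expansions of all graded pieces monomial by monomial gives a preimage under \<open>phi\<close> that
  makes the value visible: its monomials are told apart by what the weights see, namely the degree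
  \<open>u\<close> and the exponents on \<open>S\<close>.
\<close>
lemma section_ring_preimage:
  assumes gen: "general_full_rank c m l" and S: "S \<subset> {..m}" "card S = c"
    and l: "\<And>i. i \<le> m \<Longrightarrow> l i \<in> homog {..c} 1"
    and nz: "\<And>i. i \<le> m \<Longrightarrow> l i \<noteq> 0"
    and c: "1 \<le> c"
    and sigma: "rational_polyhedral_cone r \<sigma>"
    and Delta: "\<And>i. i \<le> m \<Longrightarrow> sigma_polyhedron r \<sigma> (\<Delta> i)"
    and H: "hilbert_basis H (dual_lattice_points m r (delta_cone m \<sigma> \<Delta>))"
    and f: "f \<in> section_ring c m r \<sigma> l \<Delta>"
  obtains p where "p \<in> polys H" "phi m l p = f"
    "\<And>a b. a \<in> supp p \<Longrightarrow> b \<in> supp p \<Longrightarrow> snd (total_exponent a) = snd (total_exponent b) \<Longrightarrow>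
       (\<And>i. i \<in> S \<Longrightarrow> hexp m (fst (total_exponent a)) i = hexp m (fst (total_exponent b)) i) \<Longrightarrow> a = b"
proof -
  let ?G = "dual_lattice_points m r (delta_cone m \<sigma> \<Delta>)"
  define Q where "Q u K z \<longleftrightarrow> finite K \<and> (\<forall>h\<in>K. (h, u) \<in> ?G) \<and>
      entry f u = (\<Sum>h\<in>K. to_rf (const (z h)) * laurent m l h) \<and>
      (\<forall>h\<in>K. \<forall>h'\<in>K. (\<forall>i\<in>S. hexp m h i = hexp m h' i) \<longrightarrow> h = h')" for u K z
  have "\<exists>K z. Q u K z" if u: "u \<in> supp f" for u
  proof -
    have fu: "u \<in> vecs {..<r}" "of_ivec u \<in> dual_cone r \<sigma>" "entry f u \<in> graded_piece c m l \<Delta> u"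
      using f u by (auto simp: section_ring_def)
    obtain K z where "finite K" "\<And>h. h \<in> K \<Longrightarrow> (h, u) \<in> ?G"
      "entry f u = (\<Sum>h\<in>K. to_rf (const (z h)) * laurent m l h)"
      "\<And>h h'. h \<in> K \<Longrightarrow> h' \<in> K \<Longrightarrow> (\<And>i. i \<in> S \<Longrightarrow> hexp m h i = hexp m h' i) \<Longrightarrow> h = h'"
      using graded_piece_expansion [OF gen S l nz c sigma Delta fu] by blast
    then show ?thesis
      unfolding Q_def by (intro exI [of _ K] exI [of _ z]) simp
  qed
  then obtain K z where "\<And>u. u \<in> supp f \<Longrightarrow> Q u (K u) (z u)"
    by metis
  then have K: "\<And>u. u \<in> supp f \<Longrightarrow> finite (K u)"
    "\<And>u h. u \<in> supp f \<Longrightarrow> h \<in> K u \<Longrightarrow> (h, u) \<in> ?G"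
    "\<And>u. u \<in> supp f \<Longrightarrow> entry f u = (\<Sum>h\<in>K u. to_rf (const (z u h)) * laurent m l h)"
    "\<And>u h h'. u \<in> supp f \<Longrightarrow> h \<in> K u \<Longrightarrow> h' \<in> K u \<Longrightarrow>
       (\<And>i. i \<in> S \<Longrightarrow> hexp m h i = hexp m h' i) \<Longrightarrow> h = h'"
    unfolding Q_def by simp_all
  have "\<forall>g\<in>?G. \<exists>a. a \<in> vecs H \<and> total_exponent a = g"
    using hilbert_basis_total_exponent [OF H] by (metis imageE)
  then obtain lift where lift: "\<And>g. g \<in> ?G \<Longrightarrow> lift g \<in> vecs H" "\<And>g. g \<in> ?G \<Longrightarrow> total_exponent (lift g) = g"
    by metis
  define p where "p = (\<Sum>u\<in>supp f. \<Sum>h\<in>K u. Poly_Mapping.single (lift (h, u)) (z u h))"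
  have supp_p: "\<exists>u\<in>supp f. \<exists>h\<in>K u. a = lift (h, u)" if "a \<in> supp p" for a
  proof -
    have "entry p a \<noteq> 0" using that by (simp add: in_keys_iff)
    then obtain u h where "u \<in> supp f" "h \<in> K u" "entry (Poly_Mapping.single (lift (h, u)) (z u h)) a \<noteq> 0"
      unfolding p_def lookup_sum by (metis (no_types, lifting) sum.neutral)
    then show ?thesis by (auto simp: lookup_single when_def split: if_splits)
  qed
  show ?thesis
  proof (rule that)
    show "p \<in> polys H"
      using supp_p K(2) lift(1) by (fastforce simp: polys_def)
    have "phi m l p = (\<Sum>u\<in>supp f. \<Sum>h\<in>K u.
        Poly_Mapping.single u (to_rf (const (z u h)) * laurent m l h))"
      unfolding p_def phi_eq_insertion phi.insertion_sum
      by (intro sum.cong refl)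
        (simp add: phi.insertion_single monom_eval_generator [OF nz] lift K(2) mult_single)
    also have "\<dots> = (\<Sum>u\<in>supp f. Poly_Mapping.single u (entry f u))"
      by (intro sum.cong refl) (simp add: K(3) single_sum)
    finally show "phi m l p = f"
      by (simp add: sum_single_supp)
    fix a b assume ab: "a \<in> supp p" "b \<in> supp p" "snd (total_exponent a) = snd (total_exponent b)"
      "\<And>i. i \<in> S \<Longrightarrow> hexp m (fst (total_exponent a)) i = hexp m (fst (total_exponent b)) i"
    obtain u h where a: "u \<in> supp f" "h \<in> K u" "a = lift (h, u)"
      using supp_p [OF ab(1)] by blast
    obtain u' h' where b: "u' \<in> supp f" "h' \<in> K u'" "b = lift (h', u')"
      using supp_p [OF ab(2)] by blast
    have "u = u'"
      using ab(3) by (simp add: a b lift K(2))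
    moreover have "h = h'"
      using ab(4) K(4) [of u h h'] a b \<open>u = u'\<close> by (simp add: lift K(2))
    ultimately show "a = b" by (simp add: a b)
  qed
qed

text \<open>
  Here the divisor has to be found: where \<open>\<Delta>\<^sub>i\<close> is empty, the coefficient of \<open>V(l\<^sub>i)\<close> is free and is
  chosen so that it just admits the pole or zero of the character.
\<close>
lemma monomial_in_section_ring:
  assumes l: "\<And>i. i \<le> m \<Longrightarrow> l i \<in> homog {..c} 1"
    and nz: "\<And>i. i \<le> m \<Longrightarrow> l i \<noteq> 0"
    and sigma: "rational_polyhedral_cone r \<sigma>"
    and Delta: "\<And>i. i \<le> m \<Longrightarrow> sigma_polyhedron r \<sigma> (\<Delta> i)"
    and hu: "(h, u) \<in> dual_lattice_points m r (delta_cone m \<sigma> \<Delta>)"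
  shows "Poly_Mapping.single u (laurent m l h) \<in> section_ring c m r \<sigma> l \<Delta>"
proof -
  have u: "u \<in> vecs {..<r}" "of_ivec u \<in> dual_cone r \<sigma>"
    and ge: "\<And>i v. i \<le> m \<Longrightarrow> v \<in> \<Delta> i \<Longrightarrow> 0 \<le> real_of_int (hexp m h i) + pairing (of_ivec u) v"
    using hu by (auto simp: dual_lattice_points_iff)
  define a where "a i = (if supp_val (\<Delta> i) (of_ivec u) = \<infinity> then - hexp m h i
      else \<lfloor>real_of_ereal (supp_val (\<Delta> i) (of_ivec u))\<rfloor>)" for i
  have pos: "0 \<le> hexp m h i + a i" if i: "i \<le> m" for i
  proof (cases "supp_val (\<Delta> i) (of_ivec u) = \<infinity>")
    case False
    then have "\<Delta> i \<noteq> {}" by auto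
    then obtain x where x: "x \<in> \<Delta> i" "supp_val (\<Delta> i) (of_ivec u) = ereal (pairing (of_ivec u) x)"
      using supp_val_attained [OF sigma Delta [OF i] u(2)] by metis
    have "- hexp m h i \<le> \<lfloor>pairing (of_ivec u) x\<rfloor>"
      using ge [OF i x(1)] by (simp add: le_floor_iff)
    then show ?thesis by (simp add: a_def x(2))
  qed (simp add: a_def)
  have "laurent m l h \<in> sections c m l a"
    unfolding sections_def
  proof (intro CollectI allI impI)
    fix k assume k: "k \<le> c"
    let ?x = "to_rf (var k)"
    define e where "e i = nat (hexp m h i + a i)" for i
    have e: "hexp m h i + a i = int (e i)" if "i \<le> m" for i
      using pos [OF that] by (simp add: e_def)
    have "(\<Sum>i\<le>m. a i) = (\<Sum>i\<le>m. hexp m h i + a i)"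
      by (simp add: sum.distrib sum_hexp)
    also have "\<dots> = int (\<Sum>i\<le>m. e i)"
      by (simp add: e)
    finally have sum: "(\<Sum>i\<le>m. a i) = int (\<Sum>i\<le>m. e i)" .
    have "laurent m l h * (\<Prod>i\<le>m. (to_rf (l i) / ?x) powi a i)
        = (\<Prod>i\<le>m. to_rf (l i) powi hexp m h i * to_rf (l i) powi a i) / ?x powi (\<Sum>i\<le>m. a i)"
      by (simp add: laurent_eq_prod [OF nz] power_int_divide_distrib prod_dividef power_int_sum prod.distrib)
    also have "(\<Prod>i\<le>m. to_rf (l i) powi hexp m h i * to_rf (l i) powi a i) = to_rf (\<Prod>i\<le>m. l i ^ e i)"
      unfolding to_rf_prod
      by (rule prod.cong) (use nz in \<open>auto simp: power_int_add [symmetric] e to_rf_power\<close>)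
    also have "?x powi (\<Sum>i\<le>m. a i) = ?x ^ (\<Sum>i\<le>m. e i)"
      by (simp only: sum power_int_of_nat)
    finally have "laurent m l h * (\<Prod>i\<le>m. (to_rf (l i) / ?x) powi a i)
        = to_rf (\<Prod>i\<le>m. l i ^ e i) / ?x ^ (\<Sum>i\<le>m. e i)" .
    moreover have "(\<Prod>i\<le>m. l i ^ e i) \<in> homog {..c} (\<Sum>i\<le>m. 1 * e i)"
      by (intro homog_prod homog_power l) auto
    ultimately show "laurent m l h * (\<Prod>i\<le>m. (to_rf (l i) / ?x) powi a i) \<in> chart_ring c k"
      by (auto simp: chart_ring_def hom_polys_eq_homog)
  qed
  then have "laurent m l h \<in> graded_piece c m l \<Delta> u"
    by (auto simp: graded_piece_def a_def intro!: exI [of _ a])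
  with u show ?thesis
    by (simp add: section_ring_def)
qed


section \<open>Lattice points in rational cones\<close>

lemma common_denominator:
  assumes "finite R" "R \<subseteq> (\<rat>::real set)"
  shows "\<exists>d::nat. 0 < d \<and> (\<forall>x\<in>R. real d * x \<in> \<int>)"
  using assms
proof (induction R)
  case (insert x R)
  then obtain d where d: "0 < d" "\<forall>x\<in>R. real d * x \<in> \<int>" by auto
  have "x \<in> \<rat>" using insert by simp
  then obtain a :: int and b :: nat where x: "x = a / b" "b \<noteq> 0"
    unfolding Rats_eq_int_div_nat by blast
  have "real (d * b) * x = real_of_int (int d * a)"
    using x by simp
  then have "real (d * b) * x \<in> \<int>"
    by (metis Ints_of_int)
  moreover have "real (d * b) * y \<in> \<int>" if "y \<in> R" for y
  proof -
    have "real (d * b) * y = real b * (real d * y)" by simp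
    also have "\<dots> \<in> \<int>" by (rule Ints_mult) (use d that in auto)
    finally show ?thesis .
  qed
  ultimately show ?case
    using d x by (intro exI [of _ "d * b"]) auto
qed (auto intro: exI [of _ 1])

text \<open>
  Simultaneous Diophantine approximation finds lattice points of a rational cone near any ray of
  the cone.  If an integral functional is nonnegative at \<open>\<theta>\<close> and \<open>p\<close> is very close to \<open>q \<theta>\<close>, then
  the functional takes an integral value greater than \<open>-1\<close> at \<open>p\<close>.
\<close>
lemma integral_points_near_ray:
  fixes \<theta> :: "'i \<Rightarrow> real" and F :: "('i \<Rightarrow> real) set"
  assumes I: "finite I" and F: "finite F" and rat: "\<And>a i. a \<in> F \<Longrightarrow> i \<in> I \<Longrightarrow> a i \<in> \<rat>"
    and pos: "\<And>a. a \<in> F \<Longrightarrow> 0 \<le> (\<Sum>i\<in>I. a i * \<theta> i)" and eps: "0 < \<epsilon>"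
  obtains q :: real and p :: "'i \<Rightarrow> int" where "0 < q"
    "\<And>a::'i \<Rightarrow> real. a \<in> F \<Longrightarrow> 0 \<le> (\<Sum>i\<in>I. a i * p i)" "\<And>i. i \<in> I \<Longrightarrow> \<bar>p i / q - \<theta> i\<bar> < \<epsilon>"
proof -
  have "finite ((\<lambda>(a, i). a i) ` (F \<times> I))" "(\<lambda>(a, i). a i) ` (F \<times> I) \<subseteq> \<rat>"
    using I F rat by auto
  from common_denominator [OF this] obtain d :: nat where d: "0 < d"
    "\<And>a i. a \<in> F \<Longrightarrow> i \<in> I \<Longrightarrow> real d * a i \<in> \<int>"
    by auto
  define C where "C = (\<Sum>a\<in>F. \<Sum>i\<in>I. \<bar>real d * a i\<bar>)"
  \<comment> \<open>An error of less than \<open>1/N\<close> in each coordinate changes the integral functionals \<open>d a\<close>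
    by less than 1.\<close>
  obtain N :: nat where N: "max (C + 1) (1 / \<epsilon>) < real N"
    using reals_Archimedean2 by blast
  have C: "0 \<le> C" unfolding C_def by (intro sum_nonneg) auto
  have N0: "0 < N" using N C by linarith
  obtain \<beta> where \<beta>: "bij_betw \<beta> {..<card I} I"
    using ex_bij_betw_nat_finite [OF I] atLeast0LessThan by metis
  obtain q p' where q: "0 < (q::int)"
    and p': "\<And>i. i < card I \<Longrightarrow> \<bar>of_int q * \<theta> (\<beta> i) - of_int (p' i)\<bar> < 1 / N"
    using Dirichlet_approx_simult [OF N0, of "card I" "\<lambda>i. \<theta> (\<beta> i)"] by blast
  define p where "p i = p' (inv_into {..<card I} \<beta> i)" for i
  have p: "\<bar>of_int q * \<theta> i - of_int (p i)\<bar> < 1 / N" if i: "i \<in> I" for i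
  proof -
    have "i \<in> \<beta> ` {..<card I}"
      using \<beta> i by (simp add: bij_betw_def)
    then have "inv_into {..<card I} \<beta> i \<in> {..<card I}" "\<beta> (inv_into {..<card I} \<beta> i) = i"
      by (simp_all only: f_inv_into_f inv_into_into)
    with p' [of "inv_into {..<card I} \<beta> i"] show ?thesis by (simp add: p_def)
  qed
  show ?thesis
  proof (rule that [of "of_int q" p])
    show "0 < real_of_int q" using q by simp
  next
    fix i assume i: "i \<in> I"
    have q1: "1 \<le> real_of_int q" using q by simp
    let ?y = "of_int q * \<theta> i - of_int (p i)"
    have "p i / real_of_int q - \<theta> i = - ?y / of_int q"
      using q by (simp add: field_simps)
    then have "\<bar>p i / real_of_int q - \<theta> i\<bar> = \<bar>?y\<bar> / of_int q"
      using q by (simp add: abs_divide)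
    also have "\<dots> \<le> \<bar>?y\<bar>"
      using mult_left_mono [OF q1, of "\<bar>?y\<bar>"] q by (simp add: divide_le_eq)
    also have "\<dots> < 1 / N" by (rule p [OF i])
    also have "\<dots> < \<epsilon>"
    proof -
      have "1 / \<epsilon> < real N" using N by simp
      then show ?thesis using eps N0 by (simp add: field_simps)
    qed
    finally show "\<bar>p i / real_of_int q - \<theta> i\<bar> < \<epsilon>" .
  next
    fix a :: "'i \<Rightarrow> real" assume a: "a \<in> F"
    let ?b = "\<lambda>i. real d * a i"
    have int: "(\<Sum>i\<in>I. ?b i * p i) \<in> \<int>"
      by (intro Ints_sum Ints_mult d(2) [OF a]) auto
    have "(\<Sum>i\<in>I. \<bar>?b i\<bar>) \<le> C"
      unfolding C_def by (rule member_le_sum) (use a F in \<open>auto intro: sum_nonneg\<close>)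
    have "(\<Sum>i\<in>I. ?b i * (of_int q * \<theta> i)) - (\<Sum>i\<in>I. ?b i * p i)
        = (\<Sum>i\<in>I. ?b i * (of_int q * \<theta> i - p i))"
      by (simp add: sum_subtractf right_diff_distrib)
    also have "\<dots> \<le> (\<Sum>i\<in>I. \<bar>?b i\<bar> * (1 / N))"
    proof (rule sum_mono)
      fix i assume i: "i \<in> I"
      have "?b i * (of_int q * \<theta> i - p i) \<le> \<bar>?b i\<bar> * \<bar>of_int q * \<theta> i - p i\<bar>"
        by (metis abs_ge_self abs_mult)
      also have "\<dots> \<le> \<bar>?b i\<bar> * (1 / N)"
        by (rule mult_left_mono) (use p [OF i] in auto)
      finally show "?b i * (of_int q * \<theta> i - p i) \<le> \<bar>?b i\<bar> * (1 / N)" .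
    qed
    also have "\<dots> = (\<Sum>i\<in>I. \<bar>?b i\<bar>) / N"
      by (simp add: sum_divide_distrib)
    also have "\<dots> \<le> C / N"
      by (rule divide_right_mono) (use \<open>(\<Sum>i\<in>I. \<bar>?b i\<bar>) \<le> C\<close> in auto)
    also have "\<dots> < 1"
      using N C N0 by (simp add: field_simps)
    finally have "(\<Sum>i\<in>I. ?b i * (of_int q * \<theta> i)) - 1 < (\<Sum>i\<in>I. ?b i * p i)"
      by linarith
    moreover have "(\<Sum>i\<in>I. ?b i * (of_int q * \<theta> i)) = real d * of_int q * (\<Sum>i\<in>I. a i * \<theta> i)"
      by (simp add: sum_distrib_left mult_ac)
    then have "0 \<le> (\<Sum>i\<in>I. ?b i * (of_int q * \<theta> i))"
      using pos [OF a] q by simp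
    ultimately have "-1 < (\<Sum>i\<in>I. ?b i * p i)" by linarith
    with int have "0 \<le> (\<Sum>i\<in>I. ?b i * p i)"
      by (auto elim!: Ints_cases)
    moreover have "(\<Sum>i\<in>I. ?b i * p i) = real d * (\<Sum>i\<in>I. a i * p i)"
      by (simp add: sum_distrib_left mult_ac)
    ultimately show "0 \<le> (\<Sum>i\<in>I. a i * p i)"
      using d(1) by (simp add: zero_le_mult_iff)
  qed
qed

lemma vecs_expand:
  fixes v :: rvec
  assumes "finite K" "v \<in> vecs K"
  shows "v = (\<Sum>i\<in>K. entry v i *\<^sub>R Poly_Mapping.single i 1)"
proof (rule poly_mapping_eqI)
  fix j
  have "entry (\<Sum>i\<in>K. entry v i *\<^sub>R Poly_Mapping.single i 1) j = (\<Sum>i\<in>K. if i = j then entry v i else 0)"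
    unfolding lookup_sum by (intro sum.cong) (auto simp: lookup_single when_def)
  then show "entry v j = entry (\<Sum>i\<in>K. entry v i *\<^sub>R Poly_Mapping.single i 1) j"
    using assms by (auto simp: vecs_def in_keys_iff)
qed

lemma tendsto_vecs:
  fixes V :: "nat \<Rightarrow> rvec"
  assumes K: "finite K" and V: "\<And>n. V n \<in> vecs K" "v \<in> vecs K"
    and lim: "\<And>i. i \<in> K \<Longrightarrow> (\<lambda>n. entry (V n) i) \<longlonglongrightarrow> entry v i"
  shows "V \<longlonglongrightarrow> v"
proof -
  have "(\<lambda>n. \<Sum>i\<in>K. entry (V n) i *\<^sub>R Poly_Mapping.single i 1)
      \<longlonglongrightarrow> (\<Sum>i\<in>K. entry v i *\<^sub>R Poly_Mapping.single i (1::real))"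
    by (intro tendsto_sum tendsto_scaleR lim tendsto_const)
  then show ?thesis
    using vecs_expand [OF K] V by simp
qed

lemma lattice_points_near_ray:
  fixes Z :: "(rvec \<times> rvec) set"
  assumes Z: "finite Z" "\<And>z i. z \<in> Z \<Longrightarrow> entry (fst z) i \<in> \<rat> \<and> entry (snd z) i \<in> \<rat>"
    and x: "h \<in> vecs {1..m}" "u \<in> vecs {..<r}"
    and pos: "\<And>z. z \<in> Z \<Longrightarrow> 0 \<le> pairing h (fst z) + pairing u (snd z)"
  obtains q :: "nat \<Rightarrow> real" and hs us :: "nat \<Rightarrow> ivec" where "\<And>n. 0 < q n"
    "\<And>n. hs n \<in> vecs {1..m}" "\<And>n. us n \<in> vecs {..<r}"
    "\<And>n z. z \<in> Z \<Longrightarrow> 0 \<le> pairing (of_ivec (hs n)) (fst z) + pairing (of_ivec (us n)) (snd z)"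
    "(\<lambda>n. (1 / q n) *\<^sub>R of_ivec (hs n)) \<longlonglongrightarrow> h" "(\<lambda>n. (1 / q n) *\<^sub>R of_ivec (us n)) \<longlonglongrightarrow> u"
proof -
  let ?I = "{1..m} <+> {..<r}"
  let ?f = "\<lambda>z. case_sum (entry (fst z)) (entry (snd z)) :: nat + nat \<Rightarrow> real"
  define \<theta> where "\<theta> = (case_sum (entry h) (entry u) :: nat + nat \<Rightarrow> real)"
  have pair: "pairing k (fst z) + pairing v (snd z) = (\<Sum>i\<in>?I. ?f z i * case_sum (entry k) (entry v) i)"
    if "k \<in> vecs {1..m}" "v \<in> vecs {..<r}" for k v z
    using that by (simp add: sum.Plus pairing_superset [of "{1..m}" k] pairing_superset [of "{..<r}" v]
        vecs_def mult.commute)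
  define Q where "Q n q p \<longleftrightarrow> 0 < q \<and>
      (\<forall>a\<in>?f ` Z. 0 \<le> (\<Sum>i\<in>?I. a i * real_of_int (p i))) \<and>
      (\<forall>i\<in>?I. \<bar>p i / q - \<theta> i\<bar> < inverse (Suc n))" for n q and p :: "nat + nat \<Rightarrow> int"
  have "\<exists>q p. Q n q p" for n
  proof -
    have rat: "\<And>a i. a \<in> ?f ` Z \<Longrightarrow> i \<in> ?I \<Longrightarrow> a i \<in> \<rat>"
      using Z(2) by (auto split: sum.splits)
    have pos': "\<And>a. a \<in> ?f ` Z \<Longrightarrow> 0 \<le> (\<Sum>i\<in>?I. a i * \<theta> i)"
      using pos pair [OF x] by (auto simp: \<theta>_def)
    have fin: "finite ?I" "finite (?f ` Z)" using Z(1) by auto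
    have "0 < inverse (real (Suc n))" by simp
    then obtain q :: real and p :: "nat + nat \<Rightarrow> int" where "0 < q"
      "\<And>a::nat + nat \<Rightarrow> real. a \<in> ?f ` Z \<Longrightarrow> 0 \<le> (\<Sum>i\<in>?I. a i * p i)"
      "\<And>i. i \<in> ?I \<Longrightarrow> \<bar>p i / q - \<theta> i\<bar> < inverse (Suc n)"
      using integral_points_near_ray [where I = ?I and F = "?f ` Z" and \<theta> = \<theta>] fin rat pos' by blast
    then show ?thesis
      unfolding Q_def by blast
  qed
  then obtain q p where "\<And>n. Q n (q n) (p n)"
    by metis
  then have qp: "\<And>n. 0 < q n"
    "\<And>n a. a \<in> ?f ` Z \<Longrightarrow> 0 \<le> (\<Sum>i\<in>?I. a i * real_of_int (p n i))"
    "\<And>n i. i \<in> ?I \<Longrightarrow> \<bar>p n i / q n - \<theta> i\<bar> < inverse (Suc n)"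
    unfolding Q_def by blast+
  have lim: "(\<lambda>n. p n i / q n) \<longlonglongrightarrow> \<theta> i" if "i \<in> ?I" for i
  proof (rule LIM_zero_cancel)
    show "(\<lambda>n. p n i / q n - \<theta> i) \<longlonglongrightarrow> 0"
    proof (rule Lim_null_comparison [OF _ LIMSEQ_inverse_real_of_nat])
      show "\<forall>\<^sub>F n in sequentially. norm (p n i / q n - \<theta> i) \<le> inverse (real (Suc n))"
        using qp(3) [OF that] by (intro always_eventually allI) (simp add: less_imp_le)
    qed
  qed
  define hs where "hs n = (\<Sum>i=1..m. Poly_Mapping.single i (p n (Inl i)))" for n
  define us where "us n = (\<Sum>i<r. Poly_Mapping.single i (p n (Inr i)))" for n
  have hs: "hs n \<in> vecs {1..m}" and us: "us n \<in> vecs {..<r}" for n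
    by (auto simp: hs_def us_def vecs_def in_keys_iff entry_sum_single split: if_splits)
  have hs': "of_ivec (hs n) \<in> vecs {1..m}" and us': "of_ivec (us n) \<in> vecs {..<r}" for n
    using hs [of n] us [of n] by (auto simp: vecs_def in_keys_iff subset_iff)
  have scale: "a *\<^sub>R v \<in> vecs K" if "v \<in> vecs K" for a K and v :: rvec
    using that by (auto simp: vecs_def in_keys_iff subset_iff)
  show ?thesis
  proof (rule that [OF qp(1) hs us])
    fix n z assume z: "z \<in> Z"
    have "(\<Sum>i\<in>?I. ?f z i * case_sum (entry (of_ivec (hs n))) (entry (of_ivec (us n))) i)
        = (\<Sum>i\<in>?I. ?f z i * real_of_int (p n i))"
      by (rule sum.cong) (auto simp: hs_def us_def entry_sum_single)
    then show "0 \<le> pairing (of_ivec (hs n)) (fst z) + pairing (of_ivec (us n)) (snd z)"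
      unfolding pair [OF hs' us'] using qp(2) z by auto
  next
    show "(\<lambda>n. (1 / q n) *\<^sub>R of_ivec (hs n)) \<longlonglongrightarrow> h"
    proof (rule tendsto_vecs [OF _ scale [OF hs'] x(1)])
      fix i assume i: "i \<in> {1..m}"
      then have eq: "(\<lambda>n. entry ((1 / q n) *\<^sub>R of_ivec (hs n)) i) = (\<lambda>n. p n (Inl i) / q n)"
        by (simp add: hs_def entry_sum_single fun_eq_iff)
      have "Inl i \<in> ?I" using i by auto
      from lim [OF this] show "(\<lambda>n. entry ((1 / q n) *\<^sub>R of_ivec (hs n)) i) \<longlonglongrightarrow> entry h i"
        unfolding eq by (simp add: \<theta>_def)
    qed simp
    show "(\<lambda>n. (1 / q n) *\<^sub>R of_ivec (us n)) \<longlonglongrightarrow> u"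
    proof (rule tendsto_vecs [OF _ scale [OF us'] x(2)])
      fix i assume i: "i \<in> {..<r}"
      then have eq: "(\<lambda>n. entry ((1 / q n) *\<^sub>R of_ivec (us n)) i) = (\<lambda>n. p n (Inr i) / q n)"
        by (simp add: us_def entry_sum_single fun_eq_iff)
      have "Inr i \<in> ?I" using i by auto
      from lim [OF this] show "(\<lambda>n. entry ((1 / q n) *\<^sub>R of_ivec (us n)) i) \<longlonglongrightarrow> entry u i"
        unfolding eq by (simp add: \<theta>_def)
    qed simp
  qed
qed


section \<open>The rows of the weight matrix\<close>

lemma subspace_vecs: "subspace (vecs K :: rvec set)"
proof (rule subspaceI)
  show "a *\<^sub>R x \<in> vecs K" if "x \<in> vecs K" for a and x :: rvec
    using that by (auto simp: vecs_def in_keys_iff subset_iff)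
  show "x + y \<in> vecs K" if "x \<in> vecs K" "y \<in> vecs K" for x y :: rvec
    using that by (rule vecs_add)
qed (simp add: vecs_def)

lemma subspace_vecs_Times: "subspace (vecs K \<times> vecs L :: (rvec \<times> rvec) set)"
  by (intro subspace_Times subspace_vecs)

definition weight_map :: "nat \<Rightarrow> (nat \<Rightarrow> rvec \<times> rvec) \<Rightarrow> rvec \<times> rvec \<Rightarrow> rvec" where
  "weight_map d R x =
     (\<Sum>k<d. Poly_Mapping.single k (pairing (fst x) (fst (R k)) + pairing (snd x) (snd (R k))))"

lemma entry_weight_map:
  "entry (weight_map d R x) k =
     (if k < d then pairing (fst x) (fst (R k)) + pairing (snd x) (snd (R k)) else 0)"
  by (simp add: weight_map_def entry_sum_single)

lemma linear_weight_map: "linear (weight_map d R)"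
  by (rule linearI; rule poly_mapping_eqI)
     (simp_all add: entry_weight_map lookup_add pairing_add_left pairing_scale_left algebra_simps)

text \<open>
  As many independent vectors as the dimension span the space, so a vector that is orthogonal to
  all rows is orthogonal to itself; and the images of the rows are again a basis.
\<close>
lemma bij_betw_weight_map:
  fixes R :: "nat \<Rightarrow> rvec \<times> rvec"
  assumes fin: "finite K" "finite L" and d: "card K + card L = d"
    and R: "\<And>k. k < d \<Longrightarrow> R k \<in> vecs K \<times> vecs L"
    and ind: "inj_on R {..<d}" "independent (R ` {..<d})"
  shows "bij_betw (weight_map d R) (vecs K \<times> vecs L) (vecs {..<d})"
proof -
  let ?W = "vecs K \<times> vecs L :: (rvec \<times> rvec) set" and ?B = "weight_map d R" and ?s = "\<lambda>i. Poly_Mapping.single i (1::real)"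
  define E where "E = (\<lambda>i. (?s i, 0::rvec)) ` K \<union> (\<lambda>i. (0::rvec, ?s i)) ` L"
  have finE: "finite E" using fin by (simp add: E_def)
  have "card E \<le> card ((\<lambda>i. (?s i, 0::rvec)) ` K) + card ((\<lambda>i. (0::rvec, ?s i)) ` L)"
    unfolding E_def by (rule card_Un_le)
  also have "\<dots> \<le> d"
    unfolding d [symmetric] by (intro add_mono card_image_le fin)
  finally have cardE: "card E \<le> d" .
  have W_span: "x \<in> span E" if "x \<in> ?W" for x
  proof -
    have "x = (\<Sum>i\<in>K. entry (fst x) i *\<^sub>R (?s i, 0)) + (\<Sum>i\<in>L. entry (snd x) i *\<^sub>R (0, ?s i))"
      using vecs_expand [OF fin(1), of "fst x"] vecs_expand [OF fin(2), of "snd x"] that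
      by (auto simp: prod_eq_iff fst_sum snd_sum)
    also have "\<dots> \<in> span E"
      by (intro span_add span_sum span_scale span_base) (auto simp: E_def)
    finally show ?thesis .
  qed
  have cardR: "card (R ` {..<d}) = d"
    by (simp add: card_image [OF ind(1)])
  have RW: "R ` {..<d} \<subseteq> ?W"
    by (rule image_subsetI, rule R) simp
  have span: "span (R ` {..<d}) = ?W"
  proof
    show "span (R ` {..<d}) \<subseteq> ?W"
      by (rule span_minimal [OF RW subspace_vecs_Times])
    show "?W \<subseteq> span (R ` {..<d})"
    proof
      fix x assume "x \<in> ?W"
      then have "x \<in> span E" by (rule W_span)
      moreover have "R ` {..<d} \<subseteq> span E"
        using subsetI [of ?W "span E", OF W_span] RW by (rule order_trans [rotated])
      ultimately show "x \<in> span (R ` {..<d})"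
        by (intro real_vector.independent_spans_of_card [OF _ ind(2) _ finE])
          (simp_all only: cardE cardR finite_imageI finite_lessThan)
    qed
  qed
  have ker: "x = 0" if x: "x \<in> ?W" "?B x = 0" for x
  proof -
    let ?P = "{y. pairing (fst x) (fst y) + pairing (snd x) (snd y) = 0}"
    have "R k \<in> ?P" if "k < d" for k
      using entry_weight_map [of d R x k] x(2) that by simp
    moreover have "subspace ?P"
      by (rule subspaceI) (auto simp: pairing_add_right pairing_scale_right
          add_eq_0_iff2 distrib_left [symmetric] simp flip: distrib_left)
    ultimately have "?W \<subseteq> ?P"
      unfolding span [symmetric] by (intro span_minimal) auto
    then have sum: "pairing (fst x) (fst x) + pairing (snd x) (snd x) = 0"
      using x(1) by auto
    have sq: "0 \<le> pairing v v" "pairing v v = 0 \<Longrightarrow> v = 0" for v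
    proof -
      show "0 \<le> pairing v v"
        unfolding pairing_def by (rule sum_nonneg) simp
      assume "pairing v v = 0"
      then have "\<forall>i\<in>supp v. entry v i * entry v i = 0"
        unfolding pairing_def by (subst (asm) sum_nonneg_eq_0_iff) auto
      then show "v = 0"
        by (intro poly_mapping_eqI) (auto simp: in_keys_iff)
    qed
    have "pairing (fst x) (fst x) = 0" "pairing (snd x) (snd x) = 0"
      using sum sq(1) [of "fst x"] sq(1) [of "snd x"] by linarith+
    then show "x = 0"
      by (simp add: prod_eq_iff sq(2))
  qed
  have inj: "inj_on ?B ?W"
    using linear_inj_on_iff_eq_0 [OF linear_weight_map subspace_vecs_Times] ker by blast
  have into: "?B x \<in> vecs {..<d}" for x
    by (auto simp: vecs_def in_keys_iff entry_weight_map split: if_splits)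
  have "vecs {..<d} \<subseteq> ?B ` ?W"
  proof
    fix y :: rvec assume y: "y \<in> vecs {..<d}"
    have vecs_span: "v \<in> span (?s ` {..<d})" if v: "v \<in> vecs {..<d}" for v
    proof -
      have "(\<Sum>i<d. entry v i *\<^sub>R ?s i) \<in> span (?s ` {..<d})"
        by (intro span_sum span_scale span_base) auto
      then show ?thesis using vecs_expand [OF _ v] by simp
    qed
    have "inj_on ?B (R ` {..<d})"
      by (rule inj_on_subset [OF inj RW])
    then have "card (?B ` (R ` {..<d})) = d"
      by (simp add: card_image cardR)
    moreover have "independent (?B ` (R ` {..<d}))"
      by (rule linear_independent_injective_image [OF linear_weight_map ind(2)]) (simp add: span inj)
    moreover have "?B ` (R ` {..<d}) \<subseteq> span (?s ` {..<d})"
      using into vecs_span by blast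
    moreover have "card (?s ` {..<d}) \<le> d"
      using card_image_le [of "{..<d}" ?s] by simp
    ultimately have "y \<in> span (?B ` (R ` {..<d}))"
      using real_vector.independent_spans_of_card [of "?B ` (R ` {..<d})" "?s ` {..<d}" y]
        vecs_span [OF y] by simp
    then show "y \<in> ?B ` ?W"
      unfolding linear_span_image [OF linear_weight_map] span .
  qed
  with into inj show ?thesis
    by (auto simp: bij_betw_def)
qed

lemma independent_preimages:
  fixes f :: "'a::real_vector \<Rightarrow> 'b::real_vector"
  assumes f: "linear f" and K: "finite K"
    and ind: "inj_on (\<lambda>k. f (R k)) K" "independent ((\<lambda>k. f (R k)) ` K)"
  shows "inj_on R K" "independent (R ` K)"
proof -
  show inj: "inj_on R K"
    using ind(1) by (auto simp: inj_on_def)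
  show "independent (R ` K)"
  proof (rule real_vector.independent_if_scalars_zero)
    fix g x assume g: "(\<Sum>x\<in>R ` K. g x *\<^sub>R x) = 0" and "x \<in> R ` K"
    then obtain k where k: "k \<in> K" "x = R k" by blast
    let ?u = "\<lambda>y. g (R (inv_into K (\<lambda>k. f (R k)) y))"
    have "(\<Sum>k\<in>K. g (R k) *\<^sub>R R k) = 0"
      using g by (simp add: sum.reindex [OF inj])
    from arg_cong [OF this, of f] have "(\<Sum>k\<in>K. g (R k) *\<^sub>R f (R k)) = 0"
      by (simp add: linear_sum [OF f] linear_scale [OF f] linear_0 [OF f])
    then have "(\<Sum>y\<in>(\<lambda>k. f (R k)) ` K. ?u y *\<^sub>R y) = 0"
      by (simp add: sum.reindex [OF ind(1)] inv_into_f_f [OF ind(1)])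
    then have "?u (f (R k)) = 0"
      using independentD [OF ind(2) _ order_refl, of ?u "f (R k)"] K k by blast
    then show "g x = 0"
      using k by (simp add: inv_into_f_f [OF ind(1)])
  qed (use K in simp)
qed


section \<open>Coordinate cones\<close>

text \<open>
  Subtracting a small multiple of \<open>\<Sum>\<^sub>j e j\<close> from a point of the relative interior does not leave the
  cone; so the coefficients of the point can be chosen positive.
\<close>
lemma rel_interior_cone_positive:
  fixes e :: "'i \<Rightarrow> 'a::real_normed_vector"
  assumes S: "finite S" and x: "x \<in> rel_interior (convex_cone hull (e ` S))"
  obtains s where "\<And>j. j \<in> S \<Longrightarrow> 0 < s j" "x = (\<Sum>j\<in>S. s j *\<^sub>R e j)"
proof -
  let ?C = "convex_cone hull (e ` S)"
  define D where "D = {\<Sum>j\<in>S. s j *\<^sub>R e j | s. \<forall>j\<in>S. (0::real) \<le> s j}"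
  have "convex_cone D"
    unfolding convex_cone_iff
  proof (intro conjI ballI allI impI)
    show "0 \<in> D"
      unfolding D_def by (auto intro!: exI [of _ "\<lambda>_. 0"])
    fix y assume "y \<in> D"
    then obtain s where s: "y = (\<Sum>j\<in>S. s j *\<^sub>R e j)" "\<forall>j\<in>S. 0 \<le> s j"
      by (auto simp: D_def)
    show "a *\<^sub>R y \<in> D" if "0 \<le> a" for a
      unfolding D_def s using s(2) that
      by (auto simp: scaleR_sum_right intro!: exI [of _ "\<lambda>j. a * s j"])
    fix z assume "z \<in> D"
    then obtain t where t: "z = (\<Sum>j\<in>S. t j *\<^sub>R e j)" "\<forall>j\<in>S. 0 \<le> t j"
      by (auto simp: D_def)
    show "y + z \<in> D"
      unfolding D_def s t using s(2) t(2)
      by (auto simp: sum.distrib scaleR_add_left intro!: exI [of _ "\<lambda>j. s j + t j"])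
  qed
  moreover have "e ` S \<subseteq> D"
  proof
    fix y assume "y \<in> e ` S"
    then obtain k where k: "k \<in> S" "y = e k" by blast
    have "(\<Sum>j\<in>S. (if j = k then 1 else 0) *\<^sub>R e j) = (\<Sum>j\<in>S. if j = k then e j else 0)"
      by (rule sum.cong) auto
    also have "\<dots> = y" using S k by simp
    finally show "y \<in> D"
      unfolding D_def by (auto intro!: exI [of _ "\<lambda>j. if j = k then 1 else 0"])
  qed
  ultimately have sub: "?C \<subseteq> D"
    by (intro hull_minimal) auto
  have cone: "convex_cone ?C" by (rule convex_cone_convex_cone_hull)
  define y where "y = (\<Sum>j\<in>S. e j)"
  have zero: "0 \<in> ?C" by (rule convex_cone_contains_0 [OF cone])
  have "(\<Sum>j\<in>J. e j) \<in> ?C" if "J \<subseteq> S" for J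
    using finite_subset [OF that S] that
  proof (induction J rule: finite_induct)
    case (insert j J)
    then show ?case
      by (simp add: convex_cone_add [OF cone] hull_inc)
  qed (simp add: zero)
  then have y: "y \<in> ?C" by (simp add: y_def)
  obtain T where T: "open T" "x \<in> T" "T \<inter> affine hull ?C \<subseteq> ?C" and xC: "x \<in> ?C"
    using x by (auto simp: rel_interior_def openin_open)
  then obtain \<epsilon> where \<epsilon>: "0 < \<epsilon>" "ball x \<epsilon> \<subseteq> T"
    by (meson open_contains_ball)
  define \<delta> where "\<delta> = \<epsilon> / (norm y + 1)"
  have \<delta>: "0 < \<delta>" using \<epsilon>(1) by (simp add: \<delta>_def add_nonneg_pos)
  have "norm y + 1 \<noteq> 0"
    by (smt (verit) norm_ge_zero)
  then have "\<delta> * (norm y + 1) = \<epsilon>"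
    by (simp add: \<delta>_def)
  then have "\<delta> * norm y < \<epsilon>"
    using \<delta> by (simp add: distrib_left)
  then have "x + \<delta> *\<^sub>R (0 - y) \<in> T"
    using \<epsilon> \<delta> by (intro subsetD [OF \<epsilon>(2)]) (simp add: dist_norm)
  moreover have "x + \<delta> *\<^sub>R (0 - y) \<in> affine hull ?C"
    by (rule mem_affine_3_minus) (auto intro: hull_inc xC zero y)
  ultimately have "x + \<delta> *\<^sub>R (0 - y) \<in> D"
    using T(3) sub by blast
  then obtain s where s: "x + \<delta> *\<^sub>R (0 - y) = (\<Sum>j\<in>S. s j *\<^sub>R e j)" "\<forall>j\<in>S. 0 \<le> s j"
    by (auto simp: D_def)
  show ?thesis
  proof (rule that [of "\<lambda>j. s j + \<delta>"])
    show "x = (\<Sum>j\<in>S. (s j + \<delta>) *\<^sub>R e j)"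
      using s(1) by (simp add: scaleR_add_left sum.distrib y_def scaleR_sum_right algebra_simps)
  qed (use s(2) \<delta> in \<open>auto simp: add_nonneg_pos\<close>)
qed

lemma entry_evec:
  "i \<le> m \<Longrightarrow> j \<le> m \<Longrightarrow>
     entry (evec m j) i = (if i = j then 1 else 0) - (if j = 0 then 1 else 0)"
  by (auto simp: evec_def entry_sum_single lookup_single when_def)

text \<open>
  For \<open>w = \<Sum>\<^sub>j\<^sub>\<in>\<^sub>S s\<^sub>j e\<^sub>j\<close> the coordinates of \<open>w\<close> are, up to a common shift, the \<open>s\<^sub>j\<close> on \<open>S\<close> and zero
  elsewhere.
\<close>
lemma minimizing_indices_rel_interior:
  assumes S: "S \<subset> {..m}" and w: "w \<in> rel_interior (convex_cone hull (evec m ` S))"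
  shows "minimizing_indices m w = {..m} - S"
proof -
  have finS: "finite S" using S finite_subset by blast
  obtain s where s: "\<And>j. j \<in> S \<Longrightarrow> 0 < s j" "w = (\<Sum>j\<in>S. s j *\<^sub>R evec m j)"
    using rel_interior_cone_positive [OF finS w] by blast
  define t where "t j = (if j \<in> S then s j else 0)" for j
  have w_eq: "entry w i = t i - t 0" if i: "i \<le> m" for i
  proof -
    have "entry w i = (\<Sum>j\<in>S. t j * entry (evec m j) i)"
      by (simp add: s(2) lookup_sum t_def)
    also have "\<dots> = (\<Sum>j\<le>m. t j * entry (evec m j) i)"
      by (rule sum.mono_neutral_left) (use S in \<open>auto simp: t_def\<close>)
    also have "\<dots> = (\<Sum>j\<le>m. (if j = i then t j else 0) - (if j = 0 then t j else 0))"
      by (rule sum.cong) (use i in \<open>auto simp: entry_evec algebra_simps\<close>)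
    also have "\<dots> = t i - t 0"
      using i by (simp add: sum_subtractf)
    finally show ?thesis .
  qed
  have t: "0 \<le> t j" for j
    using s(1) [of j] by (auto simp: t_def)
  obtain k where k: "k \<le> m" "k \<notin> S" using S by auto
  have "Min (entry w ` {..m}) = - t 0"
  proof (rule Min_eqI)
    show "- t 0 \<in> entry w ` {..m}"
      by (rule image_eqI [of _ _ k]) (use k in \<open>auto simp: w_eq t_def\<close>)
  qed (use t w_eq in auto)
  then have "minimizing_indices m w = {i. i \<le> m \<and> t i = 0}"
    by (auto simp: minimizing_indices_def w_eq)
  also have "\<dots> = {..m} - S"
    using s(1) by (force simp: t_def)
  finally show ?thesis .
qed


section \<open>The cone defined by the support functions\<close>

definition support_cone ::
    "nat \<Rightarrow> nat \<Rightarrow> rvec set \<Rightarrow> (nat \<Rightarrow> rvec set) \<Rightarrow> (nat \<Rightarrow> nat) \<Rightarrow> nat set \<Rightarrow> (rvec \<times> rvec) set" where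
  "support_cone c r \<sigma> \<Delta> \<iota> I = {(v, u). v \<in> vecs {1..c} \<and> u \<in> dual_cone r \<sigma> \<and>
     ereal (\<Sum>i=1..c. entry v i) \<le> (\<Sum>j\<in>I. supp_val (\<Delta> j) u) \<and>
     (\<forall>j\<in>{1..c}. - supp_val (\<Delta> (\<iota> j)) u \<le> ereal (entry v j))}"

lemma neg_supp_val_le_iff:
  assumes sigma: "rational_polyhedral_cone r \<sigma>" and D: "sigma_polyhedron r \<sigma> D"
    and u: "u \<in> dual_cone r \<sigma>"
  shows "- supp_val D u \<le> ereal t \<longleftrightarrow> (\<forall>x\<in>D. 0 \<le> t + pairing u x)"
proof (cases "D = {}")
  case False
  obtain x where x: "x \<in> D" "supp_val D u = ereal (pairing u x)" "\<And>y. y \<in> D \<Longrightarrow> pairing u x \<le> pairing u y"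
    using supp_val_attained [OF sigma D u False] by blast
  have "(\<forall>y\<in>D. 0 \<le> t + pairing u y) \<longleftrightarrow> 0 \<le> t + pairing u x"
    using x(1,3) by force
  then show ?thesis by (simp add: x(2)) linarith
qed simp

text \<open>
  The minimum of a sum of linear functions with independent arguments is the sum of the minima; a
  vacuous condition on the right corresponds to a summand \<open>\<infinity>\<close> on the left.
\<close>
lemma le_sum_supp_val_iff:
  assumes sigma: "rational_polyhedral_cone r \<sigma>" and I: "finite I"
    and D: "\<And>i. i \<in> I \<Longrightarrow> sigma_polyhedron r \<sigma> (\<Delta> i)" and u: "u \<in> dual_cone r \<sigma>"
  shows "ereal t \<le> (\<Sum>j\<in>I. supp_val (\<Delta> j) u) \<longleftrightarrow>
    (\<forall>x. (\<forall>j\<in>I. x j \<in> \<Delta> j) \<longrightarrow> t \<le> (\<Sum>j\<in>I. pairing u (x j)))"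
proof (cases "\<exists>j\<in>I. \<Delta> j = {}")
  case True
  then obtain j where "j \<in> I" "supp_val (\<Delta> j) u = \<infinity>"
    by auto
  then have "(\<Sum>j\<in>I. supp_val (\<Delta> j) u) = \<infinity>"
    using I unfolding sum_Pinfty by blast
  then show ?thesis using True by auto
next
  case False
  have "\<exists>x. x \<in> \<Delta> j \<and> supp_val (\<Delta> j) u = ereal (pairing u x) \<and>
      (\<forall>y\<in>\<Delta> j. pairing u x \<le> pairing u y)" if j: "j \<in> I" for j
    using supp_val_attained [OF sigma D [OF j] u] False j by metis
  then obtain x where x: "\<And>j. j \<in> I \<Longrightarrow> x j \<in> \<Delta> j"
    "\<And>j. j \<in> I \<Longrightarrow> supp_val (\<Delta> j) u = ereal (pairing u (x j))"
    "\<And>j y. j \<in> I \<Longrightarrow> y \<in> \<Delta> j \<Longrightarrow> pairing u (x j) \<le> pairing u y"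
    by metis
  have "(\<Sum>j\<in>I. supp_val (\<Delta> j) u) = ereal (\<Sum>j\<in>I. pairing u (x j))"
    by (simp add: x(2))
  moreover have "(\<Sum>j\<in>I. pairing u (x j)) \<le> (\<Sum>j\<in>I. pairing u (y j))" if "\<forall>j\<in>I. y j \<in> \<Delta> j" for y
    by (rule sum_mono) (use x(3) that in blast)
  ultimately show ?thesis
    using x(1) by (auto intro: order_trans)
qed

text \<open>In this form the cone is visibly closed and convex.\<close>
lemma support_cone_halfspaces:
  assumes sigma: "rational_polyhedral_cone r \<sigma>" and I: "finite I"
    and D: "\<forall>i\<in>I \<union> \<iota> ` {1..c}. sigma_polyhedron r \<sigma> (\<Delta> i)"
  shows "support_cone c r \<sigma> \<Delta> \<iota> I =
    {z. fst z \<in> vecs {1..c} \<and> snd z \<in> vecs {..<r} \<and> (\<forall>y\<in>\<sigma>. 0 \<le> pairing (snd z) y) \<and>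
      (\<forall>x. (\<forall>j\<in>I. x j \<in> \<Delta> j) \<longrightarrow> (\<Sum>i=1..c. entry (fst z) i) \<le> (\<Sum>j\<in>I. pairing (snd z) (x j))) \<and>
      (\<forall>j\<in>{1..c}. \<forall>x\<in>\<Delta> (\<iota> j). 0 \<le> entry (fst z) j + pairing (snd z) x)}"
proof -
  have "(v, u) \<in> support_cone c r \<sigma> \<Delta> \<iota> I \<longleftrightarrow>
      v \<in> vecs {1..c} \<and> u \<in> dual_cone r \<sigma> \<and>
      (\<forall>x. (\<forall>j\<in>I. x j \<in> \<Delta> j) \<longrightarrow> (\<Sum>i=1..c. entry v i) \<le> (\<Sum>j\<in>I. pairing u (x j))) \<and>
      (\<forall>j\<in>{1..c}. \<forall>x\<in>\<Delta> (\<iota> j). 0 \<le> entry v j + pairing u x)" for v u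
  proof (cases "u \<in> dual_cone r \<sigma>")
    case True
    then show ?thesis
      using neg_supp_val_le_iff [OF sigma _ True] le_sum_supp_val_iff [OF sigma I _ True] D
      by (simp add: support_cone_def)
  qed (simp add: support_cone_def)
  then show ?thesis
    by (auto simp: dual_cone_def)
qed

lemma bounded_linear_entry: "bounded_linear (\<lambda>v::rvec. entry v i)"
proof (rule bounded_linear_intro [where K = 1])
  fix v :: rvec
  have "\<bar>entry v i\<bar> \<le> (\<Sum>n\<in>supp v. \<bar>entry v n\<bar>)"
  proof (cases "i \<in> supp v")
    case True
    then show ?thesis by (intro member_le_sum) auto
  qed (auto simp: in_keys_iff intro: sum_nonneg)
  then show "norm (entry v i) \<le> norm v * 1"
    by (simp add: norm_poly_mapping_def dist_poly_mapping_def)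
qed (simp_all add: lookup_add)

lemmas continuous_on_entry [continuous_intros] = bounded_linear.continuous_on [OF bounded_linear_entry]

lemma pairing_eq_sum_right: "pairing u v = (\<Sum>i\<in>supp v. entry u i * entry v i)"
  by (rule pairing_superset) auto

lemma continuous_on_pairing [continuous_intros]:
  assumes "continuous_on A f"
  shows "continuous_on A (\<lambda>x. pairing (f x) y)"
  unfolding pairing_eq_sum_right by (intro continuous_intros assms)

lemma closed_vecs: "closed (vecs K :: rvec set)"
proof -
  have "(vecs K :: rvec set) = (\<Inter>i\<in>-K. {v. entry v i = 0})"
    by (auto simp: vecs_def in_keys_iff)
  also have "closed \<dots>"
    by (intro closed_INT ballI closed_Collect_eq continuous_intros)
  finally show ?thesis .
qed

lemma closed_support_cone:
  assumes "rational_polyhedral_cone r \<sigma>" "finite I"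
    and "\<forall>i\<in>I \<union> \<iota> ` {1..c}. sigma_polyhedron r \<sigma> (\<Delta> i)"
  shows "closed (support_cone c r \<sigma> \<Delta> \<iota> I)"
proof -
  have v: "closed {z::rvec \<times> rvec. fst z \<in> vecs K}" "closed {z::rvec \<times> rvec. snd z \<in> vecs K}" for K
    using closed_vimage [OF closed_vecs continuous_on_fst [OF continuous_on_id], of K]
      closed_vimage [OF closed_vecs continuous_on_snd [OF continuous_on_id], of K]
    by (simp_all add: vimage_def)
  show ?thesis
    unfolding support_cone_halfspaces [OF assms] Ball_def
    by (intro closed_Collect_conj closed_Collect_all closed_Collect_imp open_Collect_const
        closed_Collect_le v continuous_intros)
qed

lemma convex_cone_support_cone:
  assumes "rational_polyhedral_cone r \<sigma>" "finite I"
    and "\<forall>i\<in>I \<union> \<iota> ` {1..c}. sigma_polyhedron r \<sigma> (\<Delta> i)"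
  shows "convex_cone (support_cone c r \<sigma> \<Delta> \<iota> I)"
  unfolding convex_cone_iff
proof (intro conjI ballI allI impI)
  note hs = support_cone_halfspaces [OF assms]
  show "0 \<in> support_cone c r \<sigma> \<Delta> \<iota> I"
    unfolding hs by (simp add: vecs_def)
  fix z assume z: "z \<in> support_cone c r \<sigma> \<Delta> \<iota> I"
  show "a *\<^sub>R z \<in> support_cone c r \<sigma> \<Delta> \<iota> I" if "0 \<le> a" for a
    using z that unfolding hs
    by (auto simp: subspace_scale [OF subspace_vecs] pairing_scale_left sum_distrib_left [symmetric]
        mult_left_mono distrib_left [symmetric] simp del: distrib_left_numeral)
  fix y assume y: "y \<in> support_cone c r \<sigma> \<Delta> \<iota> I"
  have "0 \<le> (entry (fst z) j + entry (fst y) j) + (pairing (snd z) x + pairing (snd y) x)"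
    if "j \<in> {1..c}" "x \<in> \<Delta> (\<iota> j)" for j x
  proof -
    have "0 \<le> entry (fst z) j + pairing (snd z) x" "0 \<le> entry (fst y) j + pairing (snd y) x"
      using y z that unfolding hs by blast+
    then show ?thesis by linarith
  qed
  then show "z + y \<in> support_cone c r \<sigma> \<Delta> \<iota> I"
    using y z unfolding hs
    by (auto simp: vecs_add pairing_add_left sum.distrib lookup_add intro: add_mono)
qed

text \<open>
  The exponent at the point \<open>\<Inter>\<^sub>i\<^sub>\<in>\<^sub>S V(l\<^sub>i)\<close> of the section \<open>t\<^sup>h \<chi>\<^sup>u\<close>, in the coordinates indexed by
  \<open>S = {\<iota> 1, \<dots>, \<iota> c}\<close>.
\<close>
definition local_exponent :: "nat \<Rightarrow> nat \<Rightarrow> (nat \<Rightarrow> nat) \<Rightarrow> ivec \<times> ivec \<Rightarrow> rvec \<times> rvec" where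
  "local_exponent c m \<iota> g =
     (\<Sum>j=1..c. Poly_Mapping.single j (real_of_int (hexp m (fst g) (\<iota> j))), of_ivec (snd g))"

text \<open>
  The homogeneous exponents of a character have sum zero, so the sum of those on \<open>S\<close> is minus the
  sum of the others, each of which is at least \<open>- \<Delta>\<^sub>j(u)\<close>.
\<close>
lemma local_exponent_in_support_cone:
  assumes sigma: "rational_polyhedral_cone r \<sigma>"
    and D: "\<And>i. i \<le> m \<Longrightarrow> sigma_polyhedron r \<sigma> (\<Delta> i)"
    and S: "S \<subset> {..m}" and iota: "bij_betw \<iota> {1..c} S"
    and g: "g \<in> dual_lattice_points m r (delta_cone m \<sigma> \<Delta>)"
  shows "local_exponent c m \<iota> g \<in> support_cone c r \<sigma> \<Delta> \<iota> ({..m} - S)"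
proof -
  obtain h u where hu: "g = (h, u)" by (cases g)
  have h: "u \<in> vecs {..<r}" "of_ivec u \<in> dual_cone r \<sigma>"
    "\<And>i x. i \<le> m \<Longrightarrow> x \<in> \<Delta> i \<Longrightarrow> 0 \<le> real_of_int (hexp m h i) + pairing (of_ivec u) x"
    using g by (auto simp: hu dual_lattice_points_iff)
  have iota_m: "\<iota> j \<le> m" if "j \<in> {1..c}" for j
    using bij_betwE [OF iota] that S by auto
  define v where "v = (\<Sum>j=1..c. Poly_Mapping.single j (real_of_int (hexp m h (\<iota> j))))"
  have "(\<Sum>j=1..c. entry v j)
      = (\<Sum>j=1..c. real_of_int (hexp m h (\<iota> j)))"
    by (rule sum.cong) (auto simp: v_def entry_sum_single)
  also have "\<dots> = (\<Sum>i\<in>S. real_of_int (hexp m h i))"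
    by (rule sum.reindex_bij_betw [OF iota])
  also have "\<dots> = - (\<Sum>i\<in>{..m} - S. real_of_int (hexp m h i))"
  proof -
    have "(\<Sum>i\<le>m. real_of_int (hexp m h i)) = 0"
      using sum_hexp [of m h] by (metis of_int_0 of_int_sum)
    moreover have "(\<Sum>i\<le>m. real_of_int (hexp m h i))
        = (\<Sum>i\<in>{..m} - S. real_of_int (hexp m h i)) + (\<Sum>i\<in>S. real_of_int (hexp m h i))"
      by (rule sum.subset_diff) (use S in auto)
    ultimately show ?thesis by linarith
  qed
  finally have sum: "(\<Sum>j=1..c. entry v j)
      = (\<Sum>i\<in>{..m} - S. - real_of_int (hexp m h i))"
    by (simp add: sum_negf)
  have le: "(\<Sum>i\<in>{..m} - S. - real_of_int (hexp m h i)) \<le> (\<Sum>j\<in>{..m} - S. pairing (of_ivec u) (x j))"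
    if "\<forall>j\<in>{..m} - S. x j \<in> \<Delta> j" for x
  proof (rule sum_mono)
    fix i assume "i \<in> {..m} - S"
    then show "- real_of_int (hexp m h i) \<le> pairing (of_ivec u) (x i)"
      using h(3) [of i "x i"] that by auto
  qed
  have "0 \<le> entry v j + pairing (of_ivec u) x"
    if "j \<in> {1..c}" "x \<in> \<Delta> (\<iota> j)" for j x
    using h(3) [OF iota_m that(2)] that by (simp add: v_def entry_sum_single)
  moreover have "v \<in> vecs {1..c}"
    by (auto simp: vecs_def in_keys_iff v_def entry_sum_single split: if_splits)
  moreover have "finite ({..m} - S)" by simp
  moreover have "\<forall>i\<in>({..m} - S) \<union> \<iota> ` {1..c}. sigma_polyhedron r \<sigma> (\<Delta> i)"
    using D iota_m by auto
  ultimately have "(v, of_ivec u) \<in> support_cone c r \<sigma> \<Delta> \<iota> ({..m} - S)"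
    using h(2) le
    by (subst support_cone_halfspaces [OF sigma]) (simp_all add: sum dual_cone_def del: One_nat_def)
  then show ?thesis
    by (simp add: local_exponent_def hu v_def)
qed

lemma tendsto_pairing:
  assumes "f \<longlonglongrightarrow> l"
  shows "(\<lambda>n. pairing (f n) y) \<longlonglongrightarrow> pairing l y"
  unfolding pairing_eq_sum_right
  by (intro tendsto_sum tendsto_mult tendsto_const bounded_linear.tendsto [OF bounded_linear_entry] assms)

lemma entry_evec_rational: "entry (evec m i) j \<in> \<rat>"
  by (auto simp: evec_def entry_sum_single lookup_single when_def)

text \<open>
  Conversely, the slack in the inequality for \<open>\<Sum>\<^sub>i v\<^sub>i\<close> can be put into a single coordinate outside
  \<open>S\<close>, and this lifts a point of the cone to a point of the real dual cone of \<open>\<delta>\<close>.  That cone is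
  rational, so lattice points approximate the ray through the lift.
\<close>
lemma support_cone_subset_closure:
  assumes sigma: "rational_polyhedral_cone r \<sigma>"
    and D: "\<And>i. i \<le> m \<Longrightarrow> sigma_polyhedron r \<sigma> (\<Delta> i)"
    and S: "S \<subset> {..m}" and iota: "bij_betw \<iota> {1..c} S"
  shows "support_cone c r \<sigma> \<Delta> \<iota> ({..m} - S) \<subseteq> closure (convex_cone hull
    (local_exponent c m \<iota> ` dual_lattice_points m r (delta_cone m \<sigma> \<Delta>)))" (is "_ \<subseteq> closure ?C")
proof
  let ?G = "dual_lattice_points m r (delta_cone m \<sigma> \<Delta>)" and ?I = "{..m} - S"
  fix z assume z: "z \<in> support_cone c r \<sigma> \<Delta> \<iota> ?I"
  obtain v u where vu: "z = (v, u)" by (cases z)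
  have iota_m: "\<iota> j \<le> m" "\<iota> j \<in> S" if "j \<in> {1..c}" for j
    using bij_betwE [OF iota] that S by auto
  have sp: "\<forall>i\<in>?I \<union> \<iota> ` {1..c}. sigma_polyhedron r \<sigma> (\<Delta> i)"
    using D iota_m by auto
  have hs: "v \<in> vecs {1..c}" "u \<in> dual_cone r \<sigma>"
    "\<And>x. (\<And>j. j \<in> ?I \<Longrightarrow> x j \<in> \<Delta> j) \<Longrightarrow> (\<Sum>i=1..c. entry v i) \<le> (\<Sum>j\<in>?I. pairing u (x j))"
    "\<And>j x. j \<in> {1..c} \<Longrightarrow> x \<in> \<Delta> (\<iota> j) \<Longrightarrow> 0 \<le> entry v j + pairing u x"
    using z support_cone_halfspaces [OF sigma _ sp]
    by (auto simp: vu dual_cone_def)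
  have u: "u \<in> vecs {..<r}" using hs(2) by (simp add: dual_cone_def)
  have "\<exists>x. \<Delta> i \<noteq> {} \<longrightarrow> x \<in> \<Delta> i \<and> (\<forall>y\<in>\<Delta> i. pairing u x \<le> pairing u y)" if i: "i \<le> m" for i
    using supp_val_attained [OF sigma D [OF i] hs(2)] by metis
  then obtain a where a: "\<And>i. i \<le> m \<Longrightarrow> \<Delta> i \<noteq> {} \<Longrightarrow> a i \<in> \<Delta> i"
    "\<And>i y. i \<le> m \<Longrightarrow> y \<in> \<Delta> i \<Longrightarrow> pairing u (a i) \<le> pairing u y"
    by (metis empty_iff)
  have "?I \<noteq> {}" using S by auto
  then obtain k where k: "k \<in> ?I" "\<And>i. i \<in> ?I \<Longrightarrow> \<Delta> i = {} \<Longrightarrow> \<Delta> k = {}"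
    by (metis ex_in_conv)
  \<comment> \<open>Outside \<open>S\<close> all exponents are at their lower bounds, except that the one at \<open>k\<close> takes up the
    slack; \<open>k\<close> is an index with empty \<open>\<Delta> k\<close>, hence without a lower bound, if there is one.\<close>
  define g where "g i = (if i \<in> S then entry v (inv_into {1..c} \<iota> i)
    else if i = k then - (\<Sum>j=1..c. entry v j) + (\<Sum>j\<in>?I - {k}. pairing u (a j))
    else - pairing u (a i))" for i
  have g_iota: "g (\<iota> j) = entry v j" if "j \<in> {1..c}" for j
    using that iota_m(2) [OF that] bij_betw_inv_into_left [OF iota that] by (simp add: g_def)
  have g_sum: "(\<Sum>i\<le>m. g i) = 0"
  proof -
    have "(\<Sum>i\<le>m. g i) = (\<Sum>i\<in>?I. g i) + (\<Sum>i\<in>S. g i)"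
      by (rule sum.subset_diff) (use S in auto)
    also have "(\<Sum>i\<in>S. g i) = (\<Sum>j=1..c. entry v j)"
      using sum.reindex_bij_betw [OF iota, of g] g_iota by simp
    also have "(\<Sum>i\<in>?I. g i) = g k + (\<Sum>i\<in>?I - {k}. g i)"
      by (rule sum.remove) (use k in auto)
    also have "(\<Sum>i\<in>?I - {k}. g i) = - (\<Sum>j\<in>?I - {k}. pairing u (a j))"
      by (simp add: sum_negf [symmetric]) (rule sum.cong, auto simp: g_def)
    also have "g k = - (\<Sum>j=1..c. entry v j) + (\<Sum>j\<in>?I - {k}. pairing u (a j))"
      using k by (simp add: g_def)
    finally show ?thesis by simp
  qed
  have g_pos: "0 \<le> g i + pairing u x" if i: "i \<le> m" and x: "x \<in> \<Delta> i" for i x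
  proof -
    consider "i \<in> S" | "i = k" "i \<notin> S" | "i \<noteq> k" "i \<notin> S" by blast
    then show ?thesis
    proof cases
      case 1
      then obtain j where "j \<in> {1..c}" "i = \<iota> j"
        using bij_betw_imp_surj_on [OF iota] by blast
      then show ?thesis using hs(4) x g_iota by simp
    next
      case 2
      then have "\<And>j. j \<in> ?I \<Longrightarrow> \<Delta> j \<noteq> {}"
        using k(2) x by blast
      then have "(\<Sum>j=1..c. entry v j) \<le> (\<Sum>j\<in>?I. pairing u (a j))"
        by (intro hs(3) a(1)) auto
      also have "\<dots> = pairing u (a k) + (\<Sum>j\<in>?I - {k}. pairing u (a j))"
        by (rule sum.remove) (use k in auto)
      finally show ?thesis
        using a(2) [OF i x] 2 by (simp add: g_def)
    next
      case 3
      then show ?thesis using a(2) [OF i x] by (simp add: g_def)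
    qed
  qed
  define h where "h = (\<Sum>i=1..m. Poly_Mapping.single i (g i))"
  have h: "h \<in> vecs {1..m}"
    by (auto simp: h_def vecs_def in_keys_iff entry_sum_single split: if_splits)
  have hexp_h: "hexp m h i = g i" if "i \<le> m" for i
    unfolding h_def by (rule hexp_sum_single [OF g_sum that])
  obtain Y where Y: "finite Y" "Y \<subseteq> NQ r"
    "\<And>u. u \<in> vecs {..<r} \<Longrightarrow> u \<in> dual_cone r \<sigma> \<longleftrightarrow> (\<forall>y\<in>Y. 0 \<le> pairing u y)"
    using cone_generators [OF sigma] by blast
  have "\<exists>X. finite X \<and> X \<subseteq> NQ r \<and> X \<subseteq> \<Delta> i \<and>
      (\<forall>u\<in>dual_cone r \<sigma>. \<forall>y\<in>\<Delta> i. \<exists>x\<in>X. pairing u x \<le> pairing u y)" if "i \<le> m" for i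
    using polyhedron_vertices [OF sigma D [OF that]] by metis
  then obtain X where X: "\<And>i. i \<le> m \<Longrightarrow> finite (X i)" "\<And>i. i \<le> m \<Longrightarrow> X i \<subseteq> NQ r"
    "\<And>i. i \<le> m \<Longrightarrow> X i \<subseteq> \<Delta> i"
    "\<And>i u y. i \<le> m \<Longrightarrow> u \<in> dual_cone r \<sigma> \<Longrightarrow> y \<in> \<Delta> i \<Longrightarrow> \<exists>x\<in>X i. pairing u x \<le> pairing u y"
    by metis
  define Z where "Z = ({0} \<times> Y) \<union> (\<Union>i\<le>m. {evec m i} \<times> X i)"
  have finZ: "finite Z" using Y(1) X(1) by (auto simp: Z_def)
  have ratZ: "entry (fst z) i \<in> \<rat> \<and> entry (snd z) i \<in> \<rat>" if "z \<in> Z" for z i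
    using that Y(2) X(2) by (fastforce simp: Z_def NQ_def entry_evec_rational)
  have posZ: "0 \<le> pairing h (fst z) + pairing u (snd z)" if z: "z \<in> Z" for z
  proof -
    consider y where "y \<in> Y" "z = (0, y)" | i x where "i \<le> m" "x \<in> X i" "z = (evec m i, x)"
      using z by (auto simp: Z_def)
    then show ?thesis
    proof cases
      case 1
      then show ?thesis using Y(3) [OF u] hs(2) by simp
    next
      case 2
      then have "x \<in> \<Delta> i" using X(3) by blast
      with 2 show ?thesis by (simp add: pairing_evec hexp_h g_pos)
    qed
  qed
  obtain q :: "nat \<Rightarrow> real" and hs' us where q: "\<And>n. 0 < q n"
    and mem: "\<And>n. hs' n \<in> vecs {1..m}" "\<And>n. us n \<in> vecs {..<r}"
    and pos: "\<And>n z. z \<in> Z \<Longrightarrow> 0 \<le> pairing (of_ivec (hs' n)) (fst z) + pairing (of_ivec (us n)) (snd z)"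
    and lim: "(\<lambda>n. (1 / q n) *\<^sub>R of_ivec (hs' n)) \<longlonglongrightarrow> h" "(\<lambda>n. (1 / q n) *\<^sub>R of_ivec (us n)) \<longlonglongrightarrow> u"
    using lattice_points_near_ray [OF finZ ratZ h u posZ] by blast
  have G: "(hs' n, us n) \<in> ?G" for n
  proof -
    have "of_ivec (us n) \<in> vecs {..<r}"
      using mem(2) [of n] by (auto simp: vecs_def in_keys_iff)
    moreover have "0 \<le> pairing (of_ivec (us n)) y" if "y \<in> Y" for y
      using pos [of "(0, y)" n] that by (auto simp: Z_def)
    ultimately have dual: "of_ivec (us n) \<in> dual_cone r \<sigma>"
      using Y(3) by blast
    have "0 \<le> real_of_int (hexp m (hs' n) i) + pairing (of_ivec (us n)) y" if i: "i \<le> m" "y \<in> \<Delta> i" for i y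
    proof -
      obtain x where x: "x \<in> X i" "pairing (of_ivec (us n)) x \<le> pairing (of_ivec (us n)) y"
        using X(4) [OF i(1) dual i(2)] by blast
      have "(evec m i, x) \<in> Z" using i x by (auto simp: Z_def)
      from pos [OF this, of n] x(2) show ?thesis
        using i by (simp add: pairing_evec hexp_of_ivec)
    qed
    with dual mem show ?thesis by (simp add: dual_lattice_points_iff)
  qed
  let ?x = "\<lambda>n. (1 / q n) *\<^sub>R local_exponent c m \<iota> (hs' n, us n)"
  have "?x n \<in> ?C" for n
    using q [of n] G by (intro convex_cone_hull_mul hull_inc) auto
  moreover have "?x \<longlonglongrightarrow> z"
  proof -
    have "(\<lambda>n. (1 / q n) *\<^sub>R fst (local_exponent c m \<iota> (hs' n, us n))) \<longlonglongrightarrow> v"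
    proof (rule tendsto_vecs [OF _ _ hs(1)])
      show "(1 / q n) *\<^sub>R fst (local_exponent c m \<iota> (hs' n, us n)) \<in> vecs {1..c}" for n
        by (auto simp: local_exponent_def vecs_def in_keys_iff entry_sum_single split: if_splits)
      fix j assume j: "j \<in> {1..c}"
      have "entry ((1 / q n) *\<^sub>R fst (local_exponent c m \<iota> (hs' n, us n))) j
          = pairing ((1 / q n) *\<^sub>R of_ivec (hs' n)) (evec m (\<iota> j))" for n
        using j iota_m(1) [OF j]
        by (simp add: local_exponent_def entry_sum_single pairing_scale_left pairing_evec hexp_of_ivec)
      moreover have "pairing h (evec m (\<iota> j)) = entry v j"
        using j iota_m(1) [OF j] by (simp add: pairing_evec hexp_h g_iota)
      ultimately show "(\<lambda>n. entry ((1 / q n) *\<^sub>R fst (local_exponent c m \<iota> (hs' n, us n))) j)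
          \<longlonglongrightarrow> entry v j"
        using tendsto_pairing [OF lim(1), of "evec m (\<iota> j)"] by simp
    qed simp
    from tendsto_Pair [OF this lim(2)] show ?thesis
      by (simp add: vu local_exponent_def scaleR_Pair)
  qed
  ultimately show "z \<in> closure ?C"
    unfolding closure_sequential by (intro exI [of _ ?x] conjI allI)
qed


section \<open>The values and the Newton--Okounkov cone\<close>

lemma single_nz: "x \<noteq> 0 \<Longrightarrow> Poly_Mapping.single k x \<noteq> 0"
  by (metis lookup_single_eq lookup_zero)

text \<open>
  A point \<open>\<Sum>\<^sub>j\<^sub>\<in>\<^sub>S s\<^sub>j e\<^sub>j\<close> of the cone \<open>\<tau>\<close> pairs with \<open>h\<close> through the exponents on \<open>S\<close> only.  So the weight
  of a monomial is a linear function of its local exponent.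
\<close>
lemma mat_exponent_local:
  assumes H: "finite H" and S: "S \<subset> {..m}" and iota: "bij_betw \<iota> {1..c} S"
    and A: "\<And>k. k < d \<Longrightarrow> A k = Phi H (\<Sum>j\<in>S. s k j *\<^sub>R evec m j, n k)"
    and a: "a \<in> vecs H"
  shows "mat_exponent d A a = weight_map d
    (\<lambda>k. (\<Sum>j=1..c. Poly_Mapping.single j (s k (\<iota> j)), n k)) (local_exponent c m \<iota> (total_exponent a))"
proof -
  have "pairing (of_ivec h) (\<Sum>j\<in>S. t j *\<^sub>R evec m j)
      = pairing (\<Sum>j=1..c. Poly_Mapping.single j (real_of_int (hexp m h (\<iota> j))))
          (\<Sum>j=1..c. Poly_Mapping.single j (t (\<iota> j)))" for h t
  proof -
    have "pairing (of_ivec h) (\<Sum>j\<in>S. t j *\<^sub>R evec m j) = (\<Sum>j\<in>S. t j * real_of_int (hexp m h j))"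
      unfolding pairing_sum_right pairing_scale_right
      by (rule sum.cong) (use S in \<open>auto simp: pairing_evec hexp_of_ivec\<close>)
    also have "\<dots> = (\<Sum>j=1..c. t (\<iota> j) * real_of_int (hexp m h (\<iota> j)))"
      by (rule sum.reindex_bij_betw [OF iota, symmetric])
    also have "\<dots> = pairing (\<Sum>j=1..c. Poly_Mapping.single j (real_of_int (hexp m h (\<iota> j))))
          (\<Sum>j=1..c. Poly_Mapping.single j (t (\<iota> j)))"
      by (subst pairing_superset [of "{1..c}"])
        (auto simp: in_keys_iff entry_sum_single mult.commute split: if_splits intro!: sum.cong)
    finally show ?thesis .
  qed
  then show ?thesis
    using mat_exponent_eq [where z = "\<lambda>k. (\<Sum>j\<in>S. s k j *\<^sub>R evec m j, n k)", OF H _ a] A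
    by (simp add: weight_map_def local_exponent_def)
qed

text \<open>
  The values are the weights of the local exponents of the characters in the dual of \<open>\<delta>\<close>: every
  section has a preimage with distinct weights, whose minimal weight is its value, and every such
  character is a section whose value is its own weight.
\<close>
lemma values_of_section_ring:
  assumes gen: "general_full_rank c m l" and S: "S \<subset> {..m}" "card S = c"
    and l: "\<And>i. i \<le> m \<Longrightarrow> l i \<in> homog {..c} 1"
    and nz: "\<And>i. i \<le> m \<Longrightarrow> l i \<noteq> 0"
    and c: "1 \<le> c"
    and sigma: "rational_polyhedral_cone r \<sigma>"
    and Delta: "\<And>i. i \<le> m \<Longrightarrow> sigma_polyhedron r \<sigma> (\<Delta> i)"
    and H: "hilbert_basis H (dual_lattice_points m r (delta_cone m \<sigma> \<Delta>))"
    and iota: "bij_betw \<iota> {1..c} S"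
    and weight: "\<And>a. a \<in> vecs H \<Longrightarrow> mat_exponent d A a = weight_map d R (local_exponent c m \<iota> (total_exponent a))"
    and R: "\<And>k j. k < d \<Longrightarrow> 0 \<le> entry (fst (R k)) j"
    and inj: "inj_on (weight_map d R) (vecs {1..c} \<times> vecs {..<r})"
  shows "valuation d m l H A ` (section_ring c m r \<sigma> l \<Delta> - {0})
    = weight_map d R ` local_exponent c m \<iota> ` dual_lattice_points m r (delta_cone m \<sigma> \<Delta>)"
proof -
  let ?G = "dual_lattice_points m r (delta_cone m \<sigma> \<Delta>)"
  let ?L = "local_exponent c m \<iota>" and ?V = "mat_exponent d A"
  have total_exponent_G: "total_exponent a \<in> ?G" if "a \<in> vecs H" for a
    using hilbert_basis_total_exponent [OF H] that by blast
  have L_vecs: "?L (total_exponent a) \<in> vecs {1..c} \<times> vecs {..<r}" if "a \<in> vecs H" for a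
  proof -
    obtain h u where hu: "total_exponent a = (h, u)" by (cases "total_exponent a")
    then have "u \<in> vecs {..<r}"
      using total_exponent_G [OF that] by (simp add: dual_lattice_points_iff)
    then show ?thesis
      by (auto simp: local_exponent_def hu vecs_def in_keys_iff entry_sum_single split: if_splits)
  qed
  have mono: "?V a \<le> ?V b" if ab: "a \<in> vecs H" "b \<in> vecs H" "snd (total_exponent a) = snd (total_exponent b)"
    "\<And>i. i \<in> S \<Longrightarrow> hexp m (fst (total_exponent a)) i \<le> hexp m (fst (total_exponent b)) i" for a b
  proof (rule rvec_le_if_entries_le)
    have "pairing (fst (?L (total_exponent a))) (fst (R k)) \<le> pairing (fst (?L (total_exponent b))) (fst (R k))"
      if k: "k < d" for k
    proof -
      have "pairing (fst (?L g)) (fst (R k))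
          = (\<Sum>j=1..c. real_of_int (hexp m (fst g) (\<iota> j)) * entry (fst (R k)) j)" for g
        by (subst pairing_superset [of "{1..c}"])
          (auto simp: local_exponent_def in_keys_iff entry_sum_single split: if_splits intro!: sum.cong)
      moreover have "\<iota> j \<in> S" if "j \<in> {1..c}" for j
        using bij_betwE [OF iota] that by blast
      ultimately show ?thesis
        using ab(4) by (auto intro!: sum_mono mult_right_mono R [OF k])
    qed
    then show "entry (?V a) k \<le> entry (?V b) k" for k
      using ab(3) by (simp add: weight ab(1,2) entry_weight_map local_exponent_def)
  qed
  have val: "valuation d m l H A (phi m l p) = Min (?V ` supp p)"
    if "p \<in> polys H" "p \<noteq> 0" "inj_on ?V (supp p)" for p
    unfolding pre_valuation_def [symmetric]
  proof (rule valuation_phi [OF gen S])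
    show "?V a \<le> ?V b" if "a \<in> vecs H" "b \<in> vecs H" "snd (total_exponent a) = snd (total_exponent b)"
      "\<And>i. i \<in> S \<Longrightarrow> hexp m (fst (total_exponent a)) i \<le> hexp m (fst (total_exponent b)) i" for a b
      using that by (rule mono)
  qed (use l nz that in auto)
  show ?thesis
  proof (intro equalityI subsetI)
    fix y assume "y \<in> valuation d m l H A ` (section_ring c m r \<sigma> l \<Delta> - {0})"
    then obtain f where f: "f \<in> section_ring c m r \<sigma> l \<Delta>" "f \<noteq> 0" "y = valuation d m l H A f"
      by blast
    obtain p where p: "p \<in> polys H" "phi m l p = f"
      "\<And>a b. a \<in> supp p \<Longrightarrow> b \<in> supp p \<Longrightarrow> snd (total_exponent a) = snd (total_exponent b) \<Longrightarrow>
       (\<And>i. i \<in> S \<Longrightarrow> hexp m (fst (total_exponent a)) i = hexp m (fst (total_exponent b)) i) \<Longrightarrow> a = b"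
      using section_ring_preimage [OF gen S l nz c sigma Delta H f(1)] by blast
    have vecs: "a \<in> vecs H" if "a \<in> supp p" for a
      using p(1) that by (auto simp: polys_def)
    have "p \<noteq> 0"
      using f(2) p(2) by (auto simp: phi_eq_insertion)
    moreover have "inj_on ?V (supp p)"
    proof (rule inj_onI)
      fix a b assume ab: "a \<in> supp p" "b \<in> supp p" "?V a = ?V b"
      have "?L (total_exponent a) = ?L (total_exponent b)"
        using ab(3) L_vecs [OF vecs] ab(1,2) by (intro inj_onD [OF inj]) (auto simp: weight vecs)
      then have L: "entry (fst (?L (total_exponent a))) j = entry (fst (?L (total_exponent b))) j"
        "of_ivec (snd (total_exponent a)) = of_ivec (snd (total_exponent b))" for j
        by (auto simp: local_exponent_def)
      have "entry (of_ivec (snd (total_exponent a))) i = entry (of_ivec (snd (total_exponent b))) i" for i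
        by (simp only: L(2))
      then have "snd (total_exponent a) = snd (total_exponent b)"
        by (intro poly_mapping_eqI) simp
      moreover have "hexp m (fst (total_exponent a)) i = hexp m (fst (total_exponent b)) i" if i: "i \<in> S" for i
      proof -
        obtain j where "j \<in> {1..c}" "i = \<iota> j"
          using bij_betw_imp_surj_on [OF iota] i by blast
        then show ?thesis
          using L(1) [of j] by (simp add: local_exponent_def entry_sum_single)
      qed
      ultimately show "a = b"
        using ab p(3) by blast
    qed
    ultimately have "y = Min (?V ` supp p)"
      using val [OF p(1)] f(3) p(2) by simp
    moreover have "supp p \<noteq> {}"
      using \<open>p \<noteq> 0\<close> sum_single_supp [of p] by auto
    ultimately have "y \<in> ?V ` supp p"
      by (simp add: Min_in)
    then show "y \<in> weight_map d R ` ?L ` ?G"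
      using vecs total_exponent_G weight by auto
  next
    fix y assume "y \<in> weight_map d R ` ?L ` ?G"
    then obtain g where g: "g \<in> ?G" "y = weight_map d R (?L g)"
      by blast
    then have "g \<in> total_exponent ` vecs H"
      by (simp only: hilbert_basis_total_exponent [OF H])
    then obtain a where a: "a \<in> vecs H" "total_exponent a = g"
      by (elim imageE) simp
    let ?p = "Poly_Mapping.single a (1::complex)"
    have phi: "phi m l ?p = Poly_Mapping.single (snd g) (laurent m l (fst g))"
      by (simp add: phi_eq_insertion phi.insertion_single monom_eval_generator [OF nz] a mult_single)
    have "laurent m l (fst g) \<noteq> 0"
      by (rule laurent_nonzero) (rule nz)
    then have "phi m l ?p \<noteq> 0"
      unfolding phi by (rule single_nz)
    moreover have "phi m l ?p \<in> section_ring c m r \<sigma> l \<Delta>"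
      using monomial_in_section_ring [OF l nz sigma Delta] g(1) by (simp add: phi)
    moreover have "valuation d m l H A (phi m l ?p) = y"
    proof -
      have "?p \<in> polys H" "?p \<noteq> 0"
        using a single_nz [of "1::complex" a] by (auto simp: polys_def)
      from val [OF this] show ?thesis
        using a g by (simp add: weight)
    qed
    ultimately show "y \<in> valuation d m l H A ` (section_ring c m r \<sigma> l \<Delta> - {0})"
      by (intro image_eqI [of _ _ "phi m l ?p"]) auto
  qed
qed

lemma scaleR_single: "a *\<^sub>R Poly_Mapping.single k b = Poly_Mapping.single k (a * b)"
  for b :: real
  by (rule poly_mapping_eqI) (simp add: lookup_single when_def)

lemma continuous_on_weight_map: "continuous_on A (weight_map d R)"
proof -
  have "weight_map d R = (\<lambda>x. \<Sum>k<d. (pairing (fst x) (fst (R k)) + pairing (snd x) (snd (R k)))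
      *\<^sub>R Poly_Mapping.single k 1)"
    by (simp add: weight_map_def scaleR_single fun_eq_iff)
  then show ?thesis
    by (simp only:) (intro continuous_intros)
qed

text \<open>
  On a coordinate space of finite dimension the inverse of a linear bijection is given by a finite
  sum of coordinate functions; this makes it a continuous linear map on the whole ambient space.
\<close>
lemma linear_inverse_on_vecs:
  fixes B :: "'a::real_normed_vector \<Rightarrow> rvec"
  assumes B: "linear B" and W: "subspace W" and bij: "bij_betw B W (vecs {..<d})"
  obtains f where "linear f" "continuous_on UNIV f" "\<And>x. x \<in> W \<Longrightarrow> f (B x) = x"
    "bij_betw f (vecs {..<d}) W"
proof -
  let ?g = "\<lambda>k. inv_into W B (Poly_Mapping.single k 1)"
  define f where "f y = (\<Sum>k<d. entry y k *\<^sub>R ?g k)" for y :: rvec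
  have g: "?g k \<in> W" "B (?g k) = Poly_Mapping.single k 1" if "k < d" for k
  proof -
    have "Poly_Mapping.single k 1 \<in> B ` W"
      using bij that by (simp add: bij_betw_def vecs_def)
    then show "?g k \<in> W" "B (?g k) = Poly_Mapping.single k 1"
      by (simp_all add: inv_into_into f_inv_into_f)
  qed
  have fW: "f y \<in> W" for y
    unfolding f_def by (intro subspace_sum [OF W] subspace_scale [OF W] g) simp
  have Bf: "B (f y) = y" if y: "y \<in> vecs {..<d}" for y
  proof -
    have "B (f y) = (\<Sum>k<d. entry y k *\<^sub>R Poly_Mapping.single k 1)"
      unfolding f_def by (simp add: linear_sum [OF B] linear_scale [OF B] g)
    then show ?thesis
      using vecs_expand [OF _ y] by simp
  qed
  have fB: "f (B x) = x" if x: "x \<in> W" for x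
  proof (rule inj_onD [OF bij_betw_imp_inj_on [OF bij]])
    show "B (f (B x)) = B x"
      by (rule Bf) (use bij x in \<open>auto simp: bij_betw_def\<close>)
  qed (use fW x in auto)
  show ?thesis
  proof (rule that [OF _ _ fB])
    show "linear f"
      by (rule linearI)
        (simp_all add: f_def lookup_add scaleR_add_left sum.distrib scaleR_sum_right)
    show "continuous_on UNIV f"
      unfolding f_def by (intro continuous_intros)
    show "bij_betw f (vecs {..<d}) W"
      by (rule bij_betw_byWitness [where f' = B]) (use Bf fB fW bij in \<open>auto simp: bij_betw_def\<close>)
  qed
qed

theorem corollary5p5:
  fixes c m r :: nat
    and \<sigma> \<tau> :: "rvec set" and \<Delta> :: "nat \<Rightarrow> rvec set"
    and l :: "nat \<Rightarrow> nat cpoly"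
    and w :: rvec
    and H :: "(ivec \<times> ivec) set"
    and A :: "nat \<Rightarrow> ((ivec \<times> ivec) \<Rightarrow>\<^sub>0 real)"
    and \<iota> :: "nat \<Rightarrow> nat"
  assumes c: "1 \<le> c"
    and sigma: "rational_polyhedral_cone r \<sigma>" "pointed \<sigma>"
    and Delta: "\<And>i. i \<le> m \<Longrightarrow> sigma_polyhedron r \<sigma> (\<Delta> i)"
    and proper: "(\<Sum>i\<le>m. \<Delta> i) \<subset> \<sigma>"
    and l: "\<And>i. i \<le> m \<Longrightarrow> l i \<in> hom_polys c 1"
    and arrangement: "general_full_rank c m l"
    and tau: "maximal_trop_cone m l \<tau>"
    and w: "w \<in> rel_interior \<tau>"
    and H: "hilbert_basis H (dual_lattice_points m r (delta_cone m \<sigma> \<Delta>))"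
    and A: "weight_matrix (c + r) r H \<tau> A"
    and iota: "bij_betw \<iota> {1..c} ({..m} - minimizing_indices m w)"
  shows "cones_isomorphic
           (vecs {..<c + r})
           (newton_okounkov_cone (section_ring c m r \<sigma> l \<Delta>) (valuation (c + r) m l H A))
           (vecs {1..c} \<times> vecs {..<r})
           {(v, u). v \<in> vecs {1..c} \<and> u \<in> dual_cone r \<sigma> \<and>
              ereal (\<Sum>i=1..c. Poly_Mapping.lookup v i)
                \<le> (\<Sum>j\<in>minimizing_indices m w. supp_val (\<Delta> j) u) \<and>
              (\<forall>j\<in>{1..c}. - supp_val (\<Delta> (\<iota> j)) u \<le> ereal (Poly_Mapping.lookup v j))}"
proof -
  let ?G = "dual_lattice_points m r (delta_cone m \<sigma> \<Delta>)" and ?W = "vecs {1..c} \<times> vecs {..<r} :: (rvec \<times> rvec) set"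
  obtain S where S: "S \<subset> {..m}" and tau_S: "\<tau> = convex_cone hull (evec m ` S)"
    using tau by (auto simp: maximal_trop_cone_def coordinate_cones_def)
  have finS: "finite S" using S finite_subset by blast
  have I: "minimizing_indices m w = {..m} - S"
    using minimizing_indices_rel_interior [OF S] w by (simp add: tau_S)
  have "{..m} - ({..m} - S) = S" using S by auto
  then have iota_S: "bij_betw \<iota> {1..c} S" using iota by (simp add: I)
  then have cardS: "card S = c" using bij_betw_same_card by fastforce
  have l': "l i \<in> homog {..c} 1" if "i \<le> m" for i
    using l [OF that] by (simp add: hom_polys_eq_homog)
  have nz: "l i \<noteq> 0" if i: "i \<le> m" for i
  proof -
    obtain k where k: "k \<le> m" "k \<notin> S" using S by auto
    define T where "T = insert (if i \<in> S then k else i) S"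
    have "T \<subseteq> {..m}" "card T = c + 1" "i \<in> T"
      using S i k finS cardS by (auto simp: T_def)
    then show ?thesis by (rule linear_form_nonzero [OF arrangement])
  qed
  have finH: "finite H" using H by (simp add: hilbert_basis_def)
  have "\<exists>s n. (\<forall>j\<in>S. 0 < s j) \<and> n \<in> vecs {..<r} \<and> A k = Phi H (\<Sum>j\<in>S. s j *\<^sub>R evec m j, n)"
    if k: "k < c + r" for k
  proof -
    obtain x n where x: "x \<in> rel_interior \<tau>" "n \<in> vecs {..<r}" "A k = Phi H (x, n)"
      using A k by (auto simp: weight_matrix_def)
    obtain s where "\<And>j. j \<in> S \<Longrightarrow> 0 < s j" "x = (\<Sum>j\<in>S. s j *\<^sub>R evec m j)"
      using rel_interior_cone_positive [OF finS] x(1) unfolding tau_S by blast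
    with x show ?thesis by blast
  qed
  then obtain s n where s: "\<And>k j. k < c + r \<Longrightarrow> j \<in> S \<Longrightarrow> 0 < s k j"
    and n: "\<And>k. k < c + r \<Longrightarrow> n k \<in> vecs {..<r}"
    and A_eq: "\<And>k. k < c + r \<Longrightarrow> A k = Phi H (\<Sum>j\<in>S. s k j *\<^sub>R evec m j, n k)"
    by metis
  define R where "R k = (\<Sum>j=1..c. Poly_Mapping.single j (s k (\<iota> j)), n k)" for k
  have R_vecs: "R k \<in> ?W" if "k < c + r" for k
    using n [OF that] by (auto simp: R_def vecs_def in_keys_iff entry_sum_single split: if_splits)
  have R_pos: "0 \<le> entry (fst (R k)) j" if "k < c + r" for k j
    using s [OF that] bij_betwE [OF iota_S] by (auto simp: R_def entry_sum_single less_imp_le)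
  have weight: "mat_exponent (c + r) A a = weight_map (c + r) R (local_exponent c m \<iota> (total_exponent a))"
    if "a \<in> vecs H" for a
    unfolding R_def by (rule mat_exponent_local [OF finH S iota_S A_eq that])
  \<comment> \<open>Through \<open>\<Psi>\<close> the independence of the rows of \<open>A\<close> becomes that of the vectors \<open>R k\<close>, which live
    in a space of dimension \<open>c + r\<close>.\<close>
  define \<Psi> where "\<Psi> z = Phi H (\<Sum>j=1..c. entry (fst z) j *\<^sub>R evec m (\<iota> j), snd z)" for z :: "rvec \<times> rvec"
  have "linear \<Psi>"
    by (rule linearI; rule poly_mapping_eqI)
      (simp_all add: \<Psi>_def entry_Phi [OF finH] lookup_add pairing_add_right pairing_sum_right
        pairing_scale_right sum.distrib sum_distrib_left algebra_simps)
  have \<Psi>_R: "\<Psi> (R k) = A k" if k: "k < c + r" for k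
  proof -
    have "(\<Sum>j=1..c. entry (fst (R k)) j *\<^sub>R evec m (\<iota> j)) = (\<Sum>j=1..c. s k (\<iota> j) *\<^sub>R evec m (\<iota> j))"
      by (rule sum.cong) (auto simp: R_def entry_sum_single)
    also have "\<dots> = (\<Sum>j\<in>S. s k j *\<^sub>R evec m j)"
      by (rule sum.reindex_bij_betw [OF iota_S])
    finally show ?thesis by (simp add: \<Psi>_def A_eq [OF k] R_def)
  qed
  have "inj_on (\<lambda>k. \<Psi> (R k)) {..<c + r} \<longleftrightarrow> inj_on A {..<c + r}"
    by (rule inj_on_cong) (use \<Psi>_R in auto)
  moreover have "(\<lambda>k. \<Psi> (R k)) ` {..<c + r} = A ` {..<c + r}"
    by (rule image_cong) (use \<Psi>_R in auto)
  ultimately have "inj_on (\<lambda>k. \<Psi> (R k)) {..<c + r}" "independent ((\<lambda>k. \<Psi> (R k)) ` {..<c + r})"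
    using A by (simp_all add: weight_matrix_def)
  from independent_preimages [OF \<open>linear \<Psi>\<close> finite_lessThan this]
  have bij: "bij_betw (weight_map (c + r) R) ?W (vecs {..<c + r})"
    by (intro bij_betw_weight_map R_vecs) auto
  let ?B = "weight_map (c + r) R" and ?P = "local_exponent c m \<iota> ` ?G"
  let ?D = "support_cone c r \<sigma> \<Delta> \<iota> ({..m} - S)"
  have vals: "valuation (c + r) m l H A ` (section_ring c m r \<sigma> l \<Delta> - {0}) = ?B ` ?P"
    by (rule values_of_section_ring [OF arrangement S cardS l' nz c sigma(1) Delta H iota_S weight R_pos
          bij_betw_imp_inj_on [OF bij]])
  obtain f where f: "linear f" "continuous_on UNIV f" "\<And>x. x \<in> ?W \<Longrightarrow> f (?B x) = x"
    "bij_betw f (vecs {..<c + r}) ?W"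
    using linear_inverse_on_vecs [OF linear_weight_map subspace_vecs_Times bij] by blast
  have sp: "\<forall>i\<in>({..m} - S) \<union> \<iota> ` {1..c}. sigma_polyhedron r \<sigma> (\<Delta> i)"
    using Delta S bij_betwE [OF iota_S] by auto
  have D_W: "?D \<subseteq> ?W"
    by (auto simp: support_cone_def dual_cone_def)
  have closed: "closed (?B ` ?D)"
  proof -
    have "?B ` ?D = vecs {..<c + r} \<inter> f -` ?D"
    proof (intro equalityI subsetI)
      fix y assume y: "y \<in> vecs {..<c + r} \<inter> f -` ?D"
      then obtain x where "x \<in> ?W" "y = ?B x"
        using bij_betw_imp_surj_on [OF bij] by blast
      with y f(3) show "y \<in> ?B ` ?D" by auto
    next
      fix y assume "y \<in> ?B ` ?D"
      then obtain x where x: "x \<in> ?D" "y = ?B x" by blast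
      then have "x \<in> ?W" using D_W by blast
      with x f(3) bij_betwE [OF bij] show "y \<in> vecs {..<c + r} \<inter> f -` ?D" by auto
    qed
    then show ?thesis
      using closed_Int [OF closed_vecs closed_vimage [OF closed_support_cone [OF sigma(1) _ sp] f(2)]]
      by simp
  qed
  have "closure (convex_cone hull (?B ` ?P)) = ?B ` ?D"
  proof
    have "?P \<subseteq> ?D"
      by (intro image_subsetI local_exponent_in_support_cone [OF sigma(1) _ S iota_S] Delta)
    moreover have "convex_cone ?D"
      by (rule convex_cone_support_cone [OF sigma(1) _ sp]) simp
    then have "convex_cone (?B ` ?D)"
      by (intro convex_cone_linear_image conjI linear_weight_map)
    ultimately show "closure (convex_cone hull (?B ` ?P)) \<subseteq> ?B ` ?D"
      by (intro closure_minimal hull_minimal image_mono closed)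
    have "?B ` closure (convex_cone hull ?P) \<subseteq> closure (?B ` (convex_cone hull ?P))"
      by (rule image_closure_subset [OF continuous_on_weight_map closed_closure closure_subset])
    moreover have "?D \<subseteq> closure (convex_cone hull ?P)"
      by (rule support_cone_subset_closure [OF sigma(1) _ S iota_S]) (rule Delta)
    ultimately show "?B ` ?D \<subseteq> closure (convex_cone hull (?B ` ?P))"
      unfolding convex_cone_hull_linear_image [OF linear_weight_map] by blast
  qed
  then have "f ` newton_okounkov_cone (section_ring c m r \<sigma> l \<Delta>) (valuation (c + r) m l H A) = f ` ?B ` ?D"
    by (simp add: newton_okounkov_cone_def vals)
  also have "\<dots> = ?D"
    using f(3) D_W by (force simp: image_image)
  finally show ?thesis
    using f(1,4) unfolding cones_isomorphic_def I support_cone_def by blast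
qed

end
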